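(* Let $\Omega\subset\mathbb{R}^N$ ($N\ge 2$) be piecewise $C^2$-concave, let $\Gamma=\partial\Omega$ be decomposed as $\Gamma=\overline{\Gamma_t}\cup\Gamma_n$ with $\Gamma_t$ relatively open and $\Gamma_n=\Gamma\setminus\overline{\Gamma_t}$, and let $v\in\mathring{H}^1_{t,n}(\Omega)$. Then $$\|\nabla v\|_{L^2(\Omega)}\le\sqrt{2}\,\|\operatorname{dev}\operatorname{sym}\nabla v\|_{L^2(\Omega)}.$$ If $\Omega$ is moreover a polyhedron, then $$\|\nabla v\|_{L^2(\Omega)}^2=2\|\operatorname{dev}\operatorname{sym}\nabla v\|_{L^2(\Omega)}^2+\frac{2-N}{N}\|\operatorname{div} v\|_{L^2(\Omega)}^2\le 2\|\operatorname{dev}\operatorname{sym}\nabla v\|_{L^2(\Omega)}^2,$$ and equality holds in the last inequality if and only if $\operatorname{div}v=0$ or $N=2$. In particular (since $|\operatorname{dev}\operatorname{sym}A|\le|\operatorname{sym}A|$), $\|\nabla v\|_{L^2(\Omega)}\le\sqrt2\,\|\operatorname{sym}\nabla v\|_{L^2(\Omega)}$.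
   Context: Let $2\le N\in\mathbb{N}$, $\Omega\subset\mathbb{R}^N$ open (not necessarily bounded) with boundary $\Gamma=\partial\Omega$. $\Omega$ is called piecewise $C^2$ if (i) $\Gamma$ is strongly Lipschitz (locally the graph of a Lipschitz function), and (ii) $\Gamma=\Gamma_0\cup\Gamma_1$ where $\Gamma_0$ has $(N-1)$-dimensional measure zero and $\Gamma_1$ is relatively open in $\Gamma$ and locally the graph of a $C^2$ function. On $\Gamma_1$ the exterior unit normal $\nu$ extends to a $C^1$ field near $\Gamma_1$, and $\nabla\nu$ restricted to tangent vectors is the second fundamental form. $\Omega$ is piecewise $C^2$-convex (resp. piecewise $C^2$-concave) if it is piecewise $C^2$ and this second fundamental form is positive (resp. negative) semi-definite at every point of $\Gamma_1$. A polyhedron is a piecewise $C^2$ domain whose part $\Gamma_1$ consists of relatively open pieces of hyperplanes (so $\nabla\nu=0$ on $\Gamma_1$); it is both piecewise $C^2$-convex and -concave. For a vector field $v$ on $\overline\Omega$ the normal and tangential traces are $v_n:=\nu\cdot v|_\Gamma$, $v_t:=v|_\Gamma-v_n\nu$ (defined a.e.). Let $C^\infty_c(\overline\Omega):=\{w|_\Omega: w\in C^\infty_c(\mathbb{R}^N)\}$ (componentwise for vector fields). Given relatively open $\Gamma_t\subset\Gamma$ and $\Gamma_n:=\Gamma\setminus\overline{\Gamma_t}$, set $C^\infty_{t,n}(\Omega):=\{v\in C^\infty_c(\overline\Omega)^N: v_t=0 \text{ on }\Gamma_t,\ v_n=0\text{ on }\Gamma_n\}$ and let $\mathring{H}^1_{t,n}(\Omega)$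 be its closure in $H^1(\Omega)^N$ (this includes full normal condition $\Gamma_t=\emptyset$ and full tangential condition $\Gamma_t=\Gamma$). Notation: $(\nabla v)_{ij}=\partial_i v_j$; for $A\in\mathbb{R}^{N\times N}$, $\operatorname{sym}A=\frac12(A+A^\top)$, $\operatorname{skw}A=\frac12(A-A^\top)$, $\operatorname{tr}A=\sum_iA_{ii}$, $\operatorname{dev}A=A-\frac{\operatorname{tr}A}{N}I$; $|A|$ is the Frobenius norm and $L^2$ norms of matrix fields use it. $\operatorname{div}v=\operatorname{tr}\nabla v$, and $\operatorname{rot}v\in\mathbb{R}^{N(N-1)/2}$ has components $\partial_iv_j-\partial_jv_i$, $i<j$ (so $|\operatorname{skw}\nabla v|^2=\frac12|\operatorname{rot}v|^2$). *)

theory Defs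
  imports "HOL-Analysis.Analysis"
begin

primrec Ck_on :: "nat \<Rightarrow> 'a::euclidean_space set \<Rightarrow> ('a \<Rightarrow> 'b::real_normed_vector) \<Rightarrow> bool" where
  "Ck_on 0 S f = continuous_on S f"
| "Ck_on (Suc k) S f = ((\<forall>x\<in>S. f differentiable (at x)) \<and>
                         (\<forall>u. Ck_on k S (\<lambda>x. frechet_derivative f (at x) u)))"

definition smooth :: "('a::euclidean_space \<Rightarrow> 'b::real_normed_vector) \<Rightarrow> bool" where
  "smooth f \<longleftrightarrow> (\<forall>k. Ck_on k UNIV f)"

definition compact_supp :: "('a::euclidean_space \<Rightarrow> 'b::real_normed_vector) \<Rightarrow> bool" where
  "compact_supp f \<longleftrightarrow> compact (closure {x. f x \<noteq> 0})"

definition pd :: "'n \<Rightarrow> (real^'n \<Rightarrow> 'b::real_normed_vector) \<Rightarrow> real^'n \<Rightarrow> 'b" where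
  "pd i f x = frechet_derivative f (at x) (axis i 1)"

definition grad :: "(real^'n \<Rightarrow> real) \<Rightarrow> real^'n \<Rightarrow> real^'n" where
  "grad g x = (\<chi> i. pd i g x)"

definition grad_mat :: "(real^'n \<Rightarrow> real^'n) \<Rightarrow> real^'n \<Rightarrow> real^'n^'n" where
  "grad_mat v x = (\<chi> i j. pd i v x $ j)"

definition symm :: "real^'n^'n \<Rightarrow> real^'n^'n" where
  "symm A = (1/2) *\<^sub>R (A + transpose A)"

definition dev :: "real^'n^'n \<Rightarrow> real^'n^'n" where
  "dev A = A - (trace A / real CARD('n)) *\<^sub>R mat 1"

(* (N-1)-dimensional (here: d-dimensional) Hausdorff null set *)
definition hnull :: "nat \<Rightarrow> 'a::metric_space set \<Rightarrow> bool" where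
  "hnull d S \<longleftrightarrow> (\<forall>\<epsilon>>0. \<exists>C::nat \<Rightarrow> 'a set. S \<subseteq> (\<Union>i. C i) \<and> (\<forall>i. bounded (C i)) \<and>
        summable (\<lambda>i. diameter (C i) ^ d) \<and> (\<Sum>i. diameter (C i) ^ d) < \<epsilon>)"

definition local_subgraph :: "(real^'n) set \<Rightarrow> real^'n \<Rightarrow> real^'n \<Rightarrow> real \<Rightarrow> (real^'n \<Rightarrow> real) \<Rightarrow> bool" where
  "local_subgraph \<Omega> x e r g \<longleftrightarrow> norm e = 1 \<and> r > 0 \<and> (\<forall>y t. g (y + t *\<^sub>R e) = g y) \<and>
      \<Omega> \<inter> ball x r = {y \<in> ball x r. y \<bullet> e < g y}"

definition strongly_lipschitz :: "(real^'n) set \<Rightarrow> bool" where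
  "strongly_lipschitz \<Omega> \<longleftrightarrow> (\<forall>x\<in>frontier \<Omega>. \<exists>e r g L. local_subgraph \<Omega> x e r g \<and>
      (\<forall>y z. \<bar>g y - g z\<bar> \<le> L * norm (y - z)))"

(* Omega is piecewise C^2 with regular part Gamma1 (Gamma0 = frontier - Gamma1 is
   H^{N-1}-null) and nu a C^1 field on an open neighbourhood of Gamma1 which is the
   exterior unit normal on Gamma1 *)
definition pw_C2 :: "(real^'n) set \<Rightarrow> (real^'n) set \<Rightarrow> (real^'n \<Rightarrow> real^'n) \<Rightarrow> bool" where
  "pw_C2 \<Omega> \<Gamma>1 \<nu> \<longleftrightarrow> open \<Omega> \<and> strongly_lipschitz \<Omega> \<and>
     \<Gamma>1 \<subseteq> frontier \<Omega> \<and> openin (top_of_set (frontier \<Omega>)) \<Gamma>1 \<and>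
     hnull (CARD('n) - 1) (frontier \<Omega> - \<Gamma>1) \<and>
     (\<forall>x\<in>\<Gamma>1. \<exists>e r g. local_subgraph \<Omega> x e r g \<and> Ck_on 2 (ball x r) g \<and>
         (\<forall>y\<in>frontier \<Omega> \<inter> ball x r. \<nu> y = (1 / norm (e - grad g y)) *\<^sub>R (e - grad g y))) \<and>
     (\<exists>U. open U \<and> \<Gamma>1 \<subseteq> U \<and> Ck_on 1 U \<nu>)"

(* second fundamental form  tau^T (nabla nu) tau  for tangent tau *)
definition pw_C2_concave :: "(real^'n) set \<Rightarrow> (real^'n) set \<Rightarrow> (real^'n \<Rightarrow> real^'n) \<Rightarrow> bool" where
  "pw_C2_concave \<Omega> \<Gamma>1 \<nu> \<longleftrightarrow> pw_C2 \<Omega> \<Gamma>1 \<nu> \<and>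
     (\<forall>x\<in>\<Gamma>1. \<forall>\<tau>. \<tau> \<bullet> \<nu> x = 0 \<longrightarrow> frechet_derivative \<nu> (at x) \<tau> \<bullet> \<tau> \<le> 0)"

definition polyhedral_domain :: "(real^'n) set \<Rightarrow> (real^'n) set \<Rightarrow> (real^'n \<Rightarrow> real^'n) \<Rightarrow> bool" where
  "polyhedral_domain \<Omega> \<Gamma>1 \<nu> \<longleftrightarrow> pw_C2 \<Omega> \<Gamma>1 \<nu> \<and>
     (\<forall>x\<in>\<Gamma>1. \<exists>r>0. \<exists>a c. a \<noteq> 0 \<and> frontier \<Omega> \<inter> ball x r = {y \<in> ball x r. a \<bullet> y = c})"

(* C^infty_{t,n}(Omega): (restrictions of) smooth compactly supported fields with
   v_t = 0 on Gamma_t, v_n = 0 on Gamma_n (a.e., i.e. on the regular part Gamma1) *)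
definition Cinf_tn :: "(real^'n) set \<Rightarrow> (real^'n) set \<Rightarrow> (real^'n \<Rightarrow> real^'n) \<Rightarrow> (real^'n) set
    \<Rightarrow> (real^'n \<Rightarrow> real^'n) set" where
  "Cinf_tn \<Omega> \<Gamma>1 \<nu> \<Gamma>t = {v. smooth v \<and> compact_supp v \<and>
     (\<forall>x\<in>\<Gamma>1 \<inter> \<Gamma>t. v x - (\<nu> x \<bullet> v x) *\<^sub>R \<nu> x = 0) \<and>
     (\<forall>x\<in>\<Gamma>1 \<inter> (frontier \<Omega> - closure \<Gamma>t). \<nu> x \<bullet> v x = 0)}"

definition L2 :: "(real^'n) set \<Rightarrow> (real^'n \<Rightarrow> 'b::euclidean_space) \<Rightarrow> bool" where
  "L2 \<Omega> f \<longleftrightarrow> f \<in> borel_measurable (lebesgue_on \<Omega>) \<and>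
     integrable (lebesgue_on \<Omega>) (\<lambda>x. (norm (f x))\<^sup>2)"

definition sqnorm :: "(real^'n) set \<Rightarrow> (real^'n \<Rightarrow> 'b::euclidean_space) \<Rightarrow> real" where
  "sqnorm \<Omega> f = integral\<^sup>L (lebesgue_on \<Omega>) (\<lambda>x. (norm (f x))\<^sup>2)"

definition weak_grad :: "(real^'n) set \<Rightarrow> (real^'n \<Rightarrow> real^'n) \<Rightarrow> (real^'n \<Rightarrow> real^'n^'n) \<Rightarrow> bool" where
  "weak_grad \<Omega> v G \<longleftrightarrow> (\<forall>\<phi>::real^'n \<Rightarrow> real. smooth \<phi> \<and> compact_supp \<phi> \<and>
       closure {x. \<phi> x \<noteq> 0} \<subseteq> \<Omega> \<longrightarrow>
     (\<forall>i j. integral\<^sup>L (lebesgue_on \<Omega>) (\<lambda>x. v x $ j * pd i \<phi> x) =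
            - integral\<^sup>L (lebesgue_on \<Omega>) (\<lambda>x. G x $ i $ j * \<phi> x)))"

definition H1_tn :: "(real^'n) set \<Rightarrow> (real^'n) set \<Rightarrow> (real^'n \<Rightarrow> real^'n) \<Rightarrow> (real^'n) set
    \<Rightarrow> (real^'n \<Rightarrow> real^'n) set" where
  "H1_tn \<Omega> \<Gamma>1 \<nu> \<Gamma>t = {v. L2 \<Omega> v \<and> (\<exists>G. weak_grad \<Omega> v G \<and> L2 \<Omega> G \<and>
     (\<exists>\<phi>::nat \<Rightarrow> real^'n \<Rightarrow> real^'n. (\<forall>k. \<phi> k \<in> Cinf_tn \<Omega> \<Gamma>1 \<nu> \<Gamma>t) \<and>
        (\<lambda>k. sqnorm \<Omega> (\<lambda>x. \<phi> k x - v x)) \<longlonglongrightarrow> 0 \<and>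
        (\<lambda>k. sqnorm \<Omega> (\<lambda>x. grad_mat (\<phi> k) x - G x)) \<longlonglongrightarrow> 0))}"

end

theory Submission
  imports Defs
begin

text \<open>For a smooth field \<open>v\<close> put \<open>w = (div v) v - (v \<cdot> \<nabla>) v\<close>, so that \<open>div w = (tr \<nabla>v)\<^sup>2 - tr (\<nabla>v \<nabla>v)\<close>. Pointwise,
  \<open>|A|\<^sup>2 = 2 |dev sym A|\<^sup>2 + (2 - N)/N (tr A)\<^sup>2 + ((tr A)\<^sup>2 - tr (A A))\<close>, so everything reduces to the sign of
  \<open>\<integral> div w\<close>. On \<open>\<Gamma>\<^sub>1\<close> the boundary conditions turn \<open>w \<cdot> \<nu>\<close> into a value of the second fundamental form
  or \<open>v\<^sub>n\<^sup>2\<close> times its trace; on the relative boundary of \<open>\<Gamma>\<^sub>t\<close>, where no condition is imposed, the sign follows by continuity.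

  Surface measure is avoided: in a chart, \<open>\<Omega>\<close> is approximated by \<open>C\<^sup>1\<close> functions of \<open>(g(y) - y \<cdot> e) / \<epsilon>\<close>, and
  the mass of the boundary strip is bounded by integrating by parts once more in the direction \<open>e\<close>. Since
  only the sign of the flux is needed, charts can be patched by nonnegative cutoffs, and the null set
  \<open>\<Gamma>\<^sub>0\<close> is cut off by small balls.\<close>

subsection \<open>Compactly supported \<open>C\<^sup>1\<close> fields\<close>

text \<open>In div w the terms with second derivatives of v cancel by their symmetry, so the
  integrated form is quadratic in \<nabla>v alone. Its integral is therefore continuous in \<nabla>v
  with respect to L2, and a sign known for smooth fields survives the passage to the closure. The
  equality for polyhedra needs no separate Gauss formula: there the second fundamental form
  vanishes, so the inequality holds for w and for -w; this is why the boundary lemmas carry a factor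
  \<open>\<sigma>\<close>. A further obstacle is that the theorem speaks of an arbitrary square
  integrable weak gradient G, while \<open>H1_tn\<close> provides some weak gradient H as an L2
  limit. Identifying the two takes the fundamental lemma of the calculus of variations, hence smooth
  test functions built from exp (-1/t). Fields and cutoffs are handled through \<open>C1_on\<close>:
  the derivative is an explicit map, continuous direction by direction, which in finite dimension
  amounts to continuity in operator norm and matches the shape of \<open>Ck_on\<close>.\<close>

definition C1_on :: "'a::euclidean_space set \<Rightarrow> ('a \<Rightarrow> 'b::real_normed_vector) \<Rightarrow> ('a \<Rightarrow> 'a \<Rightarrow> 'b) \<Rightarrow> bool" where
  "C1_on S f f' \<longleftrightarrow> (\<forall>x\<in>S. (f has_derivative f' x) (at x)) \<and> (\<forall>u. continuous_on S (\<lambda>x. f' x u))"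

definition divergence :: "('a::euclidean_space \<Rightarrow> 'a) \<Rightarrow> real" where
  "divergence A = (\<Sum>b\<in>Basis. A b \<bullet> b)"

lemma C1_onI:
  assumes "\<And>x. x \<in> S \<Longrightarrow> (f has_derivative f' x) (at x)"
    and "\<And>u. continuous_on S (\<lambda>x. f' x u)"
  shows "C1_on S f f'"
  using assms by (auto simp: C1_on_def)

lemma C1_on_derivative: "C1_on S f f' \<Longrightarrow> x \<in> S \<Longrightarrow> (f has_derivative f' x) (at x)"
  by (auto simp: C1_on_def)

lemma C1_on_continuous_derivative: "C1_on S f f' \<Longrightarrow> continuous_on S (\<lambda>x. f' x u)"
  by (auto simp: C1_on_def)

lemma C1_on_linear: "C1_on S f f' \<Longrightarrow> x \<in> S \<Longrightarrow> linear (f' x)"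
  using C1_on_derivative has_derivative_linear by blast

lemma C1_on_subset: "C1_on S f f' \<Longrightarrow> T \<subseteq> S \<Longrightarrow> C1_on T f f'"
  by (auto simp: C1_on_def intro: continuous_on_subset)

lemma C1_on_continuous: "C1_on S f f' \<Longrightarrow> continuous_on S f"
  by (meson C1_on_derivative continuous_at_imp_continuous_on has_derivative_continuous)

lemma C1_on_scaleR:
  assumes "C1_on S h h'" and "C1_on S w w'"
  shows "C1_on S (\<lambda>x. h x *\<^sub>R w x) (\<lambda>x u. h x *\<^sub>R w' x u + h' x u *\<^sub>R w x)"
proof (rule C1_onI)
  fix x assume "x \<in> S"
  then show "((\<lambda>x. h x *\<^sub>R w x) has_derivative (\<lambda>u. h x *\<^sub>R w' x u + h' x u *\<^sub>R w x)) (at x)"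
    using assms by (intro has_derivative_scaleR C1_on_derivative)
next
  fix u
  show "continuous_on S (\<lambda>x. h x *\<^sub>R w' x u + h' x u *\<^sub>R w x)"
    using assms by (intro continuous_intros C1_on_continuous C1_on_continuous_derivative)
qed

lemma C1_on_inner_const:
  assumes "C1_on S w w'"
  shows "C1_on S (\<lambda>x. w x \<bullet> b) (\<lambda>x u. w' x u \<bullet> b)"
proof (rule C1_onI)
  fix x assume "x \<in> S"
  then show "((\<lambda>x. w x \<bullet> b) has_derivative (\<lambda>u. w' x u \<bullet> b)) (at x)"
    using assms by (intro has_derivative_inner_left C1_on_derivative)
qed (use assms in \<open>intro continuous_intros C1_on_continuous_derivative\<close>)

text \<open>On \<open>S - K\<close> the given derivative must be zero by uniqueness, so the pasted
  derivative is continuous on each of the open sets \<open>S\<close> and \<open>- K\<close>, which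
  cover the space. This turns a product with a chart function, differentiable only in a ball, into a
  global field.\<close>

lemma C1_on_extend:
  assumes "open S" "closed K" "K \<subseteq> S" "\<And>x. f x \<noteq> 0 \<Longrightarrow> x \<in> K" and f: "C1_on S f f'"
  shows "C1_on UNIV f (\<lambda>x. if x \<in> S then f' x else (\<lambda>_. 0))"
proof -
  have d0: "(f has_derivative (\<lambda>_. 0)) (at x)" if "x \<in> - K" for x
  proof (rule has_derivative_transform_within_open[where f="\<lambda>_. 0" and s="-K"])
    show "0 = f y" if "y \<in> -K" for y using assms(4) that by force
  qed (use assms that in auto)
  have f'0: "f' x u = 0" if "x \<in> S" "x \<notin> K" for x u
    using has_derivative_unique[OF C1_on_derivative[OF f that(1)] d0] that by auto
  show ?thesis
  proof (rule C1_onI)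
    fix x show "(f has_derivative (if x \<in> S then f' x else (\<lambda>_. 0))) (at x)"
      using d0 C1_on_derivative[OF f] assms(3) by (cases "x \<in> S") auto
  next
    fix u
    let ?g = "\<lambda>x. (if x \<in> S then f' x else (\<lambda>_. 0)) u"
    have "continuous_on S ?g"
      using C1_on_continuous_derivative[OF f, of u] by (simp cong: continuous_on_cong)
    moreover have "continuous_on (-K) ?g"
      by (rule continuous_on_eq[where f="\<lambda>_. 0"]) (auto simp: f'0)
    ultimately have "continuous_on (S \<union> -K) ?g"
      using assms by (intro continuous_on_open_Un) auto
    moreover have "S \<union> -K = UNIV" using assms by auto
    ultimately show "continuous_on UNIV ?g" by simp
  qed
qed

lemma C1_derivative_zero_outside:
  assumes "C1_on UNIV f f'" "closed K" "\<And>x. f x \<noteq> 0 \<Longrightarrow> x \<in> K" "x \<notin> K"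
  shows "f' x u = 0"
proof -
  have "(f has_derivative (\<lambda>_. 0)) (at x)"
  proof (rule has_derivative_transform_within_open[where f="\<lambda>_. 0" and s="-K"])
    show "0 = f y" if "y \<in> -K" for y using assms(3) that by force
  qed (use assms in auto)
  then show ?thesis
    using has_derivative_unique C1_on_derivative[OF assms(1)] by (metis UNIV_I)
qed

lemma divergence_zero: "(\<And>u. A u = 0) \<Longrightarrow> divergence A = 0"
  by (simp add: divergence_def)

text \<open>Pointwise form of the product rule for div (h w): by linearity of \<open>h'\<close>, the
  basis expansion of \<open>w\<close> collapses the second sum.\<close>

lemma divergence_scaleR:
  assumes "linear h'"
  shows "divergence (\<lambda>u. c *\<^sub>R A u + h' u *\<^sub>R w) = c * divergence A + h' w"
proof -
  have "h' w = h' (\<Sum>b\<in>Basis. (w \<bullet> b) *\<^sub>R b)" by (simp add: euclidean_representation)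
  also have "\<dots> = (\<Sum>b\<in>Basis. h' b * (w \<bullet> b))"
    using assms by (simp add: linear_sum linear_scale mult.commute)
  finally show ?thesis
    by (simp add: divergence_def inner_add_left sum.distrib sum_distrib_left)
qed

lemma continuous_on_divergence:
  "C1_on S w w' \<Longrightarrow> continuous_on S (\<lambda>x. divergence (w' x))"
  unfolding divergence_def by (intro continuous_intros C1_on_continuous_derivative)

lemma continuous_supported_bounded:
  fixes f :: "'a::euclidean_space \<Rightarrow> real"
  assumes "continuous_on UNIV f" "compact K" "\<And>x. f x \<noteq> 0 \<Longrightarrow> x \<in> K"
  obtains M where "M \<ge> 0" "\<And>x. \<bar>f x\<bar> \<le> M"
proof -
  have "bounded (f ` K)"
    using assms by (meson compact_continuous_image compact_imp_bounded continuous_on_subset subset_UNIV)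
  then obtain M where M: "\<And>x. x \<in> K \<Longrightarrow> \<bar>f x\<bar> \<le> M" by (auto simp: bounded_iff)
  show ?thesis
  proof (rule that[of "max 0 M"])
    show "\<bar>f x\<bar> \<le> max 0 M" for x
      using M[of x] assms(3)[of x] by (cases "f x = 0") auto
  qed simp
qed

lemma integrable_continuous_supported:
  fixes f :: "'a::euclidean_space \<Rightarrow> real"
  assumes "continuous_on UNIV f" "compact K" "\<And>x. f x \<noteq> 0 \<Longrightarrow> x \<in> K"
  shows "integrable lborel f"
proof -
  have "integrable lborel (\<lambda>x. indicator K x *\<^sub>R f x)"
    using assms by (intro borel_integrable_compact) (auto intro: continuous_on_subset)
  moreover have "(\<lambda>x. indicator K x *\<^sub>R f x) = f"
    using assms(3) by (force simp: fun_eq_iff indicator_def)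
  ultimately show ?thesis by simp
qed

lemma integrable_indicator_supported:
  fixes f :: "'a::euclidean_space \<Rightarrow> real"
  assumes "continuous_on UNIV f" "compact K" "\<And>x. f x \<noteq> 0 \<Longrightarrow> x \<in> K" "open S"
  shows "integrable lborel (\<lambda>x. indicator S x * f x)"
  using integrable_mult_indicator[OF _ integrable_continuous_supported[OF assms(1-3)], of S] assms(4)
  by simp

lemma C1_on_line:
  fixes f :: "'a::euclidean_space \<Rightarrow> real"
  assumes "C1_on S f f'" "x + s *\<^sub>R u \<in> S"
  shows "((\<lambda>s. f (x + s *\<^sub>R u)) has_real_derivative f' (x + s *\<^sub>R u) u) (at s)"
proof -
  have "((\<lambda>s. x + s *\<^sub>R u) has_derivative (\<lambda>s. s *\<^sub>R u)) (at s)"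
    by (auto intro!: derivative_eq_intros)
  then have "((\<lambda>s. f (x + s *\<^sub>R u)) has_derivative (\<lambda>t. f' (x + s *\<^sub>R u) (t *\<^sub>R u))) (at s)"
    by (rule has_derivative_compose) (use C1_on_derivative[OF assms] in simp)
  moreover have "(\<lambda>t. f' (x + s *\<^sub>R u) (t *\<^sub>R u)) = (*) (f' (x + s *\<^sub>R u) u)"
    using linear_scale[OF C1_on_linear[OF assms]] by (auto simp: mult.commute)
  ultimately show ?thesis by (simp add: has_field_derivative_def)
qed

text \<open>The difference quotients of a compactly supported function have integral zero by translation
  invariance, and converge boundedly to the directional derivative.\<close>

lemma integral_derivative_zero:
  fixes f :: "'a::euclidean_space \<Rightarrow> real"
  assumes C: "C1_on UNIV f f'" and "compact K" and K: "\<And>x. f x \<noteq> 0 \<Longrightarrow> x \<in> K"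
  shows "(\<integral>x. f' x u \<partial>lborel) = 0"
proof -
  have f'K: "f' x u \<noteq> 0 \<Longrightarrow> x \<in> K" for x
    using C1_derivative_zero_outside[OF C _ K] \<open>compact K\<close> compact_imp_closed by metis
  obtain M where M: "M \<ge> 0" "\<And>x. \<bar>f' x u\<bar> \<le> M"
    using continuous_supported_bounded[OF C1_on_continuous_derivative[OF C] \<open>compact K\<close> f'K] by metis
  obtain R where R: "R > 0" "K \<subseteq> cball 0 R"
    using bounded_subset_ballD[OF compact_imp_bounded[OF \<open>compact K\<close>], of 0] ball_subset_cball by blast
  \<comment> \<open>Difference quotients with increment \<open>1 / real (Suc n)\<close>. As the
    increment is at most 1, all of them vanish outside the ball of radius \<open>R + norm u\<close>,
    which gives a common dominating function.\<close>
  define q where "q n x = (f (x + (1 / real (Suc n)) *\<^sub>R u) - f x) * real (Suc n)" for n x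
  have fint: "integrable lborel f"
    by (rule integrable_continuous_supported[OF C1_on_continuous[OF C] \<open>compact K\<close> K])
  have f_bm: "f \<in> borel_measurable borel"
    using C1_on_continuous[OF C] by (simp add: borel_measurable_continuous_onI)
  have shift: "integrable lborel (\<lambda>x. f (x + c))" "(\<integral>x. f (x + c) \<partial>lborel) = (\<integral>x. f x \<partial>lborel)" for c
  proof -
    have l: "lborel = distr lborel borel ((+) c)" by (simp add: lborel_distr_plus)
    show "integrable lborel (\<lambda>x. f (x + c))"
      using fint by (subst (asm) l, subst (asm) integrable_distr_eq) (auto simp: f_bm add.commute)
    show "(\<integral>x. f (x + c) \<partial>lborel) = (\<integral>x. f x \<partial>lborel)"
      by (subst (2) l, subst integral_distr) (auto simp: f_bm add.commute)
  qed
  have q0: "(\<integral>x. q n x \<partial>lborel) = 0" for n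
    unfolding q_def using shift fint by simp
  have "(\<lambda>n. \<integral>x. q n x \<partial>lborel) \<longlonglongrightarrow> (\<integral>x. f' x u \<partial>lborel)"
  proof (rule integral_dominated_convergence[where w="\<lambda>x. M * indicator (cball 0 (R + norm u)) x"])
    show "(\<lambda>x. f' x u) \<in> borel_measurable lborel"
      using C1_on_continuous_derivative[OF C] by (simp add: borel_measurable_continuous_onI)
    show "q n \<in> borel_measurable lborel" for n
      unfolding q_def using shift(1) fint by (intro borel_measurable_times borel_measurable_diff) auto
    show "integrable lborel (\<lambda>x. M * indicator (cball 0 (R + norm u)) x :: real)"
      by (intro integrable_mult_right) (auto intro!: integrable_real_indicator emeasure_compact_finite)
    show "AE x in lborel. (\<lambda>n. q n x) \<longlonglongrightarrow> f' x u"
    proof (intro AE_I2)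
      fix x
      have "((\<lambda>s. f (x + s *\<^sub>R u)) has_real_derivative f' x u) (at 0)"
        using C1_on_line[OF C, of x 0 u] by simp
      then have "((\<lambda>h. (f (x + h *\<^sub>R u) - f x) / h) \<longlongrightarrow> f' x u) (at 0)"
        by (simp add: DERIV_def)
      moreover have "filterlim (\<lambda>n. 1 / real (Suc n)) (at 0) sequentially"
        using LIMSEQ_Suc[OF lim_1_over_n[where 'a=real]] by (auto simp: filterlim_at intro!: always_eventually)
      ultimately have "(\<lambda>n. (f (x + (1 / real (Suc n)) *\<^sub>R u) - f x) / (1 / real (Suc n))) \<longlonglongrightarrow> f' x u"
        by (rule filterlim_compose)
      then show "(\<lambda>n. q n x) \<longlonglongrightarrow> f' x u" by (simp add: q_def)
    qed
    show "AE x in lborel. norm (q n x) \<le> M * indicator (cball 0 (R + norm u)) x" for n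
    proof (intro AE_I2)
      fix x
      define t where "t = 1 / real (Suc n)"
      have t: "t > 0" "t \<le> 1" by (auto simp: t_def)
      \<comment> \<open>The mean value theorem bounds the quotient by the same \<open>M\<close> as
        the derivative.\<close>
      have "\<exists>s. 0 < s \<and> s < t \<and> f (x + t *\<^sub>R u) - f (x + 0 *\<^sub>R u) = (t - 0) * f' (x + s *\<^sub>R u) u"
      proof (rule MVT2[where f="\<lambda>s. f (x + s *\<^sub>R u)" and f'="\<lambda>s. f' (x + s *\<^sub>R u) u", OF t(1)])
        fix s
        show "DERIV (\<lambda>s. f (x + s *\<^sub>R u)) s :> f' (x + s *\<^sub>R u) u"
          by (rule C1_on_line[OF C]) simp
      qed
      then obtain s where "f (x + t *\<^sub>R u) - f x = t * f' (x + s *\<^sub>R u) u" by auto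
      then have "q n x = f' (x + s *\<^sub>R u) u" by (simp add: q_def t_def)
      then have b: "\<bar>q n x\<bar> \<le> M" using M by simp
      show "norm (q n x) \<le> M * indicator (cball 0 (R + norm u)) x"
      proof (cases "x \<in> cball 0 (R + norm u)")
        case False
        then have nx: "norm x > R + norm u" by simp
        have "norm (t *\<^sub>R u) \<le> norm u" using t by (simp add: mult_left_le_one_le)
        moreover have "norm x \<le> norm (x + t *\<^sub>R u) + norm (t *\<^sub>R u)"
          by (metis add_diff_cancel_right' norm_triangle_ineq4)
        ultimately have "norm (x + t *\<^sub>R u) > R" using nx by linarith
        then have "f (x + t *\<^sub>R u) = 0" using K R by (metis in_mono mem_cball_0 not_less)
        moreover have "norm x > R" using nx norm_ge_zero[of u] by linarith
        then have "f x = 0" using K R by (metis in_mono mem_cball_0 not_less)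
        ultimately show ?thesis using False by (simp add: q_def t_def)
      qed (use b in simp)
    qed
  qed
  then show ?thesis using q0 by (simp add: LIMSEQ_const_iff)
qed

lemma integral_divergence_zero:
  fixes w :: "'a::euclidean_space \<Rightarrow> 'a"
  assumes C: "C1_on UNIV w w'" and "compact K" and K: "\<And>x. w x \<noteq> 0 \<Longrightarrow> x \<in> K"
  shows "(\<integral>x. divergence (w' x) \<partial>lborel) = 0"
proof -
  have w0: "w' x u \<noteq> 0 \<Longrightarrow> x \<in> K" for x u
    using C1_derivative_zero_outside[OF C _ K] \<open>compact K\<close> compact_imp_closed by metis
  have z: "(\<integral>x. w' x b \<bullet> b \<partial>lborel) = 0" for b
    using K by (intro integral_derivative_zero[OF C1_on_inner_const[OF C] \<open>compact K\<close>]) force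
  have i: "integrable lborel (\<lambda>x. w' x b \<bullet> b)" for b
    using w0
    by (intro integrable_continuous_supported[OF C1_on_continuous_derivative[OF C1_on_inner_const[OF C]] \<open>compact K\<close>])
      (metis inner_zero_left)
  show ?thesis unfolding divergence_def using z i by (subst Bochner_Integration.integral_sum) auto
qed

section \<open>Piecewise quadratic steps and radial cutoffs\<close>

definition plus2 :: "real \<Rightarrow> real" where "plus2 t = (max 0 t)\<^sup>2"

lemma plus2_deriv: "(plus2 has_real_derivative 2 * max 0 t) (at t)"
proof -
  consider "t < 0" | "t > 0" | "t = 0" by linarith
  then show ?thesis
  proof cases
    case 1
    have "((\<lambda>_. 0) has_real_derivative 2 * max 0 t) (at t)" using 1 by simp
    then show ?thesis
      by (rule has_field_derivative_transform_within_open[where S="{..<0}"]) (use 1 in \<open>auto simp: plus2_def\<close>)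
  next
    case 2
    have "((\<lambda>t. t\<^sup>2) has_real_derivative 2 * max 0 t) (at t)" using 2 by (auto intro!: derivative_eq_intros)
    then show ?thesis
      by (rule has_field_derivative_transform_within_open[where S="{0<..}"]) (use 2 in \<open>auto simp: plus2_def\<close>)
  next
    case 3
    have "((\<lambda>h. plus2 h / h) \<longlongrightarrow> 0) (at 0)"
    proof (rule Lim_null_comparison[where g="\<lambda>h. \<bar>h\<bar>"])
      show "\<forall>\<^sub>F h in at 0. norm (plus2 h / h) \<le> \<bar>h\<bar>"
        by (auto simp: plus2_def max_def power2_eq_square intro!: always_eventually)
      show "((\<lambda>h::real. \<bar>h\<bar>) \<longlongrightarrow> 0) (at 0)" by (rule tendsto_eq_intros | simp)+
    qed
    then show ?thesis using 3 by (simp add: DERIV_def plus2_def)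
  qed
qed

text \<open>A quadratic spline with knots 0, 1/2 and 1: a second difference of \<open>plus2\<close>,
  scaled by 2 so that the value beyond 1 is 1. Its derivative is a hat function of height 2 on
  [0, 1].\<close>

definition step :: "real \<Rightarrow> real" where
  "step t = 2 * (plus2 t - 2 * plus2 (t - 1/2) + plus2 (t - 1))"

definition step' :: "real \<Rightarrow> real" where
  "step' t = 4 * (max 0 t - 2 * max 0 (t - 1/2) + max 0 (t - 1))"

lemma step_deriv: "(step has_real_derivative step' t) (at t)"
proof -
  have s: "((\<lambda>t. plus2 (t - c)) has_real_derivative 2 * max 0 (t - c)) (at t)" for c
  proof -
    have "((\<lambda>t. t - c) has_real_derivative 1) (at t)" by (auto intro!: derivative_eq_intros)
    then show ?thesis
      using DERIV_chain2[where f=plus2 and g="\<lambda>t. t - c" and x=t and Db=1 and Da="2 * max 0 (t - c)" and s=UNIV] plus2_deriv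
      by simp
  qed
  show ?thesis unfolding step_def step'_def
    by (rule derivative_eq_intros s plus2_deriv refl | simp add: algebra_simps)+
qed

lemma step'_nonneg: "step' t \<ge> 0" by (auto simp: step'_def max_def)
lemma step'_zero: "t \<le> 0 \<or> t \<ge> 1 \<Longrightarrow> step' t = 0" by (auto simp: step'_def max_def)
lemma step'_le: "\<bar>step' t\<bar> \<le> 2" by (auto simp: step'_def max_def)
lemma step_0: "t \<le> 0 \<Longrightarrow> step t = 0" by (auto simp: step_def plus2_def max_def)
lemma step_1: "t \<ge> 1 \<Longrightarrow> step t = 1" 
  by (auto simp: step_def plus2_def max_def power2_eq_square algebra_simps)
lemma step_mono: "a \<le> b \<Longrightarrow> step a \<le> step b"
  using DERIV_nonneg_imp_nondecreasing[of a b step] step_deriv step'_nonneg by blast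
lemma step_ge0: "step t \<ge> 0" using step_mono[of "min t 0" t] step_0[of "min t 0"] by simp
lemma step_le1: "step t \<le> 1" using step_mono[of t "max t 1"] step_1[of "max t 1"] by simp
lemma continuous_step': "continuous_on S step'" unfolding step'_def by (intro continuous_intros)

lemma C1_on_step:
  assumes "C1_on S f f'"
  shows "C1_on S (\<lambda>x. step (f x)) (\<lambda>x u. step' (f x) * f' x u)"
proof (rule C1_onI)
  fix x assume "x \<in> S"
  then show "((\<lambda>x. step (f x)) has_derivative (\<lambda>u. step' (f x) * f' x u)) (at x)"
    using has_derivative_compose[OF C1_on_derivative[OF assms] step_deriv[unfolded has_field_derivative_def]]
    by simp
next
  fix u show "continuous_on S (\<lambda>x. step' (f x) * f' x u)"
    using assms by (intro continuous_intros C1_on_continuous_derivative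
        continuous_on_compose2[OF continuous_step'[of UNIV]] C1_on_continuous) auto
qed

text \<open>The argument of \<open>step\<close> is affine in the squared distance, so nothing
  singular happens at the centre. The cutoff falls from 1 on the ball of radius \<open>a\<close> to
  0 outside the ball of radius \<open>b\<close>.\<close>

definition bump :: "real \<Rightarrow> real \<Rightarrow> 'a::euclidean_space \<Rightarrow> 'a \<Rightarrow> real" where
  "bump a b c x = step ((b\<^sup>2 - (norm (x - c))\<^sup>2) / (b\<^sup>2 - a\<^sup>2))"

definition bump' :: "real \<Rightarrow> real \<Rightarrow> 'a::euclidean_space \<Rightarrow> 'a \<Rightarrow> 'a \<Rightarrow> real" where
  "bump' a b c x u = step' ((b\<^sup>2 - (norm (x - c))\<^sup>2) / (b\<^sup>2 - a\<^sup>2)) * (- 2 * ((x - c) \<bullet> u) / (b\<^sup>2 - a\<^sup>2))"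

lemma C1_bump: "C1_on S (bump a b c) (bump' a b c)"
  unfolding bump_def bump'_def
proof (rule C1_on_step, rule C1_onI)
  fix x
  have "((\<lambda>x. (b\<^sup>2 - (x - c) \<bullet> (x - c)) / (b\<^sup>2 - a\<^sup>2)) has_derivative
      (\<lambda>u. - 2 * ((x - c) \<bullet> u) / (b\<^sup>2 - a\<^sup>2))) (at x)"
    unfolding divide_inverse
    by (auto intro!: derivative_eq_intros simp: algebra_simps inner_commute)
  then show "((\<lambda>x. (b\<^sup>2 - (norm (x - c))\<^sup>2) / (b\<^sup>2 - a\<^sup>2)) has_derivative
      (\<lambda>u. - 2 * ((x - c) \<bullet> u) / (b\<^sup>2 - a\<^sup>2))) (at x)"
    by (simp add: power2_norm_eq_inner)
qed (auto simp: divide_inverse intro!: continuous_intros)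

lemma bump_ge0: "bump a b c x \<ge> 0" by (simp add: bump_def step_ge0)
lemma bump_le1: "bump a b c x \<le> 1" by (simp add: bump_def step_le1)

lemma bump_eq_1:
  assumes "0 \<le> a" "a < b" "x \<in> cball c a"
  shows "bump a b c x = 1"
proof -
  have "(norm (x - c))\<^sup>2 \<le> a\<^sup>2" using assms by (intro power_mono) (auto simp: dist_norm norm_minus_commute)
  moreover have "a\<^sup>2 < b\<^sup>2" using assms by (intro power_strict_mono) auto
  ultimately show ?thesis unfolding bump_def by (intro step_1) (simp add: field_simps)
qed

lemma bump_outside:
  assumes "0 \<le> a" "a < b" "x \<notin> ball c b"
  shows "bump a b c x = 0" "bump' a b c x u = 0"
proof -
  have "b\<^sup>2 \<le> (norm (x - c))\<^sup>2" using assms by (intro power_mono) (auto simp: dist_norm norm_minus_commute)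
  moreover have "a\<^sup>2 < b\<^sup>2" using assms by (intro power_strict_mono) auto
  ultimately have *: "(b\<^sup>2 - (norm (x - c))\<^sup>2) / (b\<^sup>2 - a\<^sup>2) \<le> 0" by (intro divide_nonpos_pos) auto
  then show "bump a b c x = 0" "bump' a b c x u = 0"
    by (auto simp: bump_def bump'_def step_0 step'_zero)
qed

text \<open>With radii \<open>r\<close> and \<open>2 * r\<close> the denominator is 3 r^2, the slope
  of \<open>step\<close> is at most 2 and the inner product at most \<open>2 * r * norm u\<close>;
  the resulting 8/3 is rounded up to 8.\<close>

lemma bump'_bound:
  assumes "0 < r"
  shows "\<bar>bump' r (2*r) c x u\<bar> \<le> 8 / r * norm u"
proof (cases "x \<in> ball c (2*r)")
  case True
  have "\<bar>bump' r (2*r) c x u\<bar> = \<bar>step' (((2*r)\<^sup>2 - (norm (x - c))\<^sup>2) / ((2*r)\<^sup>2 - r\<^sup>2))\<bar> * (2 * \<bar>(x - c) \<bullet> u\<bar> / (3 * r\<^sup>2))"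
    by (simp add: bump'_def abs_mult power2_eq_square)
  also have "\<dots> \<le> 2 * (2 * (2 * r * norm u) / (3 * r\<^sup>2))"
  proof (intro mult_mono divide_right_mono step'_le)
    have "\<bar>(x - c) \<bullet> u\<bar> \<le> norm (x - c) * norm u" by (rule Cauchy_Schwarz_ineq2)
    also have "\<dots> \<le> 2 * r * norm u"
      using True by (intro mult_right_mono) (auto simp: dist_norm norm_minus_commute)
    finally show "\<bar>(x - c) \<bullet> u\<bar> \<le> 2 * r * norm u" .
  qed (use assms in auto)
  also have "\<dots> = 8 / 3 / r * norm u" using assms by (simp add: power2_eq_square field_simps)
  also have "\<dots> \<le> 8 / r * norm u" using assms by (intro mult_right_mono) (auto simp: field_simps)
  finally show ?thesis .
qed (use assms in \<open>auto simp: bump_outside\<close>)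

subsection \<open>The sign of the flux in a chart\<close>

text \<open>The hypothesis \<open>sign\<close> controls the flux density only on the graph.
  Compactness spreads it to a thin strip with a loss \<kappa>, and this loss is harmless because the
  weights living on the strip have a mass bound \<open>C\<close> that depends neither on n nor on
  \<kappa>.\<close>

lemma chart_flux_nonpos:
  fixes w :: "'a::euclidean_space \<Rightarrow> 'a"
  assumes "open \<Omega>" and s: "0 \<le> s" "s < r" and W: "C1_on UNIV w w'"
    and supp: "\<And>x. w x \<noteq> 0 \<Longrightarrow> x \<in> cball c s"
    and G: "C1_on (ball c r) g g'" and e: "norm e = 1" and inv: "\<And>y t. g (y + t *\<^sub>R e) = g y"
    and sub: "\<Omega> \<inter> ball c r = {y \<in> ball c r. y \<bullet> e < g y}"
    and sign: "\<And>y. y \<in> cball c s \<Longrightarrow> y \<bullet> e = g y \<Longrightarrow> w y \<bullet> e - g' y (w y) \<le> 0"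
  shows "(\<integral>x. indicator \<Omega> x * divergence (w' x) \<partial>lborel) \<le> 0"
proof -
  let ?B = "ball c r"
  \<comment> \<open>An intermediate radius, leaving room for a cutoff \<open>\<rho>\<close> that is
    1 on the ball carrying \<open>w\<close> and is supported in a closed ball inside the
    chart.\<close>
  define b where "b = (s + r) / 2"
  have b: "s < b" "b < r" "0 \<le> b" using s by (auto simp: b_def)
  have sB: "cball c s \<subseteq> ?B" and bB: "cball c b \<subseteq> ?B" using b s by auto
  define \<rho> where "\<rho> = bump s b c"
  define \<rho>' where "\<rho>' = bump' s b c"
  have \<rho>: "C1_on S \<rho> \<rho>'" for S unfolding \<rho>_def \<rho>'_def by (rule C1_bump)
  have \<rho>0: "\<rho> x \<noteq> 0 \<Longrightarrow> x \<in> cball c b" and \<rho>'0: "\<rho>' x u \<noteq> 0 \<Longrightarrow> x \<in> cball c b" for x u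
    using bump_outside[OF s(1) b(1), of x c] ball_subset_cball unfolding \<rho>_def \<rho>'_def by blast+
  define \<phi> where "\<phi> y = g y - y \<bullet> e" for y
  define \<phi>' where "\<phi>' y u = g' y u - u \<bullet> e" for y u
  have \<Phi>: "C1_on ?B \<phi> \<phi>'"
    unfolding \<phi>_def \<phi>'_def
    by (rule C1_onI)
      (auto intro!: derivative_eq_intros continuous_intros C1_on_derivative[OF G] C1_on_continuous_derivative[OF G])
  \<comment> \<open>Since \<open>g\<close> is constant along \<open>e\<close>, the function
    \<open>\<phi>\<close> has slope -1 in that direction. This is what makes the mass of the strip
    computable.\<close>
  have \<phi>'e: "\<phi>' y e = -1" if "y \<in> ?B" for y
  proof -
    have "((\<lambda>t. g (y + t *\<^sub>R e)) has_real_derivative g' (y + 0 *\<^sub>R e) e) (at 0)"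
      by (rule C1_on_line[OF G]) (use that in simp)
    then have "((\<lambda>t. g y) has_real_derivative g' y e) (at 0)" by (simp add: inv)
    then have "g' y e = 0" using DERIV_unique DERIV_const by blast
    then show ?thesis using e by (simp add: \<phi>'_def norm_eq_1)
  qed
  define N where "N n = real (Suc n)" for n
  have N: "N n > 0" for n by (simp add: N_def)
  define \<psi> where "\<psi> n y = step (N n * \<phi> y)" for n y
  define \<psi>' where "\<psi>' n y u = step' (N n * \<phi> y) * (N n * \<phi>' y u)" for n y u
  have \<Psi>: "C1_on ?B (\<psi> n) (\<psi>' n)" for n
  proof -
    have "C1_on ?B (\<lambda>y. N n * \<phi> y) (\<lambda>y u. N n * \<phi>' y u)"
      by (rule C1_onI)
        (auto intro!: derivative_eq_intros continuous_intros C1_on_derivative[OF \<Phi>] C1_on_continuous_derivative[OF \<Phi>])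
    then show ?thesis unfolding \<psi>_def \<psi>'_def by (rule C1_on_step)
  qed
  have \<psi>01: "0 \<le> \<psi> n y" "\<psi> n y \<le> 1" for n y by (auto simp: \<psi>_def step_ge0 step_le1)
  have w'0: "w' x u \<noteq> 0 \<Longrightarrow> x \<in> cball c s" for x u
    using C1_derivative_zero_outside[OF W _ supp] by (metis closed_cball)
  have div0: "divergence (w' x) \<noteq> 0 \<Longrightarrow> x \<in> cball c s" for x
    using w'0 divergence_zero by blast
  have contdiv: "continuous_on UNIV (\<lambda>x. divergence (w' x))" by (rule continuous_on_divergence[OF W])
  have intdiv: "integrable lborel (\<lambda>x. divergence (w' x))"
    by (rule integrable_continuous_supported[OF contdiv compact_cball div0])
  define A where "A n x = indicator ?B x * (\<psi> n x * divergence (w' x))" for n x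
  define F where "F n x = indicator ?B x * \<psi>' n x (w x)" for n x
  have Abm: "A n \<in> borel_measurable borel" for n
  proof -
    have "continuous_on ?B (\<lambda>x. \<psi> n x * divergence (w' x))"
      by (intro continuous_on_mult C1_on_continuous[OF \<Psi>] continuous_on_subset[OF contdiv]) auto
    then have "(\<lambda>x. indicator ?B x *\<^sub>R (\<psi> n x * divergence (w' x))) \<in> borel_measurable borel"
      by (intro borel_measurable_continuous_on_indicator) auto
    then show ?thesis by (simp add: A_def[abs_def])
  qed
  have Abd: "\<bar>A n x\<bar> \<le> \<bar>divergence (w' x)\<bar>" for n x
    using \<psi>01[of n x] by (auto simp: A_def indicator_def abs_mult intro: mult_left_le_one_le)
  have intA: "integrable lborel (A n)" for n
    by (rule Bochner_Integration.integrable_bound[OF intdiv]) (use Abm Abd in auto)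
  \<comment> \<open>\<open>A n\<close> and \<open>F n\<close> are the two terms of the product rule
    for the divergence of \<open>\<psi> n x *\<^sub>R w x\<close>, whose integral vanishes.\<close>
  have AF: "integrable lborel (\<lambda>x. A n x + F n x)" "(\<integral>x. A n x + F n x \<partial>lborel) = 0" for n
  proof -
    let ?W = "\<lambda>x. if x \<in> ?B then (\<lambda>u. \<psi> n x *\<^sub>R w' x u + \<psi>' n x u *\<^sub>R w x) else (\<lambda>_. 0)"
    have C: "C1_on UNIV (\<lambda>x. \<psi> n x *\<^sub>R w x) ?W"
      by (rule C1_on_extend[OF open_ball closed_cball sB _ C1_on_scaleR[OF \<Psi> C1_on_subset[OF W]]])
        (use supp in auto)
    have eq: "divergence (?W x) = A n x + F n x" for x
      using divergence_scaleR[of "\<psi>' n x" "\<psi> n x" "w' x" "w x"] C1_on_linear[OF \<Psi>, of x n]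
      by (auto simp: A_def F_def divergence_zero)
    have s': "\<psi> n x *\<^sub>R w x \<noteq> 0 \<Longrightarrow> x \<in> cball c s" for x using supp by auto
    have "integrable lborel (\<lambda>x. divergence (?W x))"
    proof (rule integrable_continuous_supported[OF continuous_on_divergence[OF C] compact_cball])
      show "divergence (?W x) \<noteq> 0 \<Longrightarrow> x \<in> cball c s" for x
        using C1_derivative_zero_outside[OF C closed_cball s'] divergence_zero by blast
    qed
    then show "integrable lborel (\<lambda>x. A n x + F n x)" by (simp only: eq)
    show "(\<integral>x. A n x + F n x \<partial>lborel) = 0"
      unfolding eq[symmetric] by (rule integral_divergence_zero[OF C compact_cball]) (rule s')
  qed
  have intF: "integrable lborel (F n)" for n
    using Bochner_Integration.integrable_diff[OF AF(1)[of n] intA[of n]] by simp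
  have AF': "integral\<^sup>L lborel (A n) = (\<integral>x. - F n x \<partial>lborel)" for n
    using AF(2)[of n] intA[of n] intF[of n] by simp
  define C where "C = (\<integral>x. \<bar>\<rho>' x e\<bar> \<partial>lborel)"
  have C0: "C \<ge> 0" unfolding C_def by simp
  have int\<rho>': "integrable lborel (\<lambda>x. \<rho>' x e)"
    by (rule integrable_continuous_supported[OF C1_on_continuous_derivative[OF \<rho>] compact_cball \<rho>'0])
  define T where "T n x = indicator ?B x * (N n * step' (N n * \<phi> x) * \<rho> x)" for n x
  \<comment> \<open>Integrating the \<open>e\<close>-derivative of
    \<open>\<psi> n x *\<^sub>R \<rho> x\<close> trades the growing weight
    \<open>N n * step'\<close> for the factor \<open>\<psi> n\<close>, which lies between 0 and 1;
    hence a bound independent of \<open>n\<close>.\<close>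
  have T: "integrable lborel (T n)" "integral\<^sup>L lborel (T n) \<le> C" for n
  proof -
    let ?W = "\<lambda>x. if x \<in> ?B then (\<lambda>u. \<psi> n x *\<^sub>R \<rho>' x u + \<psi>' n x u *\<^sub>R \<rho> x) else (\<lambda>_. 0)"
    define J where "J x = indicator ?B x * (\<psi> n x * \<rho>' x e)" for x
    have C: "C1_on UNIV (\<lambda>x. \<psi> n x *\<^sub>R \<rho> x) ?W"
      by (rule C1_on_extend[OF open_ball closed_cball bB _ C1_on_scaleR[OF \<Psi> \<rho>]])
        (use \<rho>0 in auto)
    have eq: "?W x e = J x - T n x" for x
      using \<phi>'e[of x] by (auto simp: J_def T_def \<psi>'_def)
    have s': "\<psi> n x *\<^sub>R \<rho> x \<noteq> 0 \<Longrightarrow> x \<in> cball c b" for x using \<rho>0 by auto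
    have "integrable lborel (\<lambda>x. ?W x e)"
    proof (rule integrable_continuous_supported[OF C1_on_continuous_derivative[OF C] compact_cball])
      show "?W x e \<noteq> 0 \<Longrightarrow> x \<in> cball c b" for x
        using C1_derivative_zero_outside[OF C closed_cball s'] by blast
    qed
    then have iW: "integrable lborel (\<lambda>x. J x - T n x)" by (simp only: eq)
    have W0: "(\<integral>x. J x - T n x \<partial>lborel) = 0"
      unfolding eq[symmetric] by (rule integral_derivative_zero[OF C compact_cball]) (rule s')
    have Jbm: "J \<in> borel_measurable borel"
    proof -
      have "continuous_on ?B (\<lambda>x. \<psi> n x * \<rho>' x e)"
        by (intro continuous_on_mult C1_on_continuous[OF \<Psi>] C1_on_continuous_derivative[OF \<rho>])
      then have "(\<lambda>x. indicator ?B x *\<^sub>R (\<psi> n x * \<rho>' x e)) \<in> borel_measurable borel"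
        by (intro borel_measurable_continuous_on_indicator) auto
      then show ?thesis by (simp add: J_def[abs_def])
    qed
    have Jbd: "\<bar>J x\<bar> \<le> \<bar>\<rho>' x e\<bar>" for x
      using \<psi>01[of n x] by (auto simp: J_def indicator_def abs_mult intro: mult_left_le_one_le)
    have iJ: "integrable lborel J"
      by (rule Bochner_Integration.integrable_bound[OF int\<rho>']) (use Jbm Jbd in auto)
    show iT: "integrable lborel (T n)"
      using Bochner_Integration.integrable_diff[OF iJ iW] by simp
    have "integral\<^sup>L lborel (T n) = integral\<^sup>L lborel J" using W0 iJ iT by simp
    also have "\<dots> \<le> C"
      unfolding C_def using iJ int\<rho>' Jbd by (intro integral_mono) (auto intro: order_trans[OF abs_ge_self])
    finally show "integral\<^sup>L lborel (T n) \<le> C" .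
  qed
  have bound: "\<forall>\<^sub>F n in sequentially. integral\<^sup>L lborel (A n) \<le> \<kappa> * C" if \<kappa>: "\<kappa> > 0" for \<kappa>
  proof -
    define H where "H y = w y \<bullet> e - g' y (w y)" for y
    have Hsum: "H y = w y \<bullet> e - (\<Sum>b\<in>Basis. (w y \<bullet> b) * g' y b)" if "y \<in> ?B" for y
    proof -
      have "g' y (w y) = g' y (\<Sum>b\<in>Basis. (w y \<bullet> b) *\<^sub>R b)" by (simp add: euclidean_representation)
      then show ?thesis using C1_on_linear[OF G that] by (simp add: H_def linear_sum linear_scale)
    qed
    have contH: "continuous_on (cball c s) H"
    proof (rule continuous_on_eq)
      show "continuous_on (cball c s) (\<lambda>y. w y \<bullet> e - (\<Sum>b\<in>Basis. (w y \<bullet> b) * g' y b))"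
        using C1_on_continuous[OF W] C1_on_continuous_derivative[OF G] sB
        by (intro continuous_intros) (auto intro: continuous_on_subset)
    qed (use Hsum sB in auto)
    have cont\<phi>: "continuous_on (cball c s) \<phi>"
      using C1_on_continuous[OF \<Phi>] sB continuous_on_subset by blast
    \<comment> \<open>The bad points: on the closed inner side of the graph, with \<open>H\<close>
      still at least \<kappa>. None lies on the graph itself, where \<open>H\<close> is at most 0,
      so by compactness \<open>\<phi>\<close> has a positive lower bound \<open>m\<close> on
      them.\<close>
    define Z where "Z = {y \<in> cball c s. \<kappa> \<le> H y} \<inter> {y \<in> cball c s. 0 \<le> \<phi> y}"
    have "closed Z" unfolding Z_def
      using contH cont\<phi> by (intro closed_Int continuous_closed_preimage_constant
          continuous_on_closed_Collect_le closed_Collect_le) 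
        (auto intro!: continuous_on_closed_Collect_le continuous_intros)
    then have "compact Z" using compact_Int_closed[OF compact_cball[of c s], of Z] by (simp add: Z_def Int_absorb1 Collect_conj_eq inf.absorb2 subset_iff)
    have Zpos: "\<phi> y > 0" if "y \<in> Z" for y
      using that sign[of y] \<kappa> by (force simp: Z_def H_def \<phi>_def order.order_iff_strict)
    obtain m where m: "m > 0" "\<And>y. y \<in> Z \<Longrightarrow> m \<le> \<phi> y"
    proof (cases "Z = {}")
      case False
      have "continuous_on Z \<phi>" using cont\<phi> by (rule continuous_on_subset) (auto simp: Z_def)
      then obtain y where "y \<in> Z" "\<And>z. z \<in> Z \<Longrightarrow> \<phi> y \<le> \<phi> z"
        using continuous_attains_inf[OF \<open>compact Z\<close> False] by blast
      then show ?thesis using that Zpos by blast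
    qed (use that[of 1] in auto)
    have "\<forall>\<^sub>F n in sequentially. inverse (real (Suc n)) < m"
      using LIMSEQ_inverse_real_of_nat m(1) by (rule order_tendstoD)
    then show ?thesis
    proof eventually_elim
      case (elim n)
      \<comment> \<open>From here on the strip \<open>0 < N n * \<phi> x < 1\<close>, the only place
        where \<open>step'\<close> is nonzero, lies in \<open>\<phi> x < m\<close> and so misses
        \<open>Z\<close>.\<close>
      then have Nm: "N n * m > 1" by (simp add: N_def field_simps del: of_nat_Suc)
      have pw: "- F n x \<le> \<kappa> * T n x" for x
      proof (cases "x \<in> ?B")
        case xB: True
        have F_eq: "- F n x = N n * step' (N n * \<phi> x) * H x"
          using xB by (simp add: F_def \<psi>'_def \<phi>'_def H_def algebra_simps)
        show ?thesis
        proof (cases "x \<in> cball c s")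
          case True
          have \<rho>1: "\<rho> x = 1" unfolding \<rho>_def by (rule bump_eq_1[OF s(1) b(1) True])
          have "N n * step' (N n * \<phi> x) * H x \<le> N n * step' (N n * \<phi> x) * \<kappa>"
          proof (cases "step' (N n * \<phi> x) = 0")
            case False
            then have "\<not> (N n * \<phi> x \<le> 0 \<or> N n * \<phi> x \<ge> 1)" using step'_zero by blast
            then have "N n * \<phi> x > 0" "N n * \<phi> x < N n * m" using Nm by linarith+
            then have p: "\<phi> x > 0" "\<phi> x < m"
              using N[of n] by (auto simp: zero_less_mult_iff mult_less_cancel_left_pos)
            then have "x \<notin> Z" using m(2) by force
            then have "H x \<le> \<kappa>" using p True by (auto simp: Z_def)
            then show ?thesis using N[of n] step'_nonneg by (intro mult_left_mono) auto
          qed simp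
          then show ?thesis using xB \<rho>1 unfolding F_eq by (simp add: T_def mult_ac)
        next
          case False
          then have "w x = 0" using supp by blast
          then have "H x = 0" using linear_0[OF C1_on_linear[OF G xB]] by (simp add: H_def)
          moreover have "T n x \<ge> 0"
            using N[of n] step'_nonneg bump_ge0 by (auto simp: T_def \<rho>_def intro!: mult_nonneg_nonneg)
          ultimately show ?thesis using \<kappa> unfolding F_eq by simp
        qed
      qed (simp add: F_def T_def)
      have "integral\<^sup>L lborel (A n) = (\<integral>x. - F n x \<partial>lborel)" by (rule AF')
      also have "\<dots> \<le> (\<integral>x. \<kappa> * T n x \<partial>lborel)"
        using intF T(1) pw by (intro integral_mono) auto
      also have "\<dots> = \<kappa> * integral\<^sup>L lborel (T n)" by simp
      also have "\<dots> \<le> \<kappa> * C" using T(2) \<kappa> by (intro mult_left_mono) auto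
      finally show ?case .
    qed
  qed
  have lim: "(\<lambda>n. integral\<^sup>L lborel (A n)) \<longlonglongrightarrow> (\<integral>x. indicator \<Omega> x * divergence (w' x) \<partial>lborel)"
  proof (rule integral_dominated_convergence[where w="\<lambda>x. \<bar>divergence (w' x)\<bar>"])
    show "(\<lambda>x. indicator \<Omega> x * divergence (w' x)) \<in> borel_measurable lborel"
      using integrable_indicator_supported[OF contdiv compact_cball div0 \<open>open \<Omega>\<close>] by (rule borel_measurable_integrable)
    show "AE x in lborel. (\<lambda>n. A n x) \<longlonglongrightarrow> indicator \<Omega> x * divergence (w' x)"
    proof (intro AE_I2)
      fix x
      show "(\<lambda>n. A n x) \<longlonglongrightarrow> indicator \<Omega> x * divergence (w' x)"
      proof (cases "x \<in> ?B")
        case xB: True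
        show ?thesis
        proof (cases "x \<in> \<Omega>")
          case True
          then have "x \<in> {y \<in> ?B. y \<bullet> e < g y}" using xB by (simp only: sub[symmetric]) blast
          then have p: "\<phi> x > 0" by (simp add: \<phi>_def)
          have "\<forall>\<^sub>F n in sequentially. inverse (real (Suc n)) < \<phi> x"
            using LIMSEQ_inverse_real_of_nat p by (rule order_tendstoD)
          then have "\<forall>\<^sub>F n in sequentially. A n x = indicator \<Omega> x * divergence (w' x)"
          proof eventually_elim
            case (elim n)
            then have "N n * \<phi> x \<ge> 1" by (simp add: N_def field_simps del: of_nat_Suc)
            then show ?case using xB True by (simp add: A_def \<psi>_def step_1)
          qed
          then show ?thesis by (rule tendsto_eventually)
        next
          case False
          then have "x \<notin> {y \<in> ?B. y \<bullet> e < g y}" by (simp only: sub[symmetric]) blast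
          then have p: "\<phi> x \<le> 0" using xB by (simp add: \<phi>_def)
          then have "A n x = 0" for n
            using N[of n] by (simp add: A_def \<psi>_def step_0 mult_nonneg_nonpos)
          then show ?thesis using False by simp
        qed
      next
        case False
        then have "divergence (w' x) = 0" using div0 sB by blast
        then show ?thesis by (simp add: A_def)
      qed
    qed
  qed (use Abm Abd intdiv in auto)
  have le: "(\<integral>x. indicator \<Omega> x * divergence (w' x) \<partial>lborel) \<le> \<kappa> * C" if "\<kappa> > 0" for \<kappa>
    using tendsto_upperbound[OF lim bound[OF that]] by simp
  show ?thesis
  proof (rule field_le_epsilon)
    fix \<epsilon> :: real assume \<epsilon>: "\<epsilon> > 0"
    have "\<epsilon> / (C + 1) * C \<le> \<epsilon>" using C0 \<epsilon> by (simp add: field_simps)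
    then show "(\<integral>x. indicator \<Omega> x * divergence (w' x) \<partial>lborel) \<le> 0 + \<epsilon>"
      using le[of "\<epsilon> / (C + 1)"] C0 \<epsilon> by simp
  qed
qed

subsection \<open>Patching charts and removing null sets\<close>

lemma integrable_flux:
  assumes "C1_on UNIV w w'" "compact K" "\<And>x. w x \<noteq> 0 \<Longrightarrow> x \<in> K" "open \<Omega>"
  shows "integrable lborel (\<lambda>x. indicator \<Omega> x * divergence (w' x))"
proof (rule integrable_indicator_supported[OF continuous_on_divergence[OF assms(1)] assms(2) _ assms(4)])
  show "divergence (w' x) \<noteq> 0 \<Longrightarrow> x \<in> K" for x
    using C1_derivative_zero_outside[OF assms(1) compact_imp_closed[OF assms(2)] assms(3)] divergence_zero
    by blast
qed

lemma C1_on_one_minus: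
  fixes h :: "'a::euclidean_space \<Rightarrow> real"
  assumes "C1_on UNIV h h'"
  shows "C1_on UNIV (\<lambda>x. 1 - h x) (\<lambda>x u. - h' x u)"
  by (rule C1_onI) (auto intro!: derivative_eq_intros continuous_intros C1_on_derivative[OF assms]
      C1_on_continuous_derivative[OF assms])

definition inward :: "'a::euclidean_space set \<Rightarrow> ('a \<Rightarrow> 'a) \<Rightarrow> ('a \<Rightarrow> 'a) \<Rightarrow> bool" where
  "inward \<Gamma> \<nu> w \<longleftrightarrow> (\<forall>y\<in>\<Gamma>. w y \<bullet> \<nu> y \<le> 0)"

text \<open>A local Gauss inequality as a property of a ball. The fields may live in the doubled
  ball because the cutoff that equals 1 up to radius \<open>s\<close> reaches 0 only at radius
  \<open>2 * s\<close>.\<close>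

definition good_ball :: "'a::euclidean_space set \<Rightarrow> 'a set \<Rightarrow> ('a \<Rightarrow> 'a) \<Rightarrow> 'a \<Rightarrow> real \<Rightarrow> bool" where
  "good_ball \<Omega> \<Gamma> \<nu> c s \<longleftrightarrow> 0 < s \<and>
     (\<forall>w w'. C1_on UNIV w w' \<longrightarrow> inward \<Gamma> \<nu> w \<longrightarrow> (\<forall>x. w x \<noteq> 0 \<longrightarrow> x \<in> cball c (2 * s)) \<longrightarrow>
        (\<integral>x. indicator \<Omega> x * divergence (w' x) \<partial>lborel) \<le> 0)"

text \<open>Induction on the balls: the part multiplied by \<open>\<beta>\<close> is handled by the
  ball around \<open>i\<close>, and the part multiplied by \<open>1 - \<beta>\<close> vanishes on
  that ball, so the remaining balls cover it. Nonnegative factors keep both parts inward. This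
  unrolls a partition of unity instead of constructing one.\<close>

lemma flux_nonpos_finite_cover:
  assumes "open \<Omega>" "compact K" "finite I"
    and "\<And>i. i \<in> I \<Longrightarrow> good_ball \<Omega> \<Gamma> \<nu> i (s i)"
    and "C1_on UNIV w w'" "inward \<Gamma> \<nu> w"
    and "\<And>x. w x \<noteq> 0 \<Longrightarrow> x \<in> K" "\<And>x. w x \<noteq> 0 \<Longrightarrow> \<exists>i\<in>I. x \<in> cball i (s i)"
  shows "(\<integral>x. indicator \<Omega> x * divergence (w' x) \<partial>lborel) \<le> 0"
  using assms(3-)
proof (induction I arbitrary: w w' rule: finite_induct)
  case empty
  then have "w' x u = 0" for x u
    using C1_derivative_zero_outside[of w w' "{}" x] by auto
  then show ?case by (simp add: divergence_zero)
next
  case (insert i I)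
  have g: "good_ball \<Omega> \<Gamma> \<nu> i (s i)" using insert.prems(1) by simp
  then have s: "s i > 0" by (simp add: good_ball_def)
  define \<beta> where "\<beta> = bump (s i) (2 * s i) i"
  define \<beta>' where "\<beta>' = bump' (s i) (2 * s i) i"
  have B: "C1_on UNIV \<beta> \<beta>'" unfolding \<beta>_def \<beta>'_def by (rule C1_bump)
  have B01: "0 \<le> \<beta> x" "\<beta> x \<le> 1" for x by (auto simp: \<beta>_def bump_ge0 bump_le1)
  have Bout: "\<beta> x \<noteq> 0 \<Longrightarrow> x \<in> cball i (2 * s i)" for x
    using bump_outside(1)[of "s i" "2 * s i" x i] s ball_subset_cball unfolding \<beta>_def by force
  have B1: "x \<in> cball i (s i) \<Longrightarrow> \<beta> x = 1" for x
    using s unfolding \<beta>_def by (intro bump_eq_1) auto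
  let ?w1 = "\<lambda>x. \<beta> x *\<^sub>R w x" and ?w2 = "\<lambda>x. (1 - \<beta> x) *\<^sub>R w x"
  let ?w1' = "\<lambda>x u. \<beta> x *\<^sub>R w' x u + \<beta>' x u *\<^sub>R w x"
  let ?w2' = "\<lambda>x u. (1 - \<beta> x) *\<^sub>R w' x u + (- \<beta>' x u) *\<^sub>R w x"
  have C1: "C1_on UNIV ?w1 ?w1'" by (rule C1_on_scaleR[OF B insert.prems(2)])
  have C2: "C1_on UNIV ?w2 ?w2'" by (rule C1_on_scaleR[OF C1_on_one_minus[OF B] insert.prems(2)])
  have "inward \<Gamma> \<nu> ?w1" using insert.prems(3) B01(1) by (auto simp: inward_def intro!: mult_nonneg_nonpos)
  moreover have "\<forall>x. ?w1 x \<noteq> 0 \<longrightarrow> x \<in> cball i (2 * s i)" using Bout by simp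
  ultimately have "(\<integral>x. indicator \<Omega> x * divergence (?w1' x) \<partial>lborel) \<le> 0"
    using g C1 unfolding good_ball_def by blast
  moreover have "(\<integral>x. indicator \<Omega> x * divergence (?w2' x) \<partial>lborel) \<le> 0"
  proof (rule insert.IH[OF _ C2])
    show "inward \<Gamma> \<nu> ?w2" using insert.prems(3) B01(2) by (auto simp: inward_def intro!: mult_nonneg_nonpos)
    show "\<exists>j\<in>I. x \<in> cball j (s j)" if "?w2 x \<noteq> 0" for x
      using insert.prems(5)[of x] B1[of x] that by auto
  qed (use insert.prems in auto)
  moreover have "(\<integral>x. indicator \<Omega> x * divergence (w' x) \<partial>lborel) =
      (\<integral>x. indicator \<Omega> x * divergence (?w1' x) + indicator \<Omega> x * divergence (?w2' x) \<partial>lborel)"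
  proof (rule Bochner_Integration.integral_cong)
    show "indicator \<Omega> x * divergence (w' x) =
      indicator \<Omega> x * divergence (?w1' x) + indicator \<Omega> x * divergence (?w2' x)" for x
      by (simp add: divergence_def inner_add_left inner_diff_left algebra_simps flip: sum.distrib distrib_left)
  qed simp
  moreover have "integrable lborel (\<lambda>x. indicator \<Omega> x * divergence (?w1' x))"
    by (rule integrable_flux[OF C1 \<open>compact K\<close> _ \<open>open \<Omega>\<close>]) (use insert.prems(4) in auto)
  moreover have "integrable lborel (\<lambda>x. indicator \<Omega> x * divergence (?w2' x))"
    by (rule integrable_flux[OF C2 \<open>compact K\<close> _ \<open>open \<Omega>\<close>]) (use insert.prems(4) in auto)
  ultimately show ?case by simp
qed

lemma flux_nonpos_compact_cover:
  assumes "open \<Omega>" "compact K" "C1_on UNIV w w'" "inward \<Gamma> \<nu> w"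
    and K: "\<And>x. w x \<noteq> 0 \<Longrightarrow> x \<in> K" and "\<And>x. x \<in> K \<Longrightarrow> \<exists>s. good_ball \<Omega> \<Gamma> \<nu> x s"
  shows "(\<integral>x. indicator \<Omega> x * divergence (w' x) \<partial>lborel) \<le> 0"
proof -
  obtain s where s: "\<And>x. x \<in> K \<Longrightarrow> good_ball \<Omega> \<Gamma> \<nu> x (s x)" using assms(6) by metis
  have "K \<subseteq> (\<Union>x\<in>K. ball x (s x))" using s by (force simp: good_ball_def)
  then obtain I where I: "I \<subseteq> K" "finite I" "K \<subseteq> (\<Union>x\<in>I. ball x (s x))"
    using compactE_image[OF \<open>compact K\<close>, of K "\<lambda>x. ball x (s x)"] by blast
  show ?thesis
  proof (rule flux_nonpos_finite_cover[OF assms(1,2) I(2) _ assms(3,4) K])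
    show "\<exists>i\<in>I. x \<in> cball i (s i)" if "w x \<noteq> 0" for x using K[OF that] I(3) ball_subset_cball by blast
  qed (use s I(1) in auto)
qed

text \<open>The cutoff is a product of factors 1 - \<beta>, one for each ball. Its defect from 1 and
  its derivative are then bounded by sums over the factors, however the balls overlap, and
  indicators of doubled balls make these bounds integrable ball by ball.\<close>

lemma cutoff_exists:
  fixes r :: "'i \<Rightarrow> real" and c :: "'i \<Rightarrow> 'a::euclidean_space"
  assumes "finite I" "\<And>i. i \<in> I \<Longrightarrow> 0 < r i"
  shows "\<exists>\<eta> \<eta>'. C1_on UNIV \<eta> \<eta>' \<and> (\<forall>x. 0 \<le> \<eta> x \<and> \<eta> x \<le> 1) \<and>
     (\<forall>x. (\<exists>i\<in>I. x \<in> cball (c i) (r i)) \<longrightarrow> \<eta> x = 0) \<and>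
     (\<forall>x. 1 - \<eta> x \<le> (\<Sum>i\<in>I. indicator (ball (c i) (2 * r i)) x)) \<and>
     (\<forall>x u. \<bar>\<eta>' x u\<bar> \<le> (\<Sum>i\<in>I. 8 / r i * indicator (ball (c i) (2 * r i)) x) * norm u)"
  using assms
proof (induction I rule: finite_induct)
  case empty
  have "C1_on UNIV (\<lambda>x::'a. 1::real) (\<lambda>x u. 0)" by (rule C1_onI) auto
  then show ?case by (intro exI[of _ "\<lambda>_. 1"] exI[of _ "\<lambda>_ _. 0"]) auto
next
  case (insert i I)
  then obtain \<eta> \<eta>' where E: "C1_on UNIV \<eta> \<eta>'" "\<And>x. 0 \<le> \<eta> x" "\<And>x. \<eta> x \<le> 1"
    "\<And>x. (\<exists>i\<in>I. x \<in> cball (c i) (r i)) \<Longrightarrow> \<eta> x = 0"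
    "\<And>x. 1 - \<eta> x \<le> (\<Sum>i\<in>I. indicator (ball (c i) (2 * r i)) x)"
    "\<And>x u. \<bar>\<eta>' x u\<bar> \<le> (\<Sum>i\<in>I. 8 / r i * indicator (ball (c i) (2 * r i)) x) * norm u"
    by auto
  have r: "r i > 0" using insert.prems by simp
  define \<beta> where "\<beta> = bump (r i) (2 * r i) (c i)"
  define \<beta>' where "\<beta>' = bump' (r i) (2 * r i) (c i)"
  have B: "C1_on UNIV \<beta> \<beta>'" unfolding \<beta>_def \<beta>'_def by (rule C1_bump)
  have B01: "0 \<le> \<beta> x" "\<beta> x \<le> 1" for x by (auto simp: \<beta>_def bump_ge0 bump_le1)
  have Bout: "x \<notin> ball (c i) (2 * r i) \<Longrightarrow> \<beta> x = 0 \<and> \<beta>' x u = 0" for x u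
    using r unfolding \<beta>_def \<beta>'_def by (intro conjI bump_outside) auto
  have Bind: "\<beta> x \<le> indicator (ball (c i) (2 * r i)) x" for x
    using Bout[of x 0] B01[of x] by (auto simp: indicator_def)
  have B'ind: "\<bar>\<beta>' x u\<bar> \<le> 8 / r i * indicator (ball (c i) (2 * r i)) x * norm u" for x u
    using Bout[of x u] bump'_bound[OF r, of "c i" x u] by (auto simp: indicator_def \<beta>'_def)
  have B1: "x \<in> cball (c i) (r i) \<Longrightarrow> \<beta> x = 1" for x
    using r unfolding \<beta>_def by (intro bump_eq_1) auto
  define \<theta> where "\<theta> x = (1 - \<beta> x) * \<eta> x" for x
  define \<theta>' where "\<theta>' x u = (1 - \<beta> x) * \<eta>' x u + (- \<beta>' x u) * \<eta> x" for x u
  have "C1_on UNIV \<theta> \<theta>'"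
    using C1_on_scaleR[OF C1_on_one_minus[OF B] E(1)] by (simp add: \<theta>_def[abs_def] \<theta>'_def[abs_def])
  moreover have "0 \<le> \<theta> x" "\<theta> x \<le> 1" for x
    using E(2,3)[of x] B01[of x] by (auto simp: \<theta>_def intro: mult_le_one)
  moreover have "(\<exists>j\<in>insert i I. x \<in> cball (c j) (r j)) \<Longrightarrow> \<theta> x = 0" for x
    using B1[of x] E(4)[of x] by (auto simp: \<theta>_def)
  moreover have "1 - \<theta> x \<le> (\<Sum>j\<in>insert i I. indicator (ball (c j) (2 * r j)) x)" for x
  proof -
    have "\<beta> x * \<eta> x \<le> \<beta> x" using E(2,3)[of x] B01[of x] by (intro mult_left_le) auto
    then have "1 - \<theta> x \<le> \<beta> x + (1 - \<eta> x)" by (simp add: \<theta>_def algebra_simps)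
    also have "\<dots> \<le> indicator (ball (c i) (2 * r i)) x + (\<Sum>j\<in>I. indicator (ball (c j) (2 * r j)) x)"
      using Bind E(5) by (intro add_mono)
    finally show ?thesis using insert.hyps by simp
  qed
  moreover have "\<bar>\<theta>' x u\<bar> \<le> (\<Sum>j\<in>insert i I. 8 / r j * indicator (ball (c j) (2 * r j)) x) * norm u" for x u
  proof -
    have "\<bar>\<theta>' x u\<bar> \<le> (1 - \<beta> x) * \<bar>\<eta>' x u\<bar> + \<bar>\<beta>' x u\<bar> * \<eta> x"
      unfolding \<theta>'_def using E(2)[of x] B01[of x] by (intro order_trans[OF abs_triangle_ineq]) (simp add: abs_mult)
    also have "\<dots> \<le> \<bar>\<eta>' x u\<bar> + \<bar>\<beta>' x u\<bar>"
      using E(2,3)[of x] B01[of x] by (intro add_mono mult_left_le_one_le mult_left_le) auto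
    also have "\<dots> \<le> (\<Sum>j\<in>I. 8 / r j * indicator (ball (c j) (2 * r j)) x) * norm u
        + 8 / r i * indicator (ball (c i) (2 * r i)) x * norm u"
      using E(6) B'ind by (intro add_mono)
    finally show ?thesis using insert.hyps by (simp add: algebra_simps)
  qed
  ultimately show ?case by blast
qed

text \<open>A set of vanishing \<open>(N - 1)\<close>-dimensional measure is invisible to the flux: cutting it off with
  balls of radii \<open>r\<^sub>i\<close> costs \<open>\<Sum> r\<^sub>i\<^sup>N / r\<^sub>i\<close>.\<close>

lemma flux_nonpos_removable:
  fixes w :: "'a::euclidean_space \<Rightarrow> 'a"
  assumes "open \<Omega>" "compact K" and W: "C1_on UNIV w w'" "inward \<Gamma> \<nu> w"
    and K: "\<And>x. w x \<noteq> 0 \<Longrightarrow> x \<in> K"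
    and good: "\<And>x. x \<in> K - S \<Longrightarrow> \<exists>s. good_ball \<Omega> \<Gamma> \<nu> x s"
    and null: "\<And>\<delta>. 0 < \<delta> \<Longrightarrow> \<exists>(I::nat set) c r. finite I \<and> (\<forall>i\<in>I. 0 < r i \<and> r i \<le> 1) \<and>
        K \<inter> S \<subseteq> (\<Union>i\<in>I. ball (c i) (r i)) \<and> (\<Sum>i\<in>I. r i ^ (DIM('a) - 1)) < \<delta>"
  shows "(\<integral>x. indicator \<Omega> x * divergence (w' x) \<partial>lborel) \<le> 0"
proof -
  have contw: "continuous_on UNIV w" by (rule C1_on_continuous[OF W(1)])
  obtain M1 where M1: "M1 \<ge> 0" "\<And>x. \<bar>norm (w x)\<bar> \<le> M1"
  proof (rule continuous_supported_bounded[OF _ \<open>compact K\<close>])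
    show "continuous_on UNIV (\<lambda>x. norm (w x))" by (intro continuous_intros contw)
  qed (use K in auto)
  have div0: "divergence (w' x) \<noteq> 0 \<Longrightarrow> x \<in> K" for x
    using C1_derivative_zero_outside[OF W(1) compact_imp_closed[OF \<open>compact K\<close>] K] divergence_zero by blast
  obtain M2 where M2: "M2 \<ge> 0" "\<And>x. \<bar>divergence (w' x)\<bar> \<le> M2"
    using continuous_supported_bounded[OF continuous_on_divergence[OF W(1)] \<open>compact K\<close> div0] by metis
  define M where "M = M1 + M2"
  have M: "M \<ge> 0" "\<And>x. norm (w x) \<le> M" "\<And>x. \<bar>divergence (w' x)\<bar> \<le> M"
    using M1 M2 by (auto simp: M_def intro: add_increasing add_increasing2)
  \<comment> \<open>The volume of a ball of radius 2, so that the ball of radius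
    \<open>2 * r i\<close> has measure \<open>V * r i ^ DIM('a)\<close>.\<close>
  define V where "V = unit_ball_vol (real DIM('a)) * 2 ^ DIM('a)"
  have V: "V \<ge> 0" by (auto simp: V_def)
  have est: "(\<integral>x. indicator \<Omega> x * divergence (w' x) \<partial>lborel) \<le> M * 9 * V * \<delta>" if pos: "\<delta> > 0" for \<delta>
  proof -
    obtain I :: "nat set" and c r where I: "finite I" "\<And>i. i \<in> I \<Longrightarrow> 0 < r i" "\<And>i. i \<in> I \<Longrightarrow> r i \<le> 1"
      "K \<inter> S \<subseteq> (\<Union>i\<in>I. ball (c i) (r i))" "(\<Sum>i\<in>I. r i ^ (DIM('a) - 1)) < \<delta>"
      using null[OF pos] by blast
    obtain \<eta> \<eta>' where E: "C1_on UNIV \<eta> \<eta>'" "\<And>x. 0 \<le> \<eta> x" "\<And>x. \<eta> x \<le> 1"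
      "\<And>x. (\<exists>i\<in>I. x \<in> cball (c i) (r i)) \<Longrightarrow> \<eta> x = 0"
      "\<And>x. 1 - \<eta> x \<le> (\<Sum>i\<in>I. indicator (ball (c i) (2 * r i)) x)"
      "\<And>x u. \<bar>\<eta>' x u\<bar> \<le> (\<Sum>i\<in>I. 8 / r i * indicator (ball (c i) (2 * r i)) x) * norm u"
      using cutoff_exists[of I r c] I(1,2) by blast
    let ?v = "\<lambda>x. \<eta> x *\<^sub>R w x" and ?v' = "\<lambda>x u. \<eta> x *\<^sub>R w' x u + \<eta>' x u *\<^sub>R w x"
    have CV: "C1_on UNIV ?v ?v'" by (rule C1_on_scaleR[OF E(1) W(1)])
    \<comment> \<open>After the cutoff the field is carried by a compact set disjoint from
      \<open>S\<close>, all of whose points have good balls.\<close>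
    define K' where "K' = K - (\<Union>i\<in>I. ball (c i) (r i))"
    have K': "compact K'" unfolding K'_def using \<open>compact K\<close> by (intro compact_diff) auto
    have vK': "x \<in> K'" if "?v x \<noteq> 0" for x
      using that K[of x] E(4)[of x] ball_subset_cball unfolding K'_def by fastforce
    have v0: "(\<integral>x. indicator \<Omega> x * divergence (?v' x) \<partial>lborel) \<le> 0"
    proof (rule flux_nonpos_compact_cover[OF \<open>open \<Omega>\<close> K' CV _ vK'])
      show "inward \<Gamma> \<nu> ?v" using W(2) E(2) by (auto simp: inward_def intro!: mult_nonneg_nonpos)
      show "\<exists>s. good_ball \<Omega> \<Gamma> \<nu> x s" if "x \<in> K'" for x
        using that I(4) by (intro good) (auto simp: K'_def)
    qed
    have i1: "integrable lborel (\<lambda>x. indicator \<Omega> x * divergence (?v' x))"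
      by (rule integrable_flux[OF CV K' vK' \<open>open \<Omega>\<close>])
    have i2: "integrable lborel (\<lambda>x. indicator \<Omega> x * divergence (w' x))"
      by (rule integrable_flux[OF W(1) \<open>compact K\<close> K \<open>open \<Omega>\<close>])
    \<comment> \<open>The 9 adds the 8 from the slope of the cutoff and a 1 from its defect, the
      latter because \<open>1 \<le> 1 / r i\<close>. Dividing the volume by \<open>r i\<close> is
      what lowers the exponent to N - 1.\<close>
    let ?R = "\<lambda>x. \<Sum>i\<in>I. M * 9 / r i * indicator (ball (c i) (2 * r i)) x"
    have bi: "integrable lborel (\<lambda>x. k * indicator (ball (c i) (2 * r i)) x :: real)" for k i
      by (intro integrable_mult_right integrable_real_indicator emeasure_lborel_ball_finite) simp
    have "(\<integral>x. indicator \<Omega> x * divergence (w' x) \<partial>lborel) - (\<integral>x. indicator \<Omega> x * divergence (?v' x) \<partial>lborel)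
      = (\<integral>x. indicator \<Omega> x * divergence (w' x) - indicator \<Omega> x * divergence (?v' x) \<partial>lborel)"
      using i1 i2 by simp
    also have "\<dots> \<le> (\<integral>x. ?R x \<partial>lborel)"
    proof (rule integral_mono)
      fix x
      have eq: "divergence (?v' x) = \<eta> x * divergence (w' x) + \<eta>' x (w x)"
        using C1_on_linear[OF E(1)] by (intro divergence_scaleR) auto
      have "indicator \<Omega> x * divergence (w' x) - indicator \<Omega> x * divergence (?v' x)
        = indicator \<Omega> x * ((1 - \<eta> x) * divergence (w' x) - \<eta>' x (w x))"
        by (simp add: eq algebra_simps)
      also have "\<dots> \<le> \<bar>(1 - \<eta> x) * divergence (w' x) - \<eta>' x (w x)\<bar>"
        by (auto simp: indicator_def)
      also have "\<dots> \<le> (1 - \<eta> x) * \<bar>divergence (w' x)\<bar> + \<bar>\<eta>' x (w x)\<bar>"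
        using E(3)[of x] by (intro order_trans[OF abs_triangle_ineq4]) (simp add: abs_mult)
      also have "\<dots> \<le> (\<Sum>i\<in>I. indicator (ball (c i) (2 * r i)) x) * M
          + (\<Sum>i\<in>I. 8 / r i * indicator (ball (c i) (2 * r i)) x) * M"
      proof (rule add_mono)
        show "(1 - \<eta> x) * \<bar>divergence (w' x)\<bar> \<le> (\<Sum>i\<in>I. indicator (ball (c i) (2 * r i)) x) * M"
          using E(3,5)[of x] M by (intro mult_mono) (auto intro: sum_nonneg)
        have "\<bar>\<eta>' x (w x)\<bar> \<le> (\<Sum>i\<in>I. 8 / r i * indicator (ball (c i) (2 * r i)) x) * norm (w x)"
          by (rule E(6))
        also have "\<dots> \<le> (\<Sum>i\<in>I. 8 / r i * indicator (ball (c i) (2 * r i)) x) * M"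
          using M(2) I(2) by (intro mult_left_mono sum_nonneg mult_nonneg_nonneg) (auto intro: less_imp_le)
        finally show "\<bar>\<eta>' x (w x)\<bar> \<le> (\<Sum>i\<in>I. 8 / r i * indicator (ball (c i) (2 * r i)) x) * M" .
      qed
      also have "\<dots> = (\<Sum>i\<in>I. (M + M * 8 / r i) * indicator (ball (c i) (2 * r i)) x)"
        by (simp add: sum_distrib_left sum_distrib_right sum.distrib[symmetric] algebra_simps)
      also have "\<dots> \<le> ?R x"
      proof (intro sum_mono mult_right_mono)
        fix i assume "i \<in> I"
        then have "1 \<le> 1 / r i" using I(2,3)[of i] by (simp add: field_simps)
        then have "M * 1 \<le> M * (1 / r i)" using M(1) by (rule mult_left_mono)
        moreover have "M * 8 / r i = 8 * (M * (1 / r i))" "M * 9 / r i = 9 * (M * (1 / r i))" by simp_all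
        ultimately show "M + M * 8 / r i \<le> M * 9 / r i" by linarith
      qed simp
      finally show "indicator \<Omega> x * divergence (w' x) - indicator \<Omega> x * divergence (?v' x) \<le> ?R x" .
    qed (use i1 i2 bi in auto)
    also have "\<dots> = (\<Sum>i\<in>I. M * 9 / r i * measure lborel (ball (c i) (2 * r i)))"
      using bi by (simp add: Bochner_Integration.integral_sum)
    also have "\<dots> = (\<Sum>i\<in>I. M * 9 * V * r i ^ (DIM('a) - 1))"
    proof (rule sum.cong)
      fix i assume "i \<in> I"
      then have ri: "r i > 0" using I(2) by simp
      have "DIM('a) = Suc (DIM('a) - 1)" using DIM_positive[where 'a='a] by simp
      then have "r i ^ DIM('a) = r i * r i ^ (DIM('a) - 1)" by (metis power_Suc)
      then show "M * 9 / r i * measure lborel (ball (c i) (2 * r i)) = M * 9 * V * r i ^ (DIM('a) - 1)"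
        using ri by (simp add: content_ball V_def power_mult_distrib)
    qed simp
    also have "\<dots> = M * 9 * V * (\<Sum>i\<in>I. r i ^ (DIM('a) - 1))" by (simp add: sum_distrib_left)
    also have "\<dots> \<le> M * 9 * V * \<delta>" using I(5) M(1) V by (intro mult_left_mono) auto
    finally show ?thesis using v0 by linarith
  qed
  show ?thesis
  proof (rule field_le_epsilon)
    fix \<epsilon> :: real assume \<epsilon>: "\<epsilon> > 0"
    have P: "M * 9 * V \<ge> 0" using M(1) V by simp
    then have "M * 9 * V * (\<epsilon> / (M * 9 * V + 1)) \<le> \<epsilon>" using \<epsilon> by (simp add: field_simps)
    then show "(\<integral>x. indicator \<Omega> x * divergence (w' x) \<partial>lborel) \<le> 0 + \<epsilon>"
      using est[of "\<epsilon> / (M * 9 * V + 1)"] P \<epsilon> by simp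
  qed
qed

text \<open>Hausdorff covers use arbitrary bounded sets, whereas the cutoffs need finitely many
  balls of radius at most 1. A bounded set lies in any open ball around one of its points whose
  radius exceeds its diameter, and compactness makes the cover finite.\<close>

lemma hnull_cover:
  fixes S K :: "'a::euclidean_space set"
  assumes "hnull d S" "d > 0" "compact (K \<inter> S)" "\<delta> > 0"
  shows "\<exists>(I::nat set) c r. finite I \<and> (\<forall>i\<in>I. 0 < r i \<and> r i \<le> 1) \<and>
        K \<inter> S \<subseteq> (\<Union>i\<in>I. ball (c i) (r i)) \<and> (\<Sum>i\<in>I. r i ^ d) < \<delta>"
proof -
  \<comment> \<open>One \<epsilon> is spent on the diameters and one on the padding below. The bound
    of the total by 1 is what forces each radius to be at most 1.\<close>
  define \<epsilon> where "\<epsilon> = min \<delta> 1 / 2"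
  have \<epsilon>: "\<epsilon> > 0" "2 * \<epsilon> \<le> \<delta>" "2 * \<epsilon> \<le> 1" using assms(4) by (auto simp: \<epsilon>_def)
  obtain C :: "nat \<Rightarrow> 'a set" where C: "S \<subseteq> (\<Union>i. C i)" "\<And>i. bounded (C i)"
    "summable (\<lambda>i. diameter (C i) ^ d)" "(\<Sum>i. diameter (C i) ^ d) < \<epsilon>"
    using assms(1) \<epsilon>(1) unfolding hnull_def by metis
  \<comment> \<open>Padding by a geometric series of sum \<epsilon> makes \<open>r i\<close>
    strictly larger than the diameter, and positive even if the diameter is 0.\<close>
  define r where "r i = root d (diameter (C i) ^ d + \<epsilon> * (1/2) ^ Suc i)" for i
  have dp: "diameter (C i) \<ge> 0" for i using diameter_ge_0[OF C(2)] .
  have rd: "r i ^ d = diameter (C i) ^ d + \<epsilon> * (1/2) ^ Suc i" for i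
    unfolding r_def using dp[of i] \<epsilon>(1) assms(2)
    by (intro real_root_pow_pos2) (auto intro!: add_nonneg_nonneg)
  have r0: "r i \<ge> 0" for i
    unfolding r_def using dp[of i] \<epsilon>(1) by (intro real_root_ge_zero) auto
  have rdiam: "diameter (C i) < r i" for i
    by (rule power_less_imp_less_base[of _ d]) (use rd[of i] r0 \<epsilon>(1) in auto)
  define c where "c i = (SOME x. x \<in> C i)" for i
  have Cb: "C i \<subseteq> ball (c i) (r i)" for i
  proof
    fix x assume x: "x \<in> C i"
    then have "c i \<in> C i" unfolding c_def by (rule someI)
    then have "dist (c i) x \<le> diameter (C i)" using diameter_bounded_bound[OF C(2)] x by blast
    then show "x \<in> ball (c i) (r i)" using rdiam[of i] by simp
  qed
  have geo: "(\<lambda>i. \<epsilon> * (1/2) ^ Suc i) sums \<epsilon>"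
    using sums_mult[OF power_half_series, of \<epsilon>] by simp
  have sm: "summable (\<lambda>i. r i ^ d)" unfolding rd using C(3) geo by (intro summable_add) (auto simp: sums_iff)
  have tot: "(\<Sum>i. r i ^ d) < 2 * \<epsilon>"
    unfolding rd using suminf_add[OF C(3) sums_summable[OF geo]] sums_unique[OF geo] C(4) by simp
  have part: "(\<Sum>i\<in>I. r i ^ d) < 2 * \<epsilon>" if "finite I" for I
  proof -
    have "(\<Sum>i\<in>I. r i ^ d) \<le> (\<Sum>i. r i ^ d)"
      using that r0 by (intro sum_le_suminf[OF sm]) auto
    then show ?thesis using tot by linarith
  qed
  have r1: "r i \<le> 1" for i
  proof -
    have "r i ^ d < 1 ^ d" using part[of "{i}"] \<epsilon>(3) by simp
    then show ?thesis using power_less_imp_less_base[of "r i" d 1] by simp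
  qed
  have "K \<inter> S \<subseteq> (\<Union>i\<in>UNIV. ball (c i) (r i))" using C(1) Cb by blast
  then obtain I :: "nat set" where "finite I" "K \<inter> S \<subseteq> (\<Union>i\<in>I. ball (c i) (r i))"
    using compactE_image[OF assms(3), of UNIV "\<lambda>i. ball (c i) (r i)"] by (metis open_ball)
  moreover have "0 < r i" for i using rdiam[of i] dp[of i] by linarith
  ultimately show ?thesis using r1 part \<epsilon>(2) by (intro exI[of _ I] exI[of _ c] exI[of _ r]) fastforce
qed

subsection \<open>Boundary geometry\<close>

lemma Ck_on_continuous: "Ck_on k S f \<Longrightarrow> continuous_on S f"
  by (cases k) (auto intro!: continuous_at_imp_continuous_on differentiable_imp_continuous_within)

lemma Ck_on_imp_C1_on: "Ck_on (Suc k) S f \<Longrightarrow> C1_on S f (\<lambda>x. frechet_derivative f (at x))"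
  by (rule C1_onI) (auto simp: frechet_derivative_works[symmetric] intro: Ck_on_continuous)

section \<open>Rules for C1 fields and symmetry of second derivatives\<close>

lemma C1_on_sum:
  assumes "\<And>i. i \<in> I \<Longrightarrow> C1_on S (f i) (f' i)"
  shows "C1_on S (\<lambda>x. \<Sum>i\<in>I. f i x) (\<lambda>x u. \<Sum>i\<in>I. f' i x u)"
  by (rule C1_onI) (auto intro!: has_derivative_sum continuous_on_sum C1_on_derivative[OF assms] C1_on_continuous_derivative[OF assms])

lemma C1_on_diff:
  assumes "C1_on S f f'" "C1_on S g g'"
  shows "C1_on S (\<lambda>x. f x - g x) (\<lambda>x u. f' x u - g' x u)"
  by (rule C1_onI) (auto intro!: has_derivative_diff continuous_on_diff C1_on_derivative[OF assms(1)] C1_on_derivative[OF assms(2)]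
     C1_on_continuous_derivative[OF assms(1)] C1_on_continuous_derivative[OF assms(2)])

lemma C1_on_const_scaleR:
  assumes "C1_on S f f'"
  shows "C1_on S (\<lambda>x. c *\<^sub>R f x) (\<lambda>x u. c *\<^sub>R f' x u)"
  by (rule C1_onI) (auto intro!: has_derivative_scaleR_right continuous_on_scaleR continuous_on_const C1_on_derivative[OF assms] C1_on_continuous_derivative[OF assms])

text \<open>Two mean value steps, along \<open>b\<close> and then along \<open>c\<close>. The mixed
  difference is symmetric in \<open>b\<close> and \<open>c\<close>, so the two orders of
  differentiation can be compared through the same number.\<close>

lemma second_difference_mvt:
  fixes f :: "'a::euclidean_space \<Rightarrow> real"
  assumes f: "C1_on UNIV f f'" and f2: "C1_on UNIV (\<lambda>x. f' x b) f2" and h: "h > 0"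
  shows "\<exists>p. dist p x \<le> h * (norm b + norm c) \<and>
    f (x + h *\<^sub>R b + h *\<^sub>R c) - f (x + h *\<^sub>R b) - f (x + h *\<^sub>R c) + f x = h * (h * f2 p c)"
proof -
  define \<phi> where "\<phi> s = f ((x + h *\<^sub>R c) + s *\<^sub>R b) - f (x + s *\<^sub>R b)" for s
  have "\<exists>s>0. s < h \<and> \<phi> h - \<phi> 0 = (h - 0) * (f' ((x + h *\<^sub>R c) + s *\<^sub>R b) b - f' (x + s *\<^sub>R b) b)"
    unfolding \<phi>_def by (rule MVT2[OF h]) (intro DERIV_diff C1_on_line[OF f], auto)
  then obtain s where s: "s > 0" "s < h"
    "\<phi> h - \<phi> 0 = h * (f' ((x + s *\<^sub>R b) + h *\<^sub>R c) b - f' (x + s *\<^sub>R b + 0 *\<^sub>R c) b)"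
    by (auto simp: add.assoc add.commute[of "h *\<^sub>R c"])
  have "\<exists>t>0. t < h \<and> f' ((x + s *\<^sub>R b) + h *\<^sub>R c) b - f' (x + s *\<^sub>R b + 0 *\<^sub>R c) b =
      (h - 0) * f2 ((x + s *\<^sub>R b) + t *\<^sub>R c) c"
    by (rule MVT2[OF h]) (intro C1_on_line[OF f2], auto)
  then obtain t where t: "t > 0" "t < h"
    "f' ((x + s *\<^sub>R b) + h *\<^sub>R c) b - f' (x + s *\<^sub>R b + 0 *\<^sub>R c) b = h * f2 ((x + s *\<^sub>R b) + t *\<^sub>R c) c"
    by auto
  let ?p = "(x + s *\<^sub>R b) + t *\<^sub>R c"
  have "dist ?p x = norm (s *\<^sub>R b + t *\<^sub>R c)" by (simp add: dist_norm add.assoc)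
  also have "\<dots> \<le> s * norm b + t * norm c" using s(1) t(1) by (intro order_trans[OF norm_triangle_ineq]) simp
  also have "\<dots> \<le> h * (norm b + norm c)"
    using s t by (simp add: distrib_left add_mono mult_right_mono)
  finally have "dist ?p x \<le> h * (norm b + norm c)" .
  moreover have "f (x + h *\<^sub>R b + h *\<^sub>R c) - f (x + h *\<^sub>R b) - f (x + h *\<^sub>R c) + f x = \<phi> h - \<phi> 0"
    by (simp add: \<phi>_def add.assoc add.commute[of "h *\<^sub>R c"])
  ultimately show ?thesis using s(3) t(3) by (intro exI[of _ ?p]) simp
qed

lemma second_derivative_symmetric_real:
  fixes f :: "'a::euclidean_space \<Rightarrow> real"
  assumes f: "C1_on UNIV f f'" and fb: "C1_on UNIV (\<lambda>x. f' x b) fb" and fc: "C1_on UNIV (\<lambda>x. f' x c) fc"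
  shows "fb x c = fc x b"
proof (rule ccontr)
  assume ne: "fb x c \<noteq> fc x b"
  \<comment> \<open>Half the gap: a number closer than \<open>d\<close> to each of the two mixed
    derivatives cannot exist.\<close>
  define d where "d = \<bar>fb x c - fc x b\<bar> / 2"
  have d: "d > 0" using ne by (simp add: d_def)
  have "isCont (\<lambda>x. fb x c) x" "isCont (\<lambda>x. fc x b) x"
    using C1_on_continuous_derivative[OF fb] C1_on_continuous_derivative[OF fc]
    by (auto simp: continuous_on_eq_continuous_at)
  then obtain \<delta>1 \<delta>2 where \<delta>: "\<delta>1 > 0" "\<And>y. dist y x < \<delta>1 \<Longrightarrow> dist (fb y c) (fb x c) < d"
     "\<delta>2 > 0" "\<And>y. dist y x < \<delta>2 \<Longrightarrow> dist (fc y b) (fc x b) < d"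
    using d unfolding continuous_at_eps_delta by metis
  define h where "h = min \<delta>1 \<delta>2 / (norm b + norm c + 1)"
  have nn: "norm b + norm c + 1 > 0" by (smt (verit) norm_ge_zero)
  have h: "h > 0" using \<delta>(1,3) nn by (simp add: h_def)
  have "h * (norm b + norm c) < h * (norm b + norm c + 1)" using h by (intro mult_strict_left_mono) auto
  also have "\<dots> = min \<delta>1 \<delta>2" using nn by (simp add: h_def)
  finally have hs: "h * (norm b + norm c) < min \<delta>1 \<delta>2" .
  obtain p where p: "dist p x \<le> h * (norm b + norm c)"
    "f (x + h *\<^sub>R b + h *\<^sub>R c) - f (x + h *\<^sub>R b) - f (x + h *\<^sub>R c) + f x = h * (h * fb p c)"
    using second_difference_mvt[OF f fb h] by blast
  obtain q where q: "dist q x \<le> h * (norm c + norm b)"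
    "f (x + h *\<^sub>R c + h *\<^sub>R b) - f (x + h *\<^sub>R c) - f (x + h *\<^sub>R b) + f x = h * (h * fc q b)"
    using second_difference_mvt[OF f fc h] by blast
  have "f (x + h *\<^sub>R c + h *\<^sub>R b) = f (x + h *\<^sub>R b + h *\<^sub>R c)" by (simp add: algebra_simps)
  then have "h * (h * fb p c) = h * (h * fc q b)" using p(2) q(2) by linarith
  then have "fb p c = fc q b" using h by simp
  moreover have "dist (fb p c) (fb x c) < d" using p(1) hs by (intro \<delta>(2)) auto
  moreover have "dist (fc q b) (fc x b) < d" using q(1) hs by (intro \<delta>(4)) (auto simp: add.commute)
  ultimately show False by (simp add: d_def dist_real_def) argo
qed

lemma second_derivative_symmetric:
  fixes f :: "'a::euclidean_space \<Rightarrow> 'b::euclidean_space"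
  assumes f: "C1_on UNIV f f'" and f2: "\<And>u. C1_on UNIV (\<lambda>x. f' x u) (f2 u)"
  shows "f2 b x c = f2 c x b"
proof (rule euclidean_eqI)
  fix i :: 'b
  show "f2 b x c \<bullet> i = f2 c x b \<bullet> i"
    by (rule second_derivative_symmetric_real[OF C1_on_inner_const[OF f] C1_on_inner_const[OF f2] C1_on_inner_const[OF f2]])
qed

section \<open>The flux field and its divergence\<close>

definition flux_field :: "('a::euclidean_space \<Rightarrow> 'a) \<Rightarrow> ('a \<Rightarrow> 'a \<Rightarrow> 'a) \<Rightarrow> 'a \<Rightarrow> 'a" where
  "flux_field v v' x = divergence (v' x) *\<^sub>R v x - v' x (v x)"

definition sq_trace :: "('a::euclidean_space \<Rightarrow> 'a) \<Rightarrow> real" where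
  "sq_trace A = (\<Sum>b\<in>Basis. \<Sum>c\<in>Basis. (A b \<bullet> c) * (A c \<bullet> b))"

text \<open>The derivative of div v along v occurs twice with opposite signs, once with the two
  differentiations exchanged, so only products of first derivatives are left. The basis expansion
  writes the field as a sum of products of C1 factors.\<close>

lemma flux_field_C1:
  fixes v :: "'a::euclidean_space \<Rightarrow> 'a"
  assumes v: "C1_on UNIV v v'" and v2: "\<And>u. C1_on UNIV (\<lambda>x. v' x u) (v2 u)"
  shows "\<exists>w'. C1_on UNIV (flux_field v v') w' \<and>
    (\<forall>x. divergence (w' x) = (divergence (v' x))\<^sup>2 - sq_trace (v' x))"
proof -
  define w' where "w' x u = (\<Sum>b\<in>Basis. ((v' x b \<bullet> b) *\<^sub>R v' x u + (v2 b x u \<bullet> b) *\<^sub>R v x)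
      - ((v x \<bullet> b) *\<^sub>R v2 b x u + (v' x u \<bullet> b) *\<^sub>R v' x b))" for x u
  have eq: "flux_field v v' x = (\<Sum>b\<in>Basis. (v' x b \<bullet> b) *\<^sub>R v x - (v x \<bullet> b) *\<^sub>R v' x b)" for x
  proof -
    have "v' x (v x) = v' x (\<Sum>b\<in>Basis. (v x \<bullet> b) *\<^sub>R b)" by (simp add: euclidean_representation)
    also have "\<dots> = (\<Sum>b\<in>Basis. (v x \<bullet> b) *\<^sub>R v' x b)"
      using C1_on_linear[OF v, of x] by (simp add: linear_sum linear_scale)
    finally show ?thesis
      by (simp add: flux_field_def divergence_def sum_subtractf scaleR_sum_left)
  qed
  have "C1_on UNIV (\<lambda>x. \<Sum>b\<in>Basis. (v' x b \<bullet> b) *\<^sub>R v x - (v x \<bullet> b) *\<^sub>R v' x b) w'"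
    unfolding w'_def[abs_def]
    by (intro C1_on_sum C1_on_diff C1_on_scaleR C1_on_inner_const v v2)
  then have "C1_on UNIV (flux_field v v') w'" by (simp add: eq[abs_def])
  moreover have "divergence (w' x) = (divergence (v' x))\<^sup>2 - sq_trace (v' x)" for x
  proof -
    have "divergence (w' x) = (\<Sum>c\<in>Basis. \<Sum>b\<in>Basis. (v' x b \<bullet> b) * (v' x c \<bullet> c) + (v2 b x c \<bullet> b) * (v x \<bullet> c)
      - (v x \<bullet> b) * (v2 b x c \<bullet> c) - (v' x c \<bullet> b) * (v' x b \<bullet> c))"
      by (simp add: divergence_def w'_def inner_sum_left inner_diff_left inner_add_left algebra_simps)
    also have "\<dots> = (\<Sum>c\<in>Basis. \<Sum>b\<in>Basis. (v' x b \<bullet> b) * (v' x c \<bullet> c)) +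
        (\<Sum>c\<in>Basis. \<Sum>b\<in>Basis. (v2 b x c \<bullet> b) * (v x \<bullet> c)) -
        (\<Sum>c\<in>Basis. \<Sum>b\<in>Basis. (v x \<bullet> b) * (v2 b x c \<bullet> c)) - sq_trace (v' x)"
      by (simp add: sum.distrib sum_subtractf sq_trace_def)
    \<comment> \<open>Exchanging the summation order and then the order of differentiation turns
      this double sum into the one it is subtracted from.\<close>
    also have "(\<Sum>c\<in>Basis. \<Sum>b\<in>Basis. (v x \<bullet> b) * (v2 b x c \<bullet> c)) =
        (\<Sum>b\<in>Basis. \<Sum>c\<in>Basis. (v x \<bullet> b) * (v2 b x c \<bullet> c))"
      by (rule sum.swap)
    also have "\<dots> = (\<Sum>c\<in>Basis. \<Sum>b\<in>Basis. (v2 b x c \<bullet> b) * (v x \<bullet> c))"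
      by (intro sum.cong refl) (simp add: second_derivative_symmetric[OF v v2, of _ x] mult.commute)
    also have "(\<Sum>c\<in>Basis. \<Sum>b\<in>Basis. (v' x b \<bullet> b) * (v' x c \<bullet> c)) = (divergence (v' x))\<^sup>2"
      by (simp add: divergence_def power2_eq_square sum_product mult.commute)
    finally show ?thesis by simp
  qed
  ultimately show ?thesis by blast
qed

text \<open>The projections of an orthonormal basis to the hyperplane orthogonal to \<open>n\<close>
  are not a basis of it, but they form a Parseval frame and therefore still compute the trace on the
  tangent space. No orthonormal tangent frame has to be chosen.\<close>

lemma divergence_tangential:
  fixes A :: "'a::euclidean_space \<Rightarrow> 'a"
  assumes "linear A" "norm n = 1"
  shows "(\<Sum>b\<in>Basis. A (b - (b \<bullet> n) *\<^sub>R n) \<bullet> (b - (b \<bullet> n) *\<^sub>R n)) = divergence A - A n \<bullet> n"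
proof -
  have nn: "(\<Sum>b\<in>Basis. (b \<bullet> n) * (b \<bullet> n)) = 1"
    using assms(2) euclidean_inner[of n n] by (simp add: norm_eq_1 inner_commute)
  have "A n = A (\<Sum>b\<in>Basis. (n \<bullet> b) *\<^sub>R b)" by (simp add: euclidean_representation)
  also have "\<dots> = (\<Sum>b\<in>Basis. (b \<bullet> n) *\<^sub>R A b)"
    using assms(1) by (simp add: linear_sum linear_scale inner_commute)
  finally have 1: "(\<Sum>b\<in>Basis. (b \<bullet> n) * (A b \<bullet> n)) = A n \<bullet> n" by (simp add: inner_sum_left)
  have 2: "(\<Sum>b\<in>Basis. (b \<bullet> n) * (A n \<bullet> b)) = A n \<bullet> n"
    using euclidean_inner[of "A n" n] by (simp add: inner_commute mult.commute)
  have "(\<Sum>b\<in>Basis. A (b - (b \<bullet> n) *\<^sub>R n) \<bullet> (b - (b \<bullet> n) *\<^sub>R n)) =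
    (\<Sum>b\<in>Basis. A b \<bullet> b - (b \<bullet> n) * (A b \<bullet> n) - (b \<bullet> n) * (A n \<bullet> b) + (b \<bullet> n) * (b \<bullet> n) * (A n \<bullet> n))"
    using assms(1) by (simp add: linear_diff linear_scale inner_diff_left inner_diff_right algebra_simps)
  also have "\<dots> = divergence A - A n \<bullet> n - A n \<bullet> n + 1 * (A n \<bullet> n)"
    by (simp only: sum.distrib sum_subtractf sum_distrib_right[symmetric] 1 2 nn divergence_def)
  finally show ?thesis by simp
qed

section \<open>Boundary charts and the one-sided Gauss theorem\<close>

lemma grad_inner:
  fixes g :: "real^'n \<Rightarrow> real"
  assumes "linear (frechet_derivative g (at y))"
  shows "grad g y \<bullet> u = frechet_derivative g (at y) u"
proof -
  have "frechet_derivative g (at y) u = frechet_derivative g (at y) (\<Sum>i\<in>UNIV. (u $ i) *\<^sub>R axis i 1)"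
    by (subst basis_expansion[of u, symmetric]) (simp add: scalar_mult_eq_scaleR)
  also have "\<dots> = (\<Sum>i\<in>UNIV. (u $ i) * frechet_derivative g (at y) (axis i 1))"
    using assms by (simp add: linear_sum linear_scale)
  also have "\<dots> = grad g y \<bullet> u" by (simp add: inner_vec_def grad_def pd_def mult.commute)
  finally show ?thesis ..
qed

text \<open>\<open>local_subgraph\<close> describes only the domain itself. Graph points are limits
  of inner points because moving along \<open>- e\<close> leaves \<open>g\<close> unchanged, and a
  point strictly above the graph has a neighbourhood that misses the domain.\<close>

lemma frontier_local_subgraph:
  fixes g :: "real^'n \<Rightarrow> real"
  assumes L: "local_subgraph \<Omega> x e r g" and "open \<Omega>" and g: "continuous_on (ball x r) g" and y: "y \<in> ball x r"
  shows "y \<in> frontier \<Omega> \<longleftrightarrow> y \<bullet> e = g y"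
proof -
  have e: "e \<bullet> e = 1" and inv: "\<And>y t. g (y + t *\<^sub>R e) = g y"
    and sub: "\<And>z. z \<in> ball x r \<Longrightarrow> z \<in> \<Omega> \<longleftrightarrow> z \<bullet> e < g z"
    using L by (auto simp: local_subgraph_def norm_eq_1)
  have fr: "frontier \<Omega> = closure \<Omega> - \<Omega>" using \<open>open \<Omega>\<close> by (simp add: frontier_def interior_open)
  show ?thesis
  proof
    assume yf: "y \<in> frontier \<Omega>"
    then have "y \<notin> \<Omega>" using fr by auto
    then have ge: "y \<bullet> e \<ge> g y" using sub[OF y] by simp
    show "y \<bullet> e = g y"
    proof (rule ccontr)
      assume "y \<bullet> e \<noteq> g y"
      then have gt: "y \<bullet> e > g y" using ge by simp
      let ?T = "{z \<in> ball x r. g z - z \<bullet> e < 0}"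
      have "continuous_on (ball x r) (\<lambda>z. g z - z \<bullet> e)" by (intro continuous_intros g)
      then have "open ((\<lambda>z. g z - z \<bullet> e) -` {..<0} \<inter> ball x r)"
        using continuous_on_open_vimage[OF open_ball] open_lessThan by metis
      then have "open ?T" by (simp add: vimage_def Int_def conj_commute)
      moreover have "y \<in> ?T" using gt y by simp
      moreover have "?T \<inter> \<Omega> = {}" using sub by force
      ultimately have "y \<notin> closure \<Omega>" using open_Int_closure_eq_empty by blast
      then show False using yf fr by blast
    qed
  next
    assume eq: "y \<bullet> e = g y"
    have "y \<in> closure \<Omega>"
    proof (rule closure_approachable[THEN iffD2], intro allI impI)
      fix \<epsilon> :: real assume "\<epsilon> > 0"
      define t where "t = min \<epsilon> (r - dist x y) / 2"
      have t: "t > 0" "t < \<epsilon>" "t < r - dist x y" using \<open>\<epsilon> > 0\<close> y by (auto simp: t_def)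
      let ?z = "y + (- t) *\<^sub>R e"
      have d: "dist ?z y = t" using L t(1) by (simp add: dist_norm local_subgraph_def)
      then have "dist x ?z < r" using dist_triangle[of x ?z y] t(3) by (simp add: dist_commute)
      moreover have "?z \<bullet> e < g ?z" using inv[of y "-t"] eq e t(1) by (simp add: inner_diff_left)
      ultimately have "?z \<in> \<Omega>" using sub by simp
      then show "\<exists>z\<in>\<Omega>. dist z y < \<epsilon>" using d t(2) by (intro bexI[of _ ?z]) auto
    qed
    moreover have "y \<notin> \<Omega>" using sub[OF y] eq by simp
    ultimately show "y \<in> frontier \<Omega>" using fr by blast
  qed
qed

text \<open>The last clause says that \<open>e\<close> minus the gradient of \<open>g\<close> is a
  positive multiple of \<nu>. In this form sign conditions and tangency pass between \<nu> and the
  chart without the normalising factor.\<close>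

definition normal_chart :: "(real^'n) set \<Rightarrow> (real^'n) set \<Rightarrow> (real^'n \<Rightarrow> real^'n) \<Rightarrow> real^'n \<Rightarrow> real \<Rightarrow> real^'n
    \<Rightarrow> (real^'n \<Rightarrow> real) \<Rightarrow> (real^'n \<Rightarrow> real^'n \<Rightarrow> real) \<Rightarrow> bool" where
  "normal_chart \<Omega> \<Gamma> \<nu> x r e g g' \<longleftrightarrow> 0 < r \<and> norm e = 1 \<and> C1_on (ball x r) g g' \<and> (\<forall>y t. g (y + t *\<^sub>R e) = g y) \<and>
     \<Omega> \<inter> ball x r = {y \<in> ball x r. y \<bullet> e < g y} \<and>
     (\<forall>y \<in> ball x r. y \<in> frontier \<Omega> \<longleftrightarrow> y \<bullet> e = g y) \<and> frontier \<Omega> \<inter> ball x r \<subseteq> \<Gamma> \<and>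
     (\<forall>y \<in> frontier \<Omega> \<inter> ball x r. norm (\<nu> y) = 1 \<and> (\<exists>l>0. \<forall>u. u \<bullet> e - g' y u = l * (u \<bullet> \<nu> y)))"

lemma normal_chartD:
  assumes "normal_chart \<Omega> \<Gamma> \<nu> x r e g g'"
  shows "0 < r" "norm e = 1" "C1_on (ball x r) g g'" "\<And>y t. g (y + t *\<^sub>R e) = g y"
    "\<Omega> \<inter> ball x r = {y \<in> ball x r. y \<bullet> e < g y}"
    "\<And>y. y \<in> ball x r \<Longrightarrow> y \<in> frontier \<Omega> \<longleftrightarrow> y \<bullet> e = g y"
    "frontier \<Omega> \<inter> ball x r \<subseteq> \<Gamma>"
    "\<And>y. y \<in> frontier \<Omega> \<inter> ball x r \<Longrightarrow> norm (\<nu> y) = 1 \<and> (\<exists>l>0. \<forall>u. u \<bullet> e - g' y u = l * (u \<bullet> \<nu> y))"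
  using assms unfolding normal_chart_def by blast+

lemma pw_C2_chart:
  fixes \<Omega> :: "(real^'n) set"
  assumes P: "pw_C2 \<Omega> \<Gamma>1 \<nu>" and x: "x \<in> \<Gamma>1"
  shows "\<exists>r e g g'. normal_chart \<Omega> \<Gamma>1 \<nu> x r e g g'"
proof -
  obtain e r g where L: "local_subgraph \<Omega> x e r g" and g2: "Ck_on 2 (ball x r) g"
    and nu: "\<And>y. y \<in> frontier \<Omega> \<inter> ball x r \<Longrightarrow> \<nu> y = (1 / norm (e - grad g y)) *\<^sub>R (e - grad g y)"
    using P x unfolding pw_C2_def by metis
  have "open \<Omega>" using P by (simp add: pw_C2_def)
  obtain T where T: "open T" "\<Gamma>1 = frontier \<Omega> \<inter> T"
    using P unfolding pw_C2_def openin_open by blast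
  obtain r2 where r2: "r2 > 0" "ball x r2 \<subseteq> T"
    using T x open_contains_ball by (metis IntD2)
  define g' where "g' y = frechet_derivative g (at y)" for y
  have G: "C1_on (ball x r) g g'"
    using Ck_on_imp_C1_on[of 1] g2 unfolding g'_def[abs_def] numeral_2_eq_2 by simp
  have r: "r > 0" and e: "norm e = 1" and inv: "\<And>y t. g (y + t *\<^sub>R e) = g y"
    and sub: "\<Omega> \<inter> ball x r = {y \<in> ball x r. y \<bullet> e < g y}"
    using L unfolding local_subgraph_def by auto
  \<comment> \<open>Shrinking the ball uses that \<open>\<Gamma>1\<close> is relatively open: every
    frontier point of the smaller ball is regular.\<close>
  define \<rho> where "\<rho> = min r r2"
  have B: "ball x \<rho> \<subseteq> ball x r" "ball x \<rho> \<subseteq> ball x r2" by (auto simp: \<rho>_def)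
  have "normal_chart \<Omega> \<Gamma>1 \<nu> x \<rho> e g g'"
    unfolding normal_chart_def
  proof (intro conjI ballI)
    show "\<rho> > 0" using r r2 by (simp add: \<rho>_def)
    show "C1_on (ball x \<rho>) g g'" by (rule C1_on_subset[OF G B(1)])
    show "\<Omega> \<inter> ball x \<rho> = {y \<in> ball x \<rho>. y \<bullet> e < g y}" using sub B(1) by blast
    show "y \<in> frontier \<Omega> \<longleftrightarrow> y \<bullet> e = g y" if "y \<in> ball x \<rho>" for y
      using frontier_local_subgraph[OF L \<open>open \<Omega>\<close> C1_on_continuous[OF G]] that B(1) by blast
  next
    show "frontier \<Omega> \<inter> ball x \<rho> \<subseteq> \<Gamma>1" using T(2) r2(2) B(2) by blast
    fix y assume "y \<in> frontier \<Omega> \<inter> ball x \<rho>"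
    then have y: "y \<in> frontier \<Omega> \<inter> ball x r" using B(1) by blast
    then have yB: "y \<in> ball x r" by simp
    define m where "m = e - grad g y"
    have gi: "grad g y \<bullet> u = g' y u" for u
      unfolding g'_def by (rule grad_inner) (use C1_on_linear[OF G yB] in \<open>simp add: g'_def\<close>)
    have "((\<lambda>t. g (y + t *\<^sub>R e)) has_real_derivative g' (y + 0 *\<^sub>R e) e) (at 0)"
      by (rule C1_on_line[OF G]) (use yB in simp)
    then have "((\<lambda>t. g y) has_real_derivative g' y e) (at 0)" by (simp add: inv)
    then have "g' y e = 0" using DERIV_unique DERIV_const by blast
    \<comment> \<open>The gradient of \<open>g\<close> is orthogonal to \<open>e\<close>, so the
      vector that is normalised cannot vanish.\<close>
    then have "m \<bullet> e = 1" using gi[of e] e by (simp add: m_def inner_diff_left norm_eq_1)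
    then have m: "norm m > 0" by auto
    have num: "\<nu> y = (1 / norm m) *\<^sub>R m" using nu[OF y] by (simp add: m_def)
    have "norm (\<nu> y) = 1" using m by (simp add: num)
    moreover have "u \<bullet> e - g' y u = norm m * (u \<bullet> \<nu> y)" for u
      using m gi[of u] by (simp add: num m_def inner_diff_right inner_diff_left inner_commute)
    ultimately show "norm (\<nu> y) = 1" "\<exists>l>0. \<forall>u. u \<bullet> e - g' y u = l * (u \<bullet> \<nu> y)" using m by blast+
  qed (use e inv in auto)
  then show ?thesis by blast
qed

text \<open>Well inside the domain the integral is that of a full divergence; away from the closure
  the integrand is zero; at a regular boundary point the chart estimate applies. Only singular
  boundary points are left out.\<close>

lemma pw_C2_good_ball:
  fixes \<Omega> :: "(real^'n) set"
  assumes P: "pw_C2 \<Omega> \<Gamma>1 \<nu>" and x: "x \<notin> frontier \<Omega> - \<Gamma>1"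
  shows "\<exists>s. good_ball \<Omega> \<Gamma>1 \<nu> x s"
proof -
  have op: "open \<Omega>" using P by (simp add: pw_C2_def)
  consider "x \<in> \<Omega>" | "x \<notin> closure \<Omega>" | "x \<in> \<Gamma>1"
    using x op by (auto simp: frontier_def interior_open)
  then show ?thesis
  proof cases
    case 1
    then obtain r where r: "r > 0" "cball x r \<subseteq> \<Omega>" using op open_contains_cball by metis
    have "good_ball \<Omega> \<Gamma>1 \<nu> x (r/2)"
      unfolding good_ball_def
    proof (intro conjI allI impI)
      fix w :: "real^'n \<Rightarrow> real^'n" and w'
      assume W: "C1_on UNIV w w'" "\<forall>x'. w x' \<noteq> 0 \<longrightarrow> x' \<in> cball x (2 * (r/2))"
      have "divergence (w' y) \<noteq> 0 \<Longrightarrow> y \<in> cball x (2 * (r/2))" for y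
        using C1_derivative_zero_outside[OF W(1) closed_cball, of x "2 * (r/2)" y] W(2) divergence_zero by blast
      then have "(\<lambda>y. indicator \<Omega> y * divergence (w' y)) = (\<lambda>y. divergence (w' y))"
        using r(2) by (force simp: fun_eq_iff indicator_def)
      then show "(\<integral>y. indicator \<Omega> y * divergence (w' y) \<partial>lborel) \<le> 0"
        using integral_divergence_zero[OF W(1) compact_cball, of x "2 * (r/2)"] W(2) by simp
    qed (use r in auto)
    then show ?thesis ..
  next
    case 2
    then obtain r where r: "r > 0" "cball x r \<subseteq> - closure \<Omega>"
      using open_contains_cball[of "- closure \<Omega>"] by auto
    have "good_ball \<Omega> \<Gamma>1 \<nu> x (r/2)"
      unfolding good_ball_def
    proof (intro conjI allI impI)
      fix w :: "real^'n \<Rightarrow> real^'n" and w'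
      assume W: "C1_on UNIV w w'" "\<forall>x'. w x' \<noteq> 0 \<longrightarrow> x' \<in> cball x (2 * (r/2))"
      have "divergence (w' y) \<noteq> 0 \<Longrightarrow> y \<in> cball x (2 * (r/2))" for y
        using C1_derivative_zero_outside[OF W(1) closed_cball, of x "2 * (r/2)" y] W(2) divergence_zero by blast
      then have "(\<lambda>y. indicator \<Omega> y * divergence (w' y)) = (\<lambda>y. 0)"
        using r(2) closure_subset[of \<Omega>] by (force simp: fun_eq_iff indicator_def)
      then show "(\<integral>y. indicator \<Omega> y * divergence (w' y) \<partial>lborel) \<le> 0" by simp
    qed (use r in auto)
    then show ?thesis ..
  next
    case 3
    obtain r e g g' where "normal_chart \<Omega> \<Gamma>1 \<nu> x r e g g'"
      using pw_C2_chart[OF P 3] by blast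
    note C = normal_chartD[OF this]
    \<comment> \<open>A third of the chart radius, so that the doubled ball still lies strictly
      inside the chart.\<close>
    have "good_ball \<Omega> \<Gamma>1 \<nu> x (r/3)"
      unfolding good_ball_def
    proof (intro conjI allI impI)
      fix w :: "real^'n \<Rightarrow> real^'n" and w'
      assume W: "C1_on UNIV w w'" "inward \<Gamma>1 \<nu> w" "\<forall>x'. w x' \<noteq> 0 \<longrightarrow> x' \<in> cball x (2 * (r/3))"
      show "(\<integral>y. indicator \<Omega> y * divergence (w' y) \<partial>lborel) \<le> 0"
      proof (rule chart_flux_nonpos[OF op _ _ W(1) _ C(3) C(2) C(4) C(5), of "2 * (r/3)"])
        fix y assume y: "y \<in> cball x (2 * (r/3))" "y \<bullet> e = g y"
        have yB: "y \<in> ball x r" using y(1) C(1) by auto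
        then have yf: "y \<in> frontier \<Omega> \<inter> ball x r" using C(6) y(2) by blast
        then obtain l where "l > 0" "\<And>u. u \<bullet> e - g' y u = l * (u \<bullet> \<nu> y)" using C(8) by blast
        moreover have "w y \<bullet> \<nu> y \<le> 0" using W(2) yf C(7) unfolding inward_def by blast
        ultimately show "w y \<bullet> e - g' y (w y) \<le> 0" by (simp add: mult_nonneg_nonpos)
      qed (use C(1) W(3) in auto)
    qed (use C(1) in auto)
    then show ?thesis ..
  qed
qed

text \<open>The one-sided Gauss theorem on the whole domain. The assumption on
  \<open>CARD('n)\<close> makes the exponent in \<open>hnull\<close> positive, as
  \<open>hnull_cover\<close> requires, and the singular part meets \<open>K\<close> in a compact set
  because \<open>\<Gamma>1\<close> is relatively open.\<close>

lemma pw_C2_flux_nonpos: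
  fixes \<Omega> :: "(real^'n) set"
  assumes P: "pw_C2 \<Omega> \<Gamma>1 \<nu>" and N: "CARD('n) \<ge> 2"
    and W: "C1_on UNIV w w'" "inward \<Gamma>1 \<nu> w" and K: "compact K" "\<And>x. w x \<noteq> 0 \<Longrightarrow> x \<in> K"
  shows "(\<integral>x. indicator \<Omega> x * divergence (w' x) \<partial>lborel) \<le> 0"
proof (rule flux_nonpos_removable[OF _ K(1) W K(2), where S="frontier \<Omega> - \<Gamma>1"])
  show "open \<Omega>" using P by (simp add: pw_C2_def)
  obtain T where T: "open T" "\<Gamma>1 = frontier \<Omega> \<inter> T"
    using P unfolding pw_C2_def openin_open by blast
  have "K \<inter> (frontier \<Omega> - \<Gamma>1) = K \<inter> (frontier \<Omega> - T)" using T(2) by blast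
  then have "compact (K \<inter> (frontier \<Omega> - \<Gamma>1))" using K(1) T(1)
    by (simp add: compact_Int_closed closed_Diff)
  then show "\<exists>(I::nat set) c r. finite I \<and> (\<forall>i\<in>I. 0 < r i \<and> r i \<le> 1) \<and>
        K \<inter> (frontier \<Omega> - \<Gamma>1) \<subseteq> (\<Union>i\<in>I. ball (c i) (r i)) \<and> (\<Sum>i\<in>I. r i ^ (DIM(real^'n) - 1)) < \<delta>"
    if "0 < \<delta>" for \<delta>
    using hnull_cover[of "CARD('n) - 1" "frontier \<Omega> - \<Gamma>1" K \<delta>] that N P by (simp add: pw_C2_def)
qed (use pw_C2_good_ball[OF P] in auto)

text \<open>The chain rule along a curve in the boundary with velocity \<tau>. This is how boundary
  conditions, which are known only on the boundary, yield information on full derivatives.\<close>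

lemma tangential_derivative_zero:
  fixes \<Omega> :: "(real^'n) set" and f :: "real^'n \<Rightarrow> 'b::real_normed_vector"
  assumes P: "pw_C2 \<Omega> \<Gamma>1 \<nu>" and x: "x \<in> \<Gamma>1" and f: "(f has_derivative f') (at x)"
    and V: "open V" "x \<in> V" "\<And>y. y \<in> frontier \<Omega> \<inter> V \<Longrightarrow> f y = 0" and \<tau>: "\<tau> \<bullet> \<nu> x = 0"
  shows "f' \<tau> = 0"
proof -
  obtain r e g g' where "normal_chart \<Omega> \<Gamma>1 \<nu> x r e g g'"
    using pw_C2_chart[OF P x] by blast
  note C = normal_chartD[OF this]
  have xf: "x \<in> frontier \<Omega>" using P x by (auto simp: pw_C2_def)
  have xB: "x \<in> ball x r" using C(1) by simp
  obtain l where l: "\<And>u. u \<bullet> e - g' x u = l * (u \<bullet> \<nu> x)" using C(8) xf xB by blast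
  have g\<tau>: "g' x \<tau> = \<tau> \<bullet> e" using l[of \<tau>] \<tau> by simp
  \<comment> \<open>Follow the tangent line and correct along \<open>e\<close> back to the graph.
    The correction has derivative 0 at the start because \<open>g\<close> and the height change at
    the same rate in the direction \<tau>.\<close>
  define c where "c s = x + s *\<^sub>R \<tau> + (g (x + s *\<^sub>R \<tau>) - (x + s *\<^sub>R \<tau>) \<bullet> e) *\<^sub>R e" for s
  have lin: "linear (g' x)" using C1_on_linear[OF C(3) xB] .
  have c0: "c 0 = x" using C(6)[OF xB] xf by (simp add: c_def)
  have "((\<lambda>s. g (x + s *\<^sub>R \<tau>)) has_real_derivative g' (x + 0 *\<^sub>R \<tau>) \<tau>) (at 0)"
    by (rule C1_on_line[OF C(3)]) (use xB in simp)
  then have gd: "((\<lambda>s. g (x + s *\<^sub>R \<tau>)) has_derivative (\<lambda>s. s * (\<tau> \<bullet> e))) (at 0)"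
    by (simp add: has_field_derivative_def g\<tau> mult_commute_abs)
  have cd: "(c has_derivative (\<lambda>s. s *\<^sub>R \<tau>)) (at 0)"
    unfolding c_def by (rule derivative_eq_intros gd refl | simp)+
  have "((\<lambda>s. f (c s)) has_derivative (\<lambda>s. f' (s *\<^sub>R \<tau>))) (at 0)"
    by (rule has_derivative_compose[OF cd]) (use f in \<open>simp add: c0\<close>)
  moreover have "((\<lambda>s. f (c s)) has_derivative (\<lambda>s. 0)) (at 0)"
  proof (rule has_derivative_transform_eventually[where f="\<lambda>s. 0"])
    have "isCont c 0" using cd has_derivative_continuous by blast
    then have "(c \<longlongrightarrow> x) (at 0)" using c0 by (simp add: isCont_def)
    moreover have "open (V \<inter> ball x r)" using V by auto
    ultimately have "\<forall>\<^sub>F s in at 0. c s \<in> V \<inter> ball x r"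
      using V(2) xB by (intro topological_tendstoD) auto
    then have "\<forall>\<^sub>F s in at 0. f (c s) = 0"
    proof eventually_elim
      case (elim s)
      have "g (c s) = g (x + s *\<^sub>R \<tau>)" unfolding c_def by (rule C(4))
      moreover have "c s \<bullet> e = g (x + s *\<^sub>R \<tau>)"
        using C(2) by (simp add: c_def inner_add_left norm_eq_1)
      ultimately have "c s \<in> frontier \<Omega>" using C(6)[of "c s"] elim by simp
      then show ?case using V(3) elim by blast
    qed
    then show "\<forall>\<^sub>F s in at 0. 0 = f (c s)" by eventually_elim simp
    show "0 = f (c 0)" using c0 V xf by simp
  qed auto
  ultimately have "(\<lambda>s. f' (s *\<^sub>R \<tau>)) = (\<lambda>s. 0)" by (rule has_derivative_unique)
  from fun_cong[OF this, of 1] show ?thesis by simp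
qed

section \<open>Boundary values of the flux field\<close>

lemma pw_C2_normal_C1:
  fixes \<Omega> :: "(real^'n) set"
  assumes P: "pw_C2 \<Omega> \<Gamma>1 \<nu>"
  obtains U where "open U" "\<Gamma>1 \<subseteq> U" "C1_on U \<nu> (\<lambda>x. frechet_derivative \<nu> (at x))"
  using assms Ck_on_imp_C1_on[of 0] unfolding pw_C2_def One_nat_def by blast

lemma pw_C2_normal_unit:
  fixes \<Omega> :: "(real^'n) set"
  assumes "pw_C2 \<Omega> \<Gamma>1 \<nu>" "x \<in> \<Gamma>1"
  shows "norm (\<nu> x) = 1"
proof -
  have xf: "x \<in> frontier \<Omega>" using assms by (auto simp: pw_C2_def)
  obtain r e g g' where "normal_chart \<Omega> \<Gamma>1 \<nu> x r e g g'"
    using pw_C2_chart[OF assms] by blast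
  note C = normal_chartD[OF this]
  show ?thesis using C(1) C(8)[of x] xf by simp
qed

text \<open>Here \<open>v x\<close> is itself a tangent vector, so the condition on \<nu> and v may
  be differentiated along it. This trades the normal part of \<open>v' x (v x)\<close> for minus the
  second fundamental form at \<open>v x\<close>.\<close>

lemma flux_field_normal:
  fixes \<Omega> :: "(real^'n) set"
  assumes P: "pw_C2 \<Omega> \<Gamma>1 \<nu>" and x: "x \<in> \<Gamma>1" and v: "(v has_derivative v' x) (at x)"
    and n: "(\<nu> has_derivative n') (at x)"
    and V: "open V" "x \<in> V" "\<And>y. y \<in> frontier \<Omega> \<inter> V \<Longrightarrow> \<nu> y \<bullet> v y = 0"
  shows "v x \<bullet> \<nu> x = 0" "flux_field v v' x \<bullet> \<nu> x = n' (v x) \<bullet> v x"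
proof -
  have "x \<in> frontier \<Omega>" using P x by (auto simp: pw_C2_def)
  then show 0: "v x \<bullet> \<nu> x = 0" using V by (simp add: inner_commute)
  have "((\<lambda>y. \<nu> y \<bullet> v y) has_derivative (\<lambda>u. \<nu> x \<bullet> v' x u + n' u \<bullet> v x)) (at x)"
    by (rule has_derivative_inner[OF n v])
  from tangential_derivative_zero[OF P x this V 0]
  show "flux_field v v' x \<bullet> \<nu> x = n' (v x) \<bullet> v x"
    using 0 by (simp add: flux_field_def inner_diff_left inner_commute[of "\<nu> x"])
qed

text \<open>On the boundary v = \<alpha> \<nu> with \<alpha> the normal component. Along a tangent
  vector \<tau> the derivative of \<alpha> is multiplied by \<nu> and disappears after pairing with
  \<tau>, so the tangential divergence of v is \<alpha> times the trace of the second fundamental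
  form. The flux contributes the other factor \<alpha>.\<close>

lemma flux_field_tangential:
  fixes \<Omega> :: "(real^'n) set"
  assumes P: "pw_C2 \<Omega> \<Gamma>1 \<nu>" and x: "x \<in> \<Gamma>1" and v: "(v has_derivative v' x) (at x)"
    and n: "(\<nu> has_derivative n') (at x)"
    and V: "open V" "x \<in> V" "\<And>y. y \<in> frontier \<Omega> \<inter> V \<Longrightarrow> v y - (\<nu> y \<bullet> v y) *\<^sub>R \<nu> y = 0"
  shows "flux_field v v' x \<bullet> \<nu> x = (\<nu> x \<bullet> v x)\<^sup>2 *
    (\<Sum>b\<in>Basis. n' (b - (b \<bullet> \<nu> x) *\<^sub>R \<nu> x) \<bullet> (b - (b \<bullet> \<nu> x) *\<^sub>R \<nu> x))"
proof -
  let ?\<alpha> = "\<nu> x \<bullet> v x"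
  let ?P = "\<lambda>b. b - (b \<bullet> \<nu> x) *\<^sub>R \<nu> x"
  have nn: "norm (\<nu> x) = 1" by (rule pw_C2_normal_unit[OF P x])
  have "x \<in> frontier \<Omega>" using P x by (auto simp: pw_C2_def)
  then have vx: "v x = ?\<alpha> *\<^sub>R \<nu> x" using V by simp
  have D: "((\<lambda>y. v y - (\<nu> y \<bullet> v y) *\<^sub>R \<nu> y) has_derivative
     (\<lambda>u. v' x u - (?\<alpha> *\<^sub>R n' u + (\<nu> x \<bullet> v' x u + n' u \<bullet> v x) *\<^sub>R \<nu> x))) (at x)"
    by (intro has_derivative_diff has_derivative_scaleR has_derivative_inner n v)
  have tang: "v' x \<tau> \<bullet> \<tau> = ?\<alpha> * (n' \<tau> \<bullet> \<tau>)" if "\<tau> \<bullet> \<nu> x = 0" for \<tau>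
  proof -
    have "v' x \<tau> - (?\<alpha> *\<^sub>R n' \<tau> + (\<nu> x \<bullet> v' x \<tau> + n' \<tau> \<bullet> v x) *\<^sub>R \<nu> x) = 0"
      by (rule tangential_derivative_zero[OF P x D V that])
    then have "v' x \<tau> = ?\<alpha> *\<^sub>R n' \<tau> + (\<nu> x \<bullet> v' x \<tau> + n' \<tau> \<bullet> v x) *\<^sub>R \<nu> x" by simp
    then have "v' x \<tau> \<bullet> \<tau> = (?\<alpha> *\<^sub>R n' \<tau> + (\<nu> x \<bullet> v' x \<tau> + n' \<tau> \<bullet> v x) *\<^sub>R \<nu> x) \<bullet> \<tau>" by simp
    then show ?thesis using that by (simp add: inner_add_left inner_commute[of "\<nu> x" \<tau>])
  qed
  have lin: "linear (v' x)" using v has_derivative_linear by blast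
  have "v' x (v x) = ?\<alpha> *\<^sub>R v' x (\<nu> x)" using linear_scale[OF lin, of ?\<alpha> "\<nu> x"] vx by simp
  then have "flux_field v v' x \<bullet> \<nu> x = ?\<alpha> * (divergence (v' x) - v' x (\<nu> x) \<bullet> \<nu> x)"
    by (simp add: flux_field_def inner_diff_left algebra_simps inner_commute[of "v x"])
  also have "\<dots> = ?\<alpha> * (\<Sum>b\<in>Basis. v' x (?P b) \<bullet> ?P b)"
    by (simp add: divergence_tangential[OF lin nn])
  also have "\<dots> = ?\<alpha> * (\<Sum>b\<in>Basis. ?\<alpha> * (n' (?P b) \<bullet> ?P b))"
    using nn by (simp add: tang inner_diff_left norm_eq_1)
  finally show ?thesis by (simp add: sum_distrib_left power2_eq_square mult.assoc)
qed

text \<open>Used with \<sigma> = 1 for concave domains; polyhedra admit \<sigma> = -1 as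
  well.\<close>

lemma flux_field_boundary_sign:
  fixes \<Omega> :: "(real^'n) set"
  assumes P: "pw_C2 \<Omega> \<Gamma>1 \<nu>" and \<Gamma>t: "openin (top_of_set (frontier \<Omega>)) \<Gamma>t"
    and v: "C1_on UNIV v v'"
    and vt: "\<And>x. x \<in> \<Gamma>1 \<inter> \<Gamma>t \<Longrightarrow> v x - (\<nu> x \<bullet> v x) *\<^sub>R \<nu> x = 0"
    and vn: "\<And>x. x \<in> \<Gamma>1 \<inter> (frontier \<Omega> - closure \<Gamma>t) \<Longrightarrow> \<nu> x \<bullet> v x = 0"
    and II: "\<And>x \<tau>. x \<in> \<Gamma>1 \<Longrightarrow> \<tau> \<bullet> \<nu> x = 0 \<Longrightarrow> \<sigma> * (frechet_derivative \<nu> (at x) \<tau> \<bullet> \<tau>) \<le> 0"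
    and x: "x \<in> \<Gamma>1"
  shows "\<sigma> * (flux_field v v' x \<bullet> \<nu> x) \<le> 0"
proof -
  obtain T where T: "open T" "\<Gamma>1 = frontier \<Omega> \<inter> T"
    using P unfolding pw_C2_def openin_open by blast
  obtain T2 where T2: "open T2" "\<Gamma>t = frontier \<Omega> \<inter> T2" using \<Gamma>t unfolding openin_open by blast
  obtain U where U: "open U" "\<Gamma>1 \<subseteq> U" "C1_on U \<nu> (\<lambda>x. frechet_derivative \<nu> (at x))"
    using pw_C2_normal_C1[OF P] by blast
  have nd: "(\<nu> has_derivative frechet_derivative \<nu> (at y)) (at y)" if "y \<in> \<Gamma>1" for y
    using C1_on_derivative[OF U(3)] U(2) that by blast
  have vd: "(v has_derivative v' y) (at y)" for y using C1_on_derivative[OF v] by simp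
  have t: "\<sigma> * (flux_field v v' y \<bullet> \<nu> y) \<le> 0" if y: "y \<in> \<Gamma>1 \<inter> \<Gamma>t" for y
  proof -
    have y1: "y \<in> \<Gamma>1" using y by simp
    let ?n' = "frechet_derivative \<nu> (at y)"
    let ?P = "\<lambda>b. b - (b \<bullet> \<nu> y) *\<^sub>R \<nu> y"
    have eq: "flux_field v v' y \<bullet> \<nu> y = (\<nu> y \<bullet> v y)\<^sup>2 * (\<Sum>b\<in>Basis. ?n' (?P b) \<bullet> ?P b)"
      by (rule flux_field_tangential[where v'=v' and x=y and V="T \<inter> T2", OF P y1 vd nd[OF y1]]) (use T T2 y vt in auto)
    have "\<sigma> * (\<Sum>b\<in>Basis. ?n' (?P b) \<bullet> ?P b) \<le> 0"
      unfolding sum_distrib_left using pw_C2_normal_unit[OF P y1]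
      by (intro sum_nonpos II[OF y1]) (simp add: inner_diff_left norm_eq_1)
    then have "(\<nu> y \<bullet> v y)\<^sup>2 * (\<sigma> * (\<Sum>b\<in>Basis. ?n' (?P b) \<bullet> ?P b)) \<le> 0"
      by (rule mult_nonneg_nonpos[OF zero_le_power2])
    then show ?thesis unfolding eq by (simp add: mult_ac)
  qed
  show ?thesis
  proof (cases "x \<in> closure \<Gamma>t")
    case False
    have *: "v x \<bullet> \<nu> x = 0" "flux_field v v' x \<bullet> \<nu> x = frechet_derivative \<nu> (at x) (v x) \<bullet> v x"
      by (rule flux_field_normal[where v'=v' and x=x and V="T \<inter> - closure \<Gamma>t", OF P x vd nd[OF x]]; use T x False vn in auto)+
    then show ?thesis using II[OF x *(1)] by simp
  next
    case True
    have xT: "x \<in> T" "x \<in> U" using x T U by auto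
    \<comment> \<open>Points of \<open>\<Gamma>t\<close> inside \<open>T\<close> belong to
      \<open>\<Gamma>1\<close>, so the tangential case applies along a sequence in this set that
      converges to \<open>x\<close>.\<close>
    have "x \<in> closure (\<Gamma>t \<inter> (T \<inter> U))"
      using open_Int_closure_subset[of "T \<inter> U" \<Gamma>t] T(1) U(1) xT True by (auto simp: Int_commute)
    then obtain z where z: "\<And>n. z n \<in> \<Gamma>t \<inter> (T \<inter> U)" "z \<longlonglongrightarrow> x" using closure_sequential by metis
    have vsum: "v' y (v y) = (\<Sum>b\<in>Basis. (v y \<bullet> b) *\<^sub>R v' y b)" for y
    proof -
      have "v' y (v y) = v' y (\<Sum>b\<in>Basis. (v y \<bullet> b) *\<^sub>R b)" by (simp add: euclidean_representation)
      then show ?thesis using C1_on_linear[OF v, of y] by (simp add: linear_sum linear_scale)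
    qed
    have "continuous_on U (\<lambda>y. \<sigma> * (flux_field v v' y \<bullet> \<nu> y))"
      unfolding flux_field_def vsum
      by (intro continuous_intros C1_on_continuous[OF U(3)] continuous_on_subset[OF C1_on_continuous[OF v]]
        continuous_on_subset[OF C1_on_continuous_derivative[OF v]] continuous_on_subset[OF continuous_on_divergence[OF v]]) auto
    then have "isCont (\<lambda>y. \<sigma> * (flux_field v v' y \<bullet> \<nu> y)) x"
      using U(1) xT(2) by (simp add: continuous_on_eq_continuous_at)
    then have "(\<lambda>n. \<sigma> * (flux_field v v' (z n) \<bullet> \<nu> (z n))) \<longlonglongrightarrow> \<sigma> * (flux_field v v' x \<bullet> \<nu> x)"
      using z(2) isCont_tendsto_compose by blast
    moreover have "\<sigma> * (flux_field v v' (z n) \<bullet> \<nu> (z n)) \<le> 0" for n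
      using z(1)[of n] T(2) T2(2) by (intro t) auto
    ultimately show ?thesis by (intro LIMSEQ_le_const2) auto
  qed
qed

text \<open>Differentiation along the boundary is used twice. Applied to
  \<open>a \<bullet> z - c\<close> it shows that \<open>a\<close> annihilates all tangent vectors,
  so \<nu> is a multiple of \<open>a\<close>. Hence a vector \<tau> tangent at \<open>x\<close>
  stays orthogonal to \<nu> at all nearby boundary points, and this relation is differentiated along
  \<tau>.\<close>

lemma polyhedral_second_form_zero:
  fixes \<Omega> :: "(real^'n) set"
  assumes Q: "polyhedral_domain \<Omega> \<Gamma>1 \<nu>" and x: "x \<in> \<Gamma>1" and \<tau>: "\<tau> \<bullet> \<nu> x = 0"
  shows "frechet_derivative \<nu> (at x) \<tau> \<bullet> \<tau> = 0"
proof -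
  have P: "pw_C2 \<Omega> \<Gamma>1 \<nu>" using Q by (simp add: polyhedral_domain_def)
  obtain T where T: "open T" "\<Gamma>1 = frontier \<Omega> \<inter> T"
    using P unfolding pw_C2_def openin_open by blast
  obtain r a c where r: "r > 0" "a \<noteq> 0" "frontier \<Omega> \<inter> ball x r = {y \<in> ball x r. a \<bullet> y = c}"
    using Q x unfolding polyhedral_domain_def by blast
  have fr: "y \<in> frontier \<Omega> \<longleftrightarrow> a \<bullet> y = c" if "y \<in> ball x r" for y using r(3) that by blast
  have par: "\<nu> y = ((a \<bullet> \<nu> y) / (a \<bullet> a)) *\<^sub>R a \<and> a = (a \<bullet> \<nu> y) *\<^sub>R \<nu> y"
    if y: "y \<in> frontier \<Omega> \<inter> (T \<inter> ball x r)" for y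
  proof -
    have y1: "y \<in> \<Gamma>1" using y T by blast
    have nn: "\<nu> y \<bullet> \<nu> y = 1" using pw_C2_normal_unit[OF P y1] by (simp add: norm_eq_1)
    have "a \<bullet> u = 0" if "u \<bullet> \<nu> y = 0" for u
    proof (rule tangential_derivative_zero[OF P y1 _ _ _ _ that])
      show "((\<lambda>z. a \<bullet> z - c) has_derivative (\<lambda>u. a \<bullet> u)) (at y)" by (auto intro!: derivative_eq_intros)
      show "open (ball x r)" "y \<in> ball x r" using y by auto
    qed (use fr in auto)
    from this[of "a - (a \<bullet> \<nu> y) *\<^sub>R \<nu> y"]
    have o: "a \<bullet> (a - (a \<bullet> \<nu> y) *\<^sub>R \<nu> y) = 0" using nn by (simp add: inner_diff_left)
    have "(a - (a \<bullet> \<nu> y) *\<^sub>R \<nu> y) \<bullet> (a - (a \<bullet> \<nu> y) *\<^sub>R \<nu> y) = 0"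
      using o nn by (simp add: inner_diff_left inner_diff_right inner_commute)
    then have a: "a = (a \<bullet> \<nu> y) *\<^sub>R \<nu> y" by simp
    define \<beta> where "\<beta> = a \<bullet> \<nu> y"
    have a': "a = \<beta> *\<^sub>R \<nu> y" using a by (simp add: \<beta>_def)
    have "\<beta> \<noteq> 0" using a' r(2) by auto
    moreover have "a \<bullet> a = \<beta> * \<beta>" using nn by (simp add: a')
    ultimately have "\<nu> y = (\<beta> / (a \<bullet> a)) *\<^sub>R a" by (simp add: a')
    then show ?thesis using a by (simp add: \<beta>_def)
  qed
  obtain U where U: "open U" "\<Gamma>1 \<subseteq> U" "C1_on U \<nu> (\<lambda>x. frechet_derivative \<nu> (at x))"
    using pw_C2_normal_C1[OF P] by blast
  have nd: "(\<nu> has_derivative frechet_derivative \<nu> (at x)) (at x)"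
    using C1_on_derivative[OF U(3)] U(2) x by blast
  have xin: "x \<in> frontier \<Omega> \<inter> (T \<inter> ball x r)" using x T r by auto
  have "a \<bullet> \<tau> = ((a \<bullet> \<nu> x) *\<^sub>R \<nu> x) \<bullet> \<tau>" using par[OF xin] by metis
  then have a\<tau>: "a \<bullet> \<tau> = 0" using \<tau> by (simp add: inner_commute)
  show ?thesis
  proof (rule tangential_derivative_zero[OF P x _ _ _ _ \<tau>, where f="\<lambda>y. \<nu> y \<bullet> \<tau>" and V="T \<inter> ball x r"
        and f'="\<lambda>u. frechet_derivative \<nu> (at x) u \<bullet> \<tau>"])
    show "((\<lambda>y. \<nu> y \<bullet> \<tau>) has_derivative (\<lambda>u. frechet_derivative \<nu> (at x) u \<bullet> \<tau>)) (at x)"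
      by (rule has_derivative_inner_left[OF nd])
    show "\<nu> y \<bullet> \<tau> = 0" if "y \<in> frontier \<Omega> \<inter> (T \<inter> ball x r)" for y
    proof -
      have "\<nu> y \<bullet> \<tau> = (((a \<bullet> \<nu> y) / (a \<bullet> a)) *\<^sub>R a) \<bullet> \<tau>" using par[OF that] by metis
      then show ?thesis using a\<tau> by simp
    qed
  qed (use T xin in auto)
qed

lemma smooth_flux_nonpos:
  fixes \<Omega> :: "(real^'n) set"
  assumes P: "pw_C2 \<Omega> \<Gamma>1 \<nu>" and N: "CARD('n) \<ge> 2"
    and \<Gamma>t: "openin (top_of_set (frontier \<Omega>)) \<Gamma>t" and v: "v \<in> Cinf_tn \<Omega> \<Gamma>1 \<nu> \<Gamma>t"
    and II: "\<And>x \<tau>. x \<in> \<Gamma>1 \<Longrightarrow> \<tau> \<bullet> \<nu> x = 0 \<Longrightarrow> \<sigma> * (frechet_derivative \<nu> (at x) \<tau> \<bullet> \<tau>) \<le> 0"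
  defines "A \<equiv> \<lambda>x. frechet_derivative v (at x)"
  shows "\<sigma> * (\<integral>x. indicator \<Omega> x * ((divergence (A x))\<^sup>2 - sq_trace (A x)) \<partial>lborel) \<le> 0"
proof -
  have sm: "smooth v" and cs: "compact_supp v" using v by (auto simp: Cinf_tn_def)
  have k2: "Ck_on (Suc (Suc 0)) UNIV v" using sm unfolding smooth_def by blast
  have V: "C1_on UNIV v A" unfolding A_def by (rule Ck_on_imp_C1_on[OF k2])
  have V2: "C1_on UNIV (\<lambda>x. A x u) (\<lambda>x. frechet_derivative (\<lambda>x. A x u) (at x))" for u
    unfolding A_def by (rule Ck_on_imp_C1_on[of 0]) (use k2 in simp)
  obtain w' where w': "C1_on UNIV (flux_field v A) w'"
    "\<And>x. divergence (w' x) = (divergence (A x))\<^sup>2 - sq_trace (A x)"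
    using flux_field_C1[OF V V2] by blast
  let ?K = "closure {x. v x \<noteq> 0}"
  have "(\<integral>x. indicator \<Omega> x * divergence (\<lambda>u. \<sigma> *\<^sub>R w' x u) \<partial>lborel) \<le> 0"
  proof (rule pw_C2_flux_nonpos[OF P N C1_on_const_scaleR[OF w'(1)]])
    show "inward \<Gamma>1 \<nu> (\<lambda>x. \<sigma> *\<^sub>R flux_field v A x)"
      unfolding inward_def
    proof
      fix y assume y: "y \<in> \<Gamma>1"
      have "\<sigma> * (flux_field v A y \<bullet> \<nu> y) \<le> 0"
      proof (rule flux_field_boundary_sign[OF P \<Gamma>t V _ _ _ y])
        show "v x - (\<nu> x \<bullet> v x) *\<^sub>R \<nu> x = 0" if "x \<in> \<Gamma>1 \<inter> \<Gamma>t" for x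
          using v that unfolding Cinf_tn_def by blast
        show "\<nu> x \<bullet> v x = 0" if "x \<in> \<Gamma>1 \<inter> (frontier \<Omega> - closure \<Gamma>t)" for x
          using v that unfolding Cinf_tn_def by blast
      qed (rule II)
      then show "(\<sigma> *\<^sub>R flux_field v A y) \<bullet> \<nu> y \<le> 0" by simp
    qed
    show "compact ?K" using cs by (simp add: compact_supp_def)
    show "x \<in> ?K" if "\<sigma> *\<^sub>R flux_field v A x \<noteq> 0" for x
    proof (rule ccontr)
      assume "x \<notin> ?K"
      moreover have "{x. v x \<noteq> 0} \<subseteq> ?K" by (rule closure_subset)
      ultimately have "v x = 0" by auto
      then show False using that linear_0[OF C1_on_linear[OF V, of x]] by (simp add: flux_field_def)
    qed
  qed
  moreover have "divergence (\<lambda>u. \<sigma> *\<^sub>R w' x u) = \<sigma> * ((divergence (A x))\<^sup>2 - sq_trace (A x))" for x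
    by (simp only: w'(2)[symmetric]) (simp add: divergence_def sum_distrib_left)
  ultimately show ?thesis by (simp add: mult.left_commute[of _ \<sigma>])
qed

subsection \<open>Test functions and uniqueness of weak gradients\<close>

lemma Ck_on_imp_differentiable: "Ck_on (Suc k) UNIV f \<Longrightarrow> f differentiable (at x)"
  by simp

text \<open>Lets an explicitly known derivative take the place of \<open>frechet_derivative\<close>
  in the recursion.\<close>

lemma Ck_on_Suc_derivative:
  assumes "\<And>x. (f has_derivative f' x) (at x)" "\<And>u. Ck_on k UNIV (\<lambda>x. f' x u)"
  shows "Ck_on (Suc k) UNIV f"
proof -
  have "frechet_derivative f (at x) = f' x" for x
    using frechet_derivative_at[OF assms(1)[of x]] by simp
  then show ?thesis using assms by (auto simp: differentiable_def)
qed

lemma Ck_on_has_derivative: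
  "Ck_on (Suc k) UNIV f \<Longrightarrow> (f has_derivative frechet_derivative f (at x)) (at x)"
  by (simp add: frechet_derivative_works[symmetric])

lemma Ck_on_Suc_D: "Ck_on (Suc k) UNIV f \<Longrightarrow> Ck_on k UNIV f"
proof (induction k arbitrary: f)
  case 0
  show ?case using Ck_on_continuous[OF 0] by simp
next
  case (Suc k)
  then show ?case using Ck_on_imp_differentiable[OF Suc.prems] by (metis Ck_on.simps(2))
qed

lemma Ck_on_add:
  "Ck_on k UNIV f \<Longrightarrow> Ck_on k UNIV g \<Longrightarrow> Ck_on k UNIV (\<lambda>x. f x + g x)"
proof (induction k arbitrary: f g)
  case (Suc k)
  show ?case
  proof (rule Ck_on_Suc_derivative)
    show "((\<lambda>x. f x + g x) has_derivative (\<lambda>u. frechet_derivative f (at x) u + frechet_derivative g (at x) u)) (at x)" for x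
      by (intro has_derivative_add Ck_on_has_derivative[OF Suc.prems(1)] Ck_on_has_derivative[OF Suc.prems(2)])
  qed (use Suc in auto)
qed (auto intro: continuous_intros)

lemma Ck_on_mult:
  fixes f g :: "'a::euclidean_space \<Rightarrow> real"
  shows "Ck_on k UNIV f \<Longrightarrow> Ck_on k UNIV g \<Longrightarrow> Ck_on k UNIV (\<lambda>x. f x * g x)"
proof (induction k arbitrary: f g)
  case (Suc k)
  show ?case
  proof (rule Ck_on_Suc_derivative)
    show "((\<lambda>x. f x * g x) has_derivative (\<lambda>u. f x * frechet_derivative g (at x) u + frechet_derivative f (at x) u * g x)) (at x)" for x
      by (intro has_derivative_mult Ck_on_has_derivative[OF Suc.prems(1)] Ck_on_has_derivative[OF Suc.prems(2)])
    show "Ck_on k UNIV (\<lambda>x. f x * frechet_derivative g (at x) u + frechet_derivative f (at x) u * g x)" for u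
      using Suc.prems Ck_on_Suc_D[OF Suc.prems(1)] Ck_on_Suc_D[OF Suc.prems(2)]
      by (intro Ck_on_add Suc.IH) auto
  qed
qed (auto intro: continuous_intros)

lemma Ck_on_const: "Ck_on k UNIV (\<lambda>x. c)"
proof (induction k arbitrary: c)
  case (Suc k)
  show ?case by (rule Ck_on_Suc_derivative[of _ "\<lambda>_ _. 0"]) (auto intro: Suc)
qed simp

lemma Ck_on_prod:
  fixes f :: "'i \<Rightarrow> 'a::euclidean_space \<Rightarrow> real"
  shows "(\<And>i. i \<in> I \<Longrightarrow> Ck_on k UNIV (f i)) \<Longrightarrow> Ck_on k UNIV (\<lambda>x. \<Prod>i\<in>I. f i x)"
  by (induction I rule: infinite_finite_induct) (auto intro: Ck_on_const Ck_on_mult)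

text \<open>For \<open>n = 0\<close> this is the usual function that is flat at the origin. The
  powers are included because the family is then closed under differentiation up to linear
  combinations, which the induction on the order of smoothness needs.\<close>

definition flat_exp :: "nat \<Rightarrow> real \<Rightarrow> real" where
  "flat_exp n t = (if t > 0 then inverse t ^ n * exp (- inverse t) else 0)"

lemma flat_exp_tendsto_0: "(flat_exp n \<longlongrightarrow> 0) (at 0)"
proof -
  have "((\<lambda>t. inverse t ^ n / exp (inverse t)) \<longlongrightarrow> 0) (at_right (0::real))"
    by (rule filterlim_compose[OF tendsto_power_div_exp_0 filterlim_inverse_at_top_right])
  then have "(flat_exp n \<longlongrightarrow> 0) (at_right 0)"
    by (rule Lim_transform_eventually)
      (auto simp: flat_exp_def exp_minus divide_inverse eventually_at_right_less intro: eventually_mono[OF eventually_at_right_less])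
  moreover have "(flat_exp n \<longlongrightarrow> 0) (at_left 0)"
    by (rule tendsto_eventually) (auto simp: flat_exp_def eventually_at_left_field intro: exI[of _ "-1"])
  ultimately show ?thesis using filterlim_split_at by blast
qed

lemma flat_exp_deriv:
  "(flat_exp n has_real_derivative (- real n * flat_exp (Suc n) t + flat_exp (Suc (Suc n)) t)) (at t)"
proof -
  consider "t < 0" | "t > 0" | "t = 0" by linarith
  then show ?thesis
  proof cases
    case 1
    have "((\<lambda>_. 0) has_real_derivative 0) (at t)" by simp
    then have "(flat_exp n has_real_derivative 0) (at t)"
      by (rule has_field_derivative_transform_within_open[where S="{..<0}"]) (use 1 in \<open>auto simp: flat_exp_def\<close>)
    then show ?thesis using 1 by (simp add: flat_exp_def)
  next
    case 2
    have "((\<lambda>t. inverse t ^ n * exp (- inverse t)) has_real_derivative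
      (- real n * (inverse t ^ Suc n * exp (- inverse t)) + inverse t ^ Suc (Suc n) * exp (- inverse t))) (at t)"
    proof -
      have i: "((\<lambda>t. inverse t) has_real_derivative - (inverse t ^ 2)) (at t)"
        using 2 by (auto intro!: derivative_eq_intros simp: power2_eq_square)
      have e: "((\<lambda>t. exp (- inverse t)) has_real_derivative exp (- inverse t) * inverse t ^ 2) (at t)"
        using 2 by (auto intro!: derivative_eq_intros simp: power2_eq_square)
      \<comment> \<open>For \<open>n = 0\<close> the exponent \<open>n - Suc 0\<close> is truncated
        to 0, but the factor in front removes that term; hence the case split.\<close>
      have "of_nat n * (- (inverse t ^ 2) * inverse t ^ (n - Suc 0)) * exp (- inverse t) +
          exp (- inverse t) * inverse t ^ 2 * inverse t ^ n =
          - real n * (inverse t ^ Suc n * exp (- inverse t)) + inverse t ^ Suc (Suc n) * exp (- inverse t)"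
        by (cases n) (simp_all add: power2_eq_square algebra_simps)
      with DERIV_mult[OF DERIV_power[OF i, of n] e] show ?thesis by simp
    qed
    then have "(flat_exp n has_real_derivative
      (- real n * (inverse t ^ Suc n * exp (- inverse t)) + inverse t ^ Suc (Suc n) * exp (- inverse t))) (at t)"
      by (rule has_field_derivative_transform_within_open[where S="{0<..}"]) (use 2 in \<open>auto simp: flat_exp_def\<close>)
    then show ?thesis using 2 by (simp add: flat_exp_def)
  next
    case 3
    \<comment> \<open>At the origin the difference quotient is the next member of the family; for
      \<open>h \<le> 0\<close> both sides are 0.\<close>
    have "(\<lambda>h. flat_exp n h / h) = flat_exp (Suc n)"
      by (auto simp: flat_exp_def fun_eq_iff divide_inverse)
    then show ?thesis using 3 flat_exp_tendsto_0[of "Suc n"] by (simp add: DERIV_def flat_exp_def)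
  qed
qed

text \<open>The index \<open>n\<close> is generalised because each derivative raises it by one or
  two.\<close>

lemma Ck_on_flat_exp_affine:
  fixes a :: "'a::euclidean_space"
  shows "Ck_on k UNIV (\<lambda>x. flat_exp n (x \<bullet> a + d))"
proof (induction k arbitrary: n)
  case 0
  have "continuous_on UNIV (flat_exp n)"
    using flat_exp_deriv DERIV_isCont by (intro continuous_at_imp_continuous_on) blast
  then have "continuous_on UNIV (\<lambda>x. flat_exp n (x \<bullet> a + d))"
    by (rule continuous_on_compose2) (auto intro!: continuous_intros)
  then show ?case by simp
next
  case (Suc k)
  show ?case
  proof (rule Ck_on_Suc_derivative)
    fix x
    have "((\<lambda>x. x \<bullet> a + d) has_derivative (\<lambda>u. u \<bullet> a)) (at x)" by (auto intro!: derivative_eq_intros)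
    from has_derivative_compose[OF this flat_exp_deriv[unfolded has_field_derivative_def]]
    show "((\<lambda>x. flat_exp n (x \<bullet> a + d)) has_derivative
      (\<lambda>u. (- real n * flat_exp (Suc n) (x \<bullet> a + d) + flat_exp (Suc (Suc n)) (x \<bullet> a + d)) * (u \<bullet> a))) (at x)" .
  next
    show "Ck_on k UNIV (\<lambda>x. (- real n * flat_exp (Suc n) (x \<bullet> a + d) + flat_exp (Suc (Suc n)) (x \<bullet> a + d)) * (u \<bullet> a))" for u
      by (intro Ck_on_mult Ck_on_add Ck_on_const Suc)
  qed
qed

text \<open>Flat functions of the distances to the faces of the box, stretched by
  \<open>Suc m\<close> so that the product tends to the indicator of the open box. The arguments are
  written in the affine form of \<open>Ck_on_flat_exp_affine\<close>; \<open>box_test_eq\<close> is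
  the readable version.\<close>

definition box_test :: "nat \<Rightarrow> 'a::euclidean_space \<Rightarrow> 'a \<Rightarrow> 'a \<Rightarrow> real" where
  "box_test m a b x = (\<Prod>i\<in>Basis. flat_exp 0 (x \<bullet> (real (Suc m) *\<^sub>R i) + (- real (Suc m) * (a \<bullet> i))) *
     flat_exp 0 (x \<bullet> ((- real (Suc m)) *\<^sub>R i) + real (Suc m) * (b \<bullet> i)))"

lemma box_test_smooth: "smooth (box_test m a b)"
  unfolding smooth_def box_test_def[abs_def] by (intro allI Ck_on_prod Ck_on_mult Ck_on_flat_exp_affine)

lemma box_test_eq:
  "box_test m a b x = (\<Prod>i\<in>Basis. flat_exp 0 (real (Suc m) * (x \<bullet> i - a \<bullet> i)) * flat_exp 0 (real (Suc m) * (b \<bullet> i - x \<bullet> i)))"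
  by (simp add: box_test_def algebra_simps del: of_nat_Suc)

lemma flat_exp_0_pos: "t > 0 \<Longrightarrow> flat_exp 0 t = exp (- inverse t)"
  and flat_exp_0_neg: "t \<le> 0 \<Longrightarrow> flat_exp 0 t = 0"
  and flat_exp_0_bounds: "0 \<le> flat_exp 0 t" "flat_exp 0 t \<le> 1"
  by (auto simp: flat_exp_def)

lemma box_test_bounds: "0 \<le> box_test m a b x" "box_test m a b x \<le> 1"
proof -
  show "0 \<le> box_test m a b x" unfolding box_test_eq by (intro prod_nonneg mult_nonneg_nonneg flat_exp_0_bounds)
  show "box_test m a b x \<le> 1" unfolding box_test_eq
    by (intro prod_le_1 conjI mult_nonneg_nonneg mult_le_one flat_exp_0_bounds)
qed

lemma box_test_outside:
  assumes "x \<notin> box a b"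
  shows "box_test m a b x = 0"
proof -
  obtain i where i: "i \<in> Basis" "\<not> (a \<bullet> i < x \<bullet> i \<and> x \<bullet> i < b \<bullet> i)" using assms by (auto simp: mem_box)
  then have "real (Suc m) * (x \<bullet> i - a \<bullet> i) \<le> 0 \<or> real (Suc m) * (b \<bullet> i - x \<bullet> i) \<le> 0"
    by (auto simp: mult_nonneg_nonpos simp del: of_nat_Suc)
  then have "flat_exp 0 (real (Suc m) * (x \<bullet> i - a \<bullet> i)) * flat_exp 0 (real (Suc m) * (b \<bullet> i - x \<bullet> i)) = 0"
    using flat_exp_0_neg by auto
  then show ?thesis unfolding box_test_eq using i(1) by (intro prod_zero) auto
qed

lemma flat_exp_tendsto_1:
  assumes "t > 0"
  shows "(\<lambda>m. flat_exp 0 (real (Suc m) * t)) \<longlonglongrightarrow> 1"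
proof -
  have "(\<lambda>m. exp (- (inverse (real (Suc m)) * inverse t))) \<longlonglongrightarrow> exp (- (0 * inverse t))"
    by (intro tendsto_intros LIMSEQ_inverse_real_of_nat)
  moreover have "flat_exp 0 (real (Suc m) * t) = exp (- (inverse (real (Suc m)) * inverse t))" for m
    using assms by (subst flat_exp_0_pos) (auto simp del: of_nat_Suc)
  ultimately show ?thesis by simp
qed

lemma box_test_tendsto: "(\<lambda>m. box_test m a b x) \<longlonglongrightarrow> indicator (box a b) x"
proof (cases "x \<in> box a b")
  case True
  have "(\<lambda>m. box_test m a b x) \<longlonglongrightarrow> (\<Prod>i\<in>(Basis::'a set). 1 * 1)"
    unfolding box_test_eq using True by (intro tendsto_prod tendsto_mult flat_exp_tendsto_1) (auto simp: mem_box)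
  then show ?thesis using True by simp
qed (simp add: box_test_outside)

lemma box_test_support:
  "compact_supp (box_test m a b)" "closure {x. box_test m a b x \<noteq> 0} \<subseteq> cbox a b"
proof -
  have "{x. box_test m a b x \<noteq> 0} \<subseteq> cbox a b" using box_test_outside box_subset_cbox by blast
  then show s: "closure {x. box_test m a b x \<noteq> 0} \<subseteq> cbox a b" by (intro closure_minimal) auto
  show "compact_supp (box_test m a b)"
    unfolding compact_supp_def using s compact_cbox closed_Int_compact[of "closure {x. box_test m a b x \<noteq> 0}" "cbox a b"]
    by (simp add: inf.absorb1)
qed

text \<open>A Dynkin argument: boxes are an intersection stable generator of the Borel sets, and the
  sets over which \<open>h\<close> integrates to 0 form a Dynkin system. The integral over the whole
  space enters for complements.\<close>

lemma AE_zero_of_box_integrals: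
  fixes h :: "'a::euclidean_space \<Rightarrow> real"
  assumes h: "integrable lborel h" and z: "(\<integral>x. h x \<partial>lborel) = 0"
    and boxes: "\<And>a b. (\<integral>x. indicator (box a b) x * h x \<partial>lborel) = 0"
  shows "AE x in lborel. h x = 0"
proof (rule sigma_finite_measure.density_zero[OF sigma_finite_lborel h])
  fix A :: "'a set" assume "A \<in> sets lborel"
  then have A: "A \<in> sigma_sets UNIV (range (\<lambda>(a, b). box a b))"
    by (simp add: borel_eq_box)
  have sb: "sets (borel :: 'a measure) = sigma_sets UNIV (range (\<lambda>(a, b). box a b))"
    by (subst borel_eq_box) simp
  have st: "Int_stable (range (\<lambda>(a, b). box a b :: 'a set))"
  proof (rule Int_stableI)
    fix A B :: "'a set" assume "A \<in> range (\<lambda>(a, b). box a b)" "B \<in> range (\<lambda>(a, b). box a b)"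
    then obtain a b c d where "A = box a b" "B = box c d" by auto
    then have "A \<inter> B = (\<lambda>(a, b). box a b) (\<Sum>i\<in>Basis. max (a\<bullet>i) (c\<bullet>i) *\<^sub>R i, \<Sum>i\<in>Basis. min (b\<bullet>i) (d\<bullet>i) *\<^sub>R i)"
      by (simp add: box_Int_box)
    then show "A \<inter> B \<in> range (\<lambda>(a, b). box a b)" by blast
  qed
  have iA: "set_integrable lborel B h" if "B \<in> sets borel" for B
    unfolding set_integrable_def using h that by (intro integrable_mult_indicator) auto
  have sp: "range (\<lambda>(a, b). box a b :: 'a set) \<subseteq> Pow UNIV" by simp
  from st sp A show "set_lebesgue_integral lborel A h = 0"
  proof (induction A rule: sigma_sets_induct_disjoint)
    case (basic A)
    then show ?case using boxes by (auto simp: set_lebesgue_integral_def)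
  next
    case (compl A)
    then have A: "A \<in> sets borel" by (simp add: sb)
    have "set_lebesgue_integral lborel (A \<union> (UNIV - A)) h = set_lebesgue_integral lborel A h + set_lebesgue_integral lborel (UNIV - A) h"
      using A iA by (intro set_integral_Un) auto
    then show ?case using z compl by (simp add: set_lebesgue_integral_def)
  next
    case (union A)
    have A: "A i \<in> sets borel" for i using union(2) by (auto simp: sb)
    have "set_lebesgue_integral lborel (\<Union>i. A i) h = (\<Sum>i. set_lebesgue_integral lborel (A i) h)"
      using A union(1) iA by (intro lebesgue_integral_countable_add) (auto simp: disjoint_family_on_def)
    then show ?case using union by simp
  qed (auto simp: set_lebesgue_integral_def)
qed

section \<open>The fundamental lemma of the calculus of variations\<close>

lemma continuous_measurable_lebesgue_on:
  fixes f :: "real^'n \<Rightarrow> real"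
  assumes "continuous_on UNIV f"
  shows "f \<in> borel_measurable (lebesgue_on \<Omega>)"
  using borel_measurable_continuous_onI[OF assms] by (intro measurable_restrict_space1 measurable_completion) simp

lemma integrable_L2_mult:
  fixes f g :: "'a \<Rightarrow> real"
  assumes "f \<in> borel_measurable M" "g \<in> borel_measurable M" "integrable M (\<lambda>x. (f x)\<^sup>2)" "integrable M (\<lambda>x. (g x)\<^sup>2)"
  shows "integrable M (\<lambda>x. f x * g x)"
proof (rule Bochner_Integration.integrable_bound[where f="\<lambda>x. (f x)\<^sup>2 + (g x)\<^sup>2"])
  show "AE x in M. norm (f x * g x) \<le> norm ((f x)\<^sup>2 + (g x)\<^sup>2)"
  proof (intro AE_I2)
    fix x
    have "2 * (\<bar>f x\<bar> * \<bar>g x\<bar>) \<le> (f x)\<^sup>2 + (g x)\<^sup>2"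
      using sum_squares_bound[of "\<bar>f x\<bar>" "\<bar>g x\<bar>"] by (simp add: mult.assoc)
    moreover have "0 \<le> \<bar>f x\<bar> * \<bar>g x\<bar>" by simp
    ultimately have "\<bar>f x\<bar> * \<bar>g x\<bar> \<le> (f x)\<^sup>2 + (g x)\<^sup>2" by linarith
    then show "norm (f x * g x) \<le> norm ((f x)\<^sup>2 + (g x)\<^sup>2)" by (simp add: abs_mult)
  qed
qed (use assms in auto)

lemma integrable_lebesgue_on_supported:
  fixes f :: "real^'n \<Rightarrow> real"
  assumes "continuous_on UNIV f" "compact K" "\<And>x. f x \<noteq> 0 \<Longrightarrow> x \<in> K" "open \<Omega>"
  shows "integrable (lebesgue_on \<Omega>) f"
    and "integral\<^sup>L (lebesgue_on \<Omega>) f = (\<integral>x. indicator \<Omega> x * f x \<partial>lborel)"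
proof -
  have i: "integrable lborel (\<lambda>x. indicator \<Omega> x * f x)"
    by (rule integrable_indicator_supported[OF assms])
  then have m: "(\<lambda>x. indicator \<Omega> x * f x) \<in> borel_measurable lborel" by (rule borel_measurable_integrable)
  have s: "\<Omega> \<inter> space lebesgue \<in> sets lebesgue" using assms(4) by simp
  show "integrable (lebesgue_on \<Omega>) f"
    using i integrable_completion[OF m] by (simp add: integrable_restrict_space[OF s])
  show "integral\<^sup>L (lebesgue_on \<Omega>) f = (\<integral>x. indicator \<Omega> x * f x \<partial>lborel)"
    using integral_completion[OF m] by (simp add: integral_restrict_space[OF s])
qed

text \<open>Admissible test functions reach only boxes whose closure lies in \<Omega>, and
  \<open>f\<close> is merely Lebesgue measurable. So \<open>f\<close> is replaced by a Borel
  representative \<open>F\<close>, the box argument runs inside each closed box contained in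
  \<Omega>, and countably many such boxes exhaust \<Omega>.\<close>

lemma AE_zero_of_test_functions:
  fixes f :: "real^'n \<Rightarrow> real"
  assumes "open \<Omega>" and fm: "f \<in> borel_measurable (lebesgue_on \<Omega>)" and f2: "integrable (lebesgue_on \<Omega>) (\<lambda>x. (f x)\<^sup>2)"
    and test: "\<And>\<phi>. smooth \<phi> \<Longrightarrow> compact_supp \<phi> \<Longrightarrow> closure {x. \<phi> x \<noteq> 0} \<subseteq> \<Omega> \<Longrightarrow>
      integral\<^sup>L (lebesgue_on \<Omega>) (\<lambda>x. f x * \<phi> x) = 0"
  shows "AE x in lebesgue_on \<Omega>. f x = 0"
proof -
  have s: "\<Omega> \<inter> space lebesgue \<in> sets lebesgue" using assms(1) by simp
  have m1: "(\<lambda>x. indicator \<Omega> x * f x) \<in> borel_measurable lebesgue"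
    using fm by (simp add: borel_measurable_restrict_space_iff[OF s])
  have i1: "integrable lebesgue (\<lambda>x. indicator \<Omega> x * (f x)\<^sup>2)"
    using f2 by (simp add: integrable_restrict_space[OF s])
  obtain F where Fm: "F \<in> borel_measurable lborel" and FE: "AE x in lborel. indicator \<Omega> x * f x = F x"
    using completion_ex_borel_measurable_real[OF m1] by blast
  have FE': "AE x in lebesgue. indicator \<Omega> x * f x = F x" using FE by (rule AE_completion)
  have Fl: "F \<in> borel_measurable lebesgue" using Fm by (rule measurable_completion)
  have "integrable lebesgue (\<lambda>x. (F x)\<^sup>2)"
  proof (rule integrable_cong_AE_imp[OF i1])
    show "AE x in lebesgue. indicator \<Omega> x * (f x)\<^sup>2 = (F x)\<^sup>2"
      using FE' by eventually_elim (auto simp: indicator_def split: if_splits)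
  qed (use Fl in auto)
  then have F2: "integrable lborel (\<lambda>x. (F x)\<^sup>2)"
    using integrable_completion[of "\<lambda>x. (F x)\<^sup>2" lborel] Fm by auto
  \<comment> \<open>Square integrability gives integrability on bounded sets only, so
    \<open>F\<close> is truncated to closed boxes.\<close>
  have Floc: "integrable lborel (\<lambda>x. indicator (cbox p q) x * F x)" for p q
  proof -
    have i: "integrable lborel (indicator (cbox p q) :: real^'n \<Rightarrow> real)"
      by (intro integrable_real_indicator emeasure_compact_finite) auto
    have "(\<lambda>x. (indicator (cbox p q) x)\<^sup>2 :: real) = indicator (cbox p q)"
      by (auto simp: indicator_def)
    then show ?thesis using i Fm F2 by (intro integrable_L2_mult) auto
  qed
  have boxF: "(\<integral>x. indicator (box a b) x * F x \<partial>lborel) = 0" if ab: "cbox a b \<subseteq> \<Omega>" for a b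
  proof -
    have tb: "box_test m a b \<in> borel_measurable borel" for m
      using box_test_smooth[of m a b] unfolding smooth_def
      by (intro borel_measurable_continuous_onI) (metis Ck_on.simps(1))
    have "(\<lambda>m. \<integral>x. box_test m a b x * F x \<partial>lborel) \<longlonglongrightarrow> (\<integral>x. indicator (box a b) x * F x \<partial>lborel)"
    proof (rule integral_dominated_convergence[where w="\<lambda>x. \<bar>indicator (cbox a b) x * F x\<bar>"])
      show "AE x in lborel. (\<lambda>m. box_test m a b x * F x) \<longlonglongrightarrow> indicator (box a b) x * F x"
        by (intro AE_I2 tendsto_mult box_test_tendsto tendsto_const)
      show "AE x in lborel. norm (box_test m a b x * F x) \<le> \<bar>indicator (cbox a b) x * F x\<bar>" for m
      proof (intro AE_I2)
        fix x
        have "box_test m a b x \<le> indicator (cbox a b) x"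
          using box_test_outside[of x a b m] box_test_bounds[of m a b x] box_subset_cbox[of a b]
          by (auto simp: indicator_def)
        then show "norm (box_test m a b x * F x) \<le> \<bar>indicator (cbox a b) x * F x\<bar>"
          using box_test_bounds(1)[of m a b x] by (auto simp: abs_mult intro!: mult_right_mono)
      qed
    qed (use Floc Fm tb in auto)
    moreover have "(\<integral>x. box_test m a b x * F x \<partial>lborel) = 0" for m
    proof -
      have "0 = integral\<^sup>L (lebesgue_on \<Omega>) (\<lambda>x. f x * box_test m a b x)"
        using test[OF box_test_smooth box_test_support(1)] box_test_support(2)[of m a b] ab by force
      also have "\<dots> = (\<integral>x. indicator \<Omega> x * (f x * box_test m a b x) \<partial>lebesgue)"
        by (simp add: integral_restrict_space[OF s])
      also have "\<dots> = (\<integral>x. box_test m a b x * F x \<partial>lebesgue)"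
      proof (rule integral_cong_AE)
        have tl: "box_test m a b \<in> borel_measurable lebesgue" using tb by (intro measurable_completion) simp
        show "(\<lambda>x. box_test m a b x * F x) \<in> borel_measurable lebesgue" using Fl tl by auto
        have "(\<lambda>x. (indicator \<Omega> x * f x) * box_test m a b x) \<in> borel_measurable lebesgue" by (rule borel_measurable_times[OF m1 tl])
        then show "(\<lambda>x. indicator \<Omega> x * (f x * box_test m a b x)) \<in> borel_measurable lebesgue" by (simp add: mult.assoc)
        show "AE x in lebesgue. indicator \<Omega> x * (f x * box_test m a b x) = box_test m a b x * F x"
          using FE' by eventually_elim (simp add: mult_ac)
      qed
      also have "\<dots> = (\<integral>x. box_test m a b x * F x \<partial>lborel)"
        using Fm tb by (intro integral_completion) auto
      finally show ?thesis by simp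
    qed
    ultimately show ?thesis by (simp add: LIMSEQ_const_iff)
  qed
  \<comment> \<open>The faces of a box are null, so open and closed boxes may be exchanged under the
    integral.\<close>
  have cb: "AE x in lborel. x \<notin> cbox p q - box p q" for p q :: "real^'n"
  proof -
    have "cbox p q - box p q \<in> null_sets lborel"
      using negligible_frontier_interval[of p q] negligible_iff_null_sets null_sets_completion_iff
      by (metis borel_closed borel_open closed_cbox open_box sets.Diff sets_lborel)
    then show ?thesis by (rule AE_not_in)
  qed
  have loc: "AE x in lborel. x \<in> cbox p q \<longrightarrow> F x = 0" if pq: "cbox p q \<subseteq> \<Omega>" for p q
  proof -
    have im: "(\<integral>x. indicator B x * (indicator (cbox p q) x * F x) \<partial>lborel) = (\<integral>x. indicator (B \<inter> box p q) x * F x \<partial>lborel)"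
      if "B \<in> sets borel" for B
    proof (rule integral_cong_AE)
      show "AE x in lborel. indicator B x * (indicator (cbox p q) x * F x) = indicator (B \<inter> box p q) x * F x"
        using cb[of p q] by eventually_elim (use box_subset_cbox in \<open>auto simp: indicator_def\<close>)
    qed (use Fm that in auto)
    have "AE x in lborel. indicator (cbox p q) x * F x = 0"
    proof (rule AE_zero_of_box_integrals[OF Floc])
      show "(\<integral>x. indicator (cbox p q) x * F x \<partial>lborel) = 0"
        using im[of UNIV] boxF[OF pq] by simp
      fix a b :: "real^'n"
      obtain c d where cd: "box a b \<inter> box p q = box c d" using box_Int_box[of a b p q] by blast
      show "(\<integral>x. indicator (box a b) x * (indicator (cbox p q) x * F x) \<partial>lborel) = 0"
      \<comment> \<open>For an empty box nothing is known about \<open>cbox c d\<close>, since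
        \<open>closure_box\<close> needs a nonempty one; the integral is then trivially 0.\<close>
      proof (cases "box c d = {}")
        case True
        then show ?thesis using im[of "box a b"] cd by simp
      next
        case False
        have "closure (box c d) \<subseteq> closure (box p q)" using cd by (intro closure_mono) blast
        moreover have "closure (box p q) \<subseteq> cbox p q" by (intro closure_minimal box_subset_cbox closed_cbox)
        moreover have "closure (box c d) = cbox c d" using False by (rule closure_box)
        ultimately have "cbox c d \<subseteq> \<Omega>" using pq by blast
        then show ?thesis using im[of "box a b"] cd boxF by simp
      qed
    qed
    then show ?thesis by eventually_elim (auto simp: indicator_def)
  qed
  obtain \<D> where D: "countable \<D>" "\<D> \<subseteq> Pow \<Omega>" "\<And>X. X \<in> \<D> \<Longrightarrow> \<exists>a b. X = cbox a b" "\<Union>\<D> = \<Omega>"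
    by (rule open_countable_Union_open_cbox[OF assms(1)]) blast
  have "AE x in lborel. \<forall>X\<in>\<D>. x \<in> X \<longrightarrow> F x = 0"
    unfolding AE_ball_countable[OF D(1)]
  proof
    fix X assume X: "X \<in> \<D>"
    then obtain p q where "X = cbox p q" using D(3) by blast
    then show "AE x in lborel. x \<in> X \<longrightarrow> F x = 0" using loc[of p q] X D(2) by blast
  qed
  then have "AE x in lborel. x \<in> \<Omega> \<longrightarrow> f x = 0"
    using FE
  proof eventually_elim
    case (elim x)
    show ?case
    proof
      assume x: "x \<in> \<Omega>"
      then obtain X where "X \<in> \<D>" "x \<in> X" using D(4) by blast
      then have "F x = 0" using elim(1) by blast
      then show "f x = 0" using elim(2) x by simp
    qed
  qed
  then have "AE x in lebesgue. x \<in> \<Omega> \<longrightarrow> f x = 0" by (rule AE_completion)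
  then show ?thesis using s by (subst AE_restrict_space_iff) auto
qed

lemma L2_component:
  fixes G :: "real^'n \<Rightarrow> real^'n^'n"
  assumes "L2 \<Omega> G"
  shows "(\<lambda>x. G x $ i $ j) \<in> borel_measurable (lebesgue_on \<Omega>)"
    "integrable (lebesgue_on \<Omega>) (\<lambda>x. (G x $ i $ j)\<^sup>2)"
proof -
  have G: "G \<in> borel_measurable (lebesgue_on \<Omega>)" "integrable (lebesgue_on \<Omega>) (\<lambda>x. (norm (G x))\<^sup>2)"
    using assms by (auto simp: L2_def)
  have "continuous_on UNIV (\<lambda>A::real^'n^'n. A $ i $ j)" by (intro continuous_intros)
  from measurable_compose[OF G(1) borel_measurable_continuous_onI[OF this]]
  show m: "(\<lambda>x. G x $ i $ j) \<in> borel_measurable (lebesgue_on \<Omega>)" .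
  show "integrable (lebesgue_on \<Omega>) (\<lambda>x. (G x $ i $ j)\<^sup>2)"
  proof (rule Bochner_Integration.integrable_bound[OF G(2)])
    show "AE x in lebesgue_on \<Omega>. norm ((G x $ i $ j)\<^sup>2) \<le> norm ((norm (G x))\<^sup>2)"
    proof (intro AE_I2)
      fix x
      have "\<bar>G x $ i $ j\<bar> \<le> norm (G x)"
        using component_le_norm_cart[of "G x $ i" j] Finite_Cartesian_Product.norm_nth_le[of "G x" i] by linarith
      then show "norm ((G x $ i $ j)\<^sup>2) \<le> norm ((norm (G x))\<^sup>2)"
        by (simp add: abs_le_square_iff[symmetric])
    qed
  qed (use m in auto)
qed

text \<open>Connects the arbitrary weak gradient of the theorem with the L2 limit that comes with
  membership in \<open>H1_tn\<close>.\<close>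

lemma weak_grad_unique:
  fixes \<Omega> :: "(real^'n) set"
  assumes "open \<Omega>" and G: "weak_grad \<Omega> v G" "L2 \<Omega> G" and H: "weak_grad \<Omega> v H" "L2 \<Omega> H"
  shows "AE x in lebesgue_on \<Omega>. G x = H x"
proof -
  have "AE x in lebesgue_on \<Omega>. G x $ i $ j - H x $ i $ j = 0" for i j
  proof (rule AE_zero_of_test_functions[OF assms(1)])
    note g = L2_component[OF G(2), of i j] and h = L2_component[OF H(2), of i j]
    show "(\<lambda>x. G x $ i $ j - H x $ i $ j) \<in> borel_measurable (lebesgue_on \<Omega>)" using g h by auto
    have "integrable (lebesgue_on \<Omega>) (\<lambda>x. (G x $ i $ j)\<^sup>2 + (H x $ i $ j)\<^sup>2 - 2 * (G x $ i $ j * H x $ i $ j))"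
      using integrable_L2_mult[OF g(1) h(1) g(2) h(2)] g h by auto
    then show "integrable (lebesgue_on \<Omega>) (\<lambda>x. (G x $ i $ j - H x $ i $ j)\<^sup>2)"
      by (simp add: power2_diff mult.assoc)
    fix \<phi> :: "real^'n \<Rightarrow> real" assume \<phi>: "smooth \<phi>" "compact_supp \<phi>" "closure {x. \<phi> x \<noteq> 0} \<subseteq> \<Omega>"
    have c: "continuous_on UNIV \<phi>" using \<phi>(1) unfolding smooth_def by (metis Ck_on.simps(1))
    have p2: "integrable (lebesgue_on \<Omega>) (\<lambda>x. (\<phi> x)\<^sup>2)"
    proof (rule integrable_lebesgue_on_supported(1)[OF _ _ _ assms(1)])
      show "compact (closure {x. \<phi> x \<noteq> 0})" using \<phi>(2) by (simp add: compact_supp_def)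
      show "(\<phi> x)\<^sup>2 \<noteq> 0 \<Longrightarrow> x \<in> closure {x. \<phi> x \<noteq> 0}" for x
        using closure_subset[of "{x. \<phi> x \<noteq> 0}"] by auto
    qed (intro continuous_intros c)
    have pm: "\<phi> \<in> borel_measurable (lebesgue_on \<Omega>)" by (rule continuous_measurable_lebesgue_on[OF c])
    have w: "integral\<^sup>L (lebesgue_on \<Omega>) (\<lambda>x. v x $ j * pd i \<phi> x) = - integral\<^sup>L (lebesgue_on \<Omega>) (\<lambda>x. F x $ i $ j * \<phi> x)"
      if "weak_grad \<Omega> v F" for F
      using that \<phi> unfolding weak_grad_def by blast
    have "integral\<^sup>L (lebesgue_on \<Omega>) (\<lambda>x. G x $ i $ j * \<phi> x) = integral\<^sup>L (lebesgue_on \<Omega>) (\<lambda>x. H x $ i $ j * \<phi> x)"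
      using w[OF G(1)] w[OF H(1)] by linarith
    then show "integral\<^sup>L (lebesgue_on \<Omega>) (\<lambda>x. (G x $ i $ j - H x $ i $ j) * \<phi> x) = 0"
      using integrable_L2_mult[OF g(1) pm g(2) p2] integrable_L2_mult[OF h(1) pm h(2) p2]
      by (simp add: left_diff_distrib)
  qed
  then have "AE x in lebesgue_on \<Omega>. \<forall>i\<in>UNIV. \<forall>j\<in>UNIV. G x $ i $ j - H x $ i $ j = 0"
    by (intro AE_finite_allI) auto
  then show ?thesis by eventually_elim (simp add: vec_eq_iff)
qed

subsection \<open>Passage to the closure\<close>

text \<open>The polarisation of (tr A)^2 - tr (A A), that is, of twice the second elementary
  symmetric function of the eigenvalues. It is kept bilinear so that perturbations can be
  expanded.\<close>

definition Qform :: "real^'n^'n \<Rightarrow> real^'n^'n \<Rightarrow> real" where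
  "Qform A B = trace A * trace B - (\<Sum>i\<in>UNIV. \<Sum>j\<in>UNIV. A $ i $ j * B $ j $ i)"

lemma matrix_entry_le_norm: "\<bar>A $ i $ j\<bar> \<le> norm (A :: real^'n^'n)"
  using component_le_norm_cart[of "A $ i" j] Finite_Cartesian_Product.norm_nth_le[of A i] by linarith

text \<open>With N = \<open>CARD('n)\<close>, a factor N^2 comes from the product of the two traces
  and another from the N^2 products of entries. The constant is crude; only its independence of the
  matrices matters.\<close>

lemma Qform_bound:
  fixes A B :: "real^'n^'n"
  shows "\<bar>Qform A B\<bar> \<le> 2 * (real CARD('n))\<^sup>2 * (norm A * norm B)"
proof -
  have t: "\<bar>trace M\<bar> \<le> real CARD('n) * norm M" for M :: "real^'n^'n"
  proof -
    have "\<bar>trace M\<bar> \<le> (\<Sum>i\<in>(UNIV::'n set). norm M)" unfolding trace_def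
      by (rule order_trans[OF sum_abs sum_mono]) (rule matrix_entry_le_norm)
    then show ?thesis by simp
  qed
  have "\<bar>trace A * trace B\<bar> \<le> (real CARD('n) * norm A) * (real CARD('n) * norm B)"
    unfolding abs_mult using t by (intro mult_mono) auto
  moreover have "\<bar>\<Sum>i\<in>UNIV. \<Sum>j\<in>UNIV. A $ i $ j * B $ j $ i\<bar> \<le> (\<Sum>i\<in>(UNIV::'n set). \<Sum>j\<in>(UNIV::'n set). norm A * norm B)"
    by (rule order_trans[OF sum_abs sum_mono], rule order_trans[OF sum_abs sum_mono])
      (simp only: abs_mult, intro mult_mono matrix_entry_le_norm, auto)
  ultimately show ?thesis by (simp add: Qform_def power2_eq_square algebra_simps)
qed

lemma Qform_expand: "Qform (A + D) (A + D) = Qform A A + Qform A D + Qform D A + Qform D D"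
  by (simp add: Qform_def trace_def sum.distrib algebra_simps)

text \<open>Young's inequality with a free parameter \<open>s\<close> stands in for the
  Cauchy-Schwarz inequality in L2: the cross terms split into a small multiple of the squared norm
  of \<open>B\<close> and a large multiple of the squared error.\<close>

lemma Qform_perturb:
  fixes A B :: "real^'n^'n"
  assumes "s > 0"
  shows "\<bar>Qform A A - Qform B B\<bar> \<le> 2 * (real CARD('n))\<^sup>2 * (s * (norm B)\<^sup>2 + (1 / s + 1) * (norm (A - B))\<^sup>2)"
proof -
  let ?C = "2 * (real CARD('n))\<^sup>2"
  let ?b = "norm B" and ?d = "norm (A - B)"
  have "Qform A A - Qform B B = Qform B (A - B) + Qform (A - B) B + Qform (A - B) (A - B)"
    using Qform_expand[of B "A - B"] by simp
  then have "\<bar>Qform A A - Qform B B\<bar> \<le> \<bar>Qform B (A - B)\<bar> + \<bar>Qform (A - B) B\<bar> + \<bar>Qform (A - B) (A - B)\<bar>"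
    by linarith
  also have "\<dots> \<le> ?C * (?b * ?d) + ?C * (?d * ?b) + ?C * (?d * ?d)"
    by (intro add_mono Qform_bound)
  also have "\<dots> = ?C * (2 * ?b * ?d + ?d\<^sup>2)" by (simp add: power2_eq_square algebra_simps)
  also have "\<dots> \<le> ?C * (s * ?b\<^sup>2 + (1 / s + 1) * ?d\<^sup>2)"
  proof (rule mult_left_mono)
    have "0 \<le> (s * ?b - ?d)\<^sup>2 / s" using assms by simp
    also have "(s * ?b - ?d)\<^sup>2 / s = s * ?b\<^sup>2 - 2 * ?b * ?d + ?d\<^sup>2 / s"
      using assms by (simp add: power2_eq_square field_simps)
    finally show "2 * ?b * ?d + ?d\<^sup>2 \<le> s * ?b\<^sup>2 + (1 / s + 1) * ?d\<^sup>2" by (simp add: algebra_simps)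
  qed simp
  finally show ?thesis .
qed

lemma sum_Basis_vec: "(\<Sum>b\<in>(Basis::(real^'n) set). f b) = (\<Sum>i\<in>UNIV. f (axis i 1))"
proof -
  have "(Basis::(real^'n) set) = range (\<lambda>i. axis i 1)" by (auto simp: Basis_vec_def)
  moreover have "inj (\<lambda>i::'n. axis i (1::real) :: real^'n)" by (auto simp: inj_on_def axis_eq_axis)
  ultimately show ?thesis using sum.reindex[of "\<lambda>i::'n. axis i (1::real) :: real^'n" UNIV f] by (simp add: o_def)
qed

text \<open>Joins the two halves of the proof: the integrand of \<open>smooth_flux_nonpos\<close> is
  \<open>Qform\<close> of the gradient matrix.\<close>

lemma Qform_grad_mat:
  fixes v :: "real^'n \<Rightarrow> real^'n"
  defines "A \<equiv> \<lambda>x. frechet_derivative v (at x)"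
  shows "Qform (grad_mat v x) (grad_mat v x) = (divergence (A x))\<^sup>2 - sq_trace (A x)"
  by (simp add: Qform_def trace_def divergence_def sq_trace_def sum_Basis_vec grad_mat_def pd_def A_def
      power2_eq_square inner_axis)

lemma continuous_matrix:
  fixes F :: "real^'n \<Rightarrow> real^'n^'n"
  assumes "\<And>i j. continuous_on UNIV (\<lambda>x. F x $ i $ j)"
  shows "continuous_on UNIV F"
proof -
  have "continuous_on UNIV (\<lambda>x. \<chi> i j. F x $ i $ j)" using assms by (intro continuous_on_vec_lambda)
  then show ?thesis by simp
qed

lemma continuous_Qform:
  "continuous_on UNIV (\<lambda>A. Qform A A)"
  unfolding Qform_def trace_def by (intro continuous_intros)

lemma L2_Qform_integrable:
  fixes G :: "real^'n \<Rightarrow> real^'n^'n"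
  assumes "L2 \<Omega> G"
  shows "integrable (lebesgue_on \<Omega>) (\<lambda>x. Qform (G x) (G x))"
proof -
  have G: "G \<in> borel_measurable (lebesgue_on \<Omega>)" "integrable (lebesgue_on \<Omega>) (\<lambda>x. (norm (G x))\<^sup>2)"
    using assms by (auto simp: L2_def)
  show ?thesis
  proof (rule Bochner_Integration.integrable_bound)
    show "integrable (lebesgue_on \<Omega>) (\<lambda>x. 2 * (real CARD('n))\<^sup>2 * (norm (G x))\<^sup>2)" using G(2) by simp
    show "(\<lambda>x. Qform (G x) (G x)) \<in> borel_measurable (lebesgue_on \<Omega>)"
      by (rule measurable_compose[OF G(1) borel_measurable_continuous_onI[OF continuous_Qform]])
    show "AE x in lebesgue_on \<Omega>. norm (Qform (G x) (G x)) \<le> norm (2 * (real CARD('n))\<^sup>2 * (norm (G x))\<^sup>2)"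
    proof (intro AE_I2)
      fix x show "norm (Qform (G x) (G x)) \<le> norm (2 * (real CARD('n))\<^sup>2 * (norm (G x))\<^sup>2)"
        using Qform_bound[of "G x" "G x"] by (simp add: power2_eq_square)
    qed
  qed
qed

lemma L2_diff:
  fixes F G :: "real^'n \<Rightarrow> 'b::euclidean_space"
  assumes "L2 \<Omega> F" "L2 \<Omega> G"
  shows "L2 \<Omega> (\<lambda>x. F x - G x)"
  unfolding L2_def
proof
  have F: "F \<in> borel_measurable (lebesgue_on \<Omega>)" "integrable (lebesgue_on \<Omega>) (\<lambda>x. (norm (F x))\<^sup>2)"
    and G: "G \<in> borel_measurable (lebesgue_on \<Omega>)" "integrable (lebesgue_on \<Omega>) (\<lambda>x. (norm (G x))\<^sup>2)"
    using assms by (auto simp: L2_def)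
  show m: "(\<lambda>x. F x - G x) \<in> borel_measurable (lebesgue_on \<Omega>)" using F(1) G(1) by (rule borel_measurable_diff)
  show "integrable (lebesgue_on \<Omega>) (\<lambda>x. (norm (F x - G x))\<^sup>2)"
  proof (rule Bochner_Integration.integrable_bound)
    show "integrable (lebesgue_on \<Omega>) (\<lambda>x. 2 * (norm (F x))\<^sup>2 + 2 * (norm (G x))\<^sup>2)" using F(2) G(2) by auto
    show "(\<lambda>x. (norm (F x - G x))\<^sup>2) \<in> borel_measurable (lebesgue_on \<Omega>)" using m by auto
    show "AE x in lebesgue_on \<Omega>. norm ((norm (F x - G x))\<^sup>2) \<le> norm (2 * (norm (F x))\<^sup>2 + 2 * (norm (G x))\<^sup>2)"
    proof (intro AE_I2)
      fix x
      have "(norm (F x - G x))\<^sup>2 \<le> (norm (F x) + norm (G x))\<^sup>2"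
        by (intro power_mono norm_triangle_ineq4) simp
      also have "\<dots> \<le> 2 * (norm (F x))\<^sup>2 + 2 * (norm (G x))\<^sup>2"
        using sum_squares_bound[of "norm (F x)" "norm (G x)"] by (simp add: power2_sum)
      finally show "norm ((norm (F x - G x))\<^sup>2) \<le> norm (2 * (norm (F x))\<^sup>2 + 2 * (norm (G x))\<^sup>2)" by simp
    qed
  qed
qed

lemma smooth_grad_mat:
  fixes v :: "real^'n \<Rightarrow> real^'n"
  assumes "smooth v" "compact_supp v" "open \<Omega>"
  shows "L2 \<Omega> (grad_mat v)"
    and "integral\<^sup>L (lebesgue_on \<Omega>) (\<lambda>x. Qform (grad_mat v x) (grad_mat v x)) =
      (\<integral>x. indicator \<Omega> x * Qform (grad_mat v x) (grad_mat v x) \<partial>lborel)"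
proof -
  let ?K = "closure {x. v x \<noteq> 0}"
  have K: "compact ?K" using assms(2) by (simp add: compact_supp_def)
  have V: "C1_on UNIV v (\<lambda>x. frechet_derivative v (at x))"
    by (rule Ck_on_imp_C1_on[of 0]) (use assms(1) in \<open>simp only: smooth_def\<close>)
  have cont: "continuous_on UNIV (grad_mat v)"
    by (rule continuous_matrix)
      (auto simp: grad_mat_def pd_def intro!: continuous_intros C1_on_continuous_derivative[OF V])
  have vK: "v x \<noteq> 0 \<Longrightarrow> x \<in> ?K" for x using closure_subset[of "{x. v x \<noteq> 0}"] by auto
  have z: "x \<notin> ?K \<Longrightarrow> grad_mat v x = 0" for x
    using C1_derivative_zero_outside[OF V closed_closure vK, of x] by (simp add: grad_mat_def pd_def vec_eq_iff)
  show "L2 \<Omega> (grad_mat v)"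
    unfolding L2_def
  proof
    show "grad_mat v \<in> borel_measurable (lebesgue_on \<Omega>)"
      using borel_measurable_continuous_onI[OF cont] by (intro measurable_restrict_space1 measurable_completion) simp
    show "integrable (lebesgue_on \<Omega>) (\<lambda>x. (norm (grad_mat v x))\<^sup>2)"
      by (rule integrable_lebesgue_on_supported(1)[OF _ K _ assms(3)]) (use z in \<open>auto intro!: continuous_intros cont\<close>)
  qed
  show "integral\<^sup>L (lebesgue_on \<Omega>) (\<lambda>x. Qform (grad_mat v x) (grad_mat v x)) =
      (\<integral>x. indicator \<Omega> x * Qform (grad_mat v x) (grad_mat v x) \<partial>lborel)"
  proof (rule integrable_lebesgue_on_supported(2)[OF _ K _ assms(3)])
    show "continuous_on UNIV (\<lambda>x. Qform (grad_mat v x) (grad_mat v x))"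
      by (rule continuous_on_compose2[OF continuous_Qform cont]) simp
    show "Qform (grad_mat v x) (grad_mat v x) \<noteq> 0 \<Longrightarrow> x \<in> ?K" for x
      using z[of x] by (cases "x \<in> ?K") (simp_all add: Qform_def trace_def)
  qed
qed

text \<open>The sign is known for the smooth approximants, and \<open>Qform_perturb\<close> carries
  it over: k tends to infinity at fixed \<open>s\<close>, and \<open>s\<close> tends to 0
  afterwards. The condition on \<open>\<bar>\<sigma>\<bar>\<close> lets \<sigma> drop out of the
  perturbation estimate.\<close>

lemma H1_Qform_nonpos:
  fixes \<Omega> :: "(real^'n) set"
  assumes P: "pw_C2 \<Omega> \<Gamma>1 \<nu>" and N: "CARD('n) \<ge> 2"
    and \<Gamma>t: "openin (top_of_set (frontier \<Omega>)) \<Gamma>t" and v: "v \<in> H1_tn \<Omega> \<Gamma>1 \<nu> \<Gamma>t"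
    and G: "weak_grad \<Omega> v G" "L2 \<Omega> G"
    and II: "\<And>x \<tau>. x \<in> \<Gamma>1 \<Longrightarrow> \<tau> \<bullet> \<nu> x = 0 \<Longrightarrow> \<sigma> * (frechet_derivative \<nu> (at x) \<tau> \<bullet> \<tau>) \<le> 0"
    and \<sigma>: "\<bar>\<sigma>\<bar> = 1"
  shows "\<sigma> * integral\<^sup>L (lebesgue_on \<Omega>) (\<lambda>x. Qform (G x) (G x)) \<le> 0"
proof -
  have op: "open \<Omega>" using P by (simp add: pw_C2_def)
  let ?M = "lebesgue_on \<Omega>"
  obtain H \<phi> where H: "weak_grad \<Omega> v H" "L2 \<Omega> H" and \<phi>: "\<And>k. \<phi> k \<in> Cinf_tn \<Omega> \<Gamma>1 \<nu> \<Gamma>t"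
    and lim: "(\<lambda>k. sqnorm \<Omega> (\<lambda>x. grad_mat (\<phi> k) x - H x)) \<longlonglongrightarrow> 0"
    using v unfolding H1_tn_def by blast
  have GH: "AE x in ?M. G x = H x" by (rule weak_grad_unique[OF op G H])
  define C where "C = 2 * (real CARD('n))\<^sup>2"
  have C: "C \<ge> 0" by (simp add: C_def)
  have sm: "smooth (\<phi> k)" "compact_supp (\<phi> k)" for k using \<phi>[of k] by (auto simp: Cinf_tn_def)
  have gL: "L2 \<Omega> (grad_mat (\<phi> k))" for k by (rule smooth_grad_mat(1)[OF sm op])
  have neg: "\<sigma> * integral\<^sup>L ?M (\<lambda>x. Qform (grad_mat (\<phi> k) x) (grad_mat (\<phi> k) x)) \<le> 0" for k
  proof -
    have "\<sigma> * (\<integral>x. indicator \<Omega> x * ((divergence (frechet_derivative (\<phi> k) (at x)))\<^sup>2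
        - sq_trace (frechet_derivative (\<phi> k) (at x))) \<partial>lborel) \<le> 0"
      by (rule smooth_flux_nonpos[OF P N \<Gamma>t \<phi>]) (rule II)
    then show ?thesis unfolding smooth_grad_mat(2)[OF sm op] by (simp only: Qform_grad_mat)
  qed
  define I where "I = integral\<^sup>L ?M (\<lambda>x. Qform (H x) (H x))"
  have IG: "integral\<^sup>L ?M (\<lambda>x. Qform (G x) (G x)) = I"
    unfolding I_def
    using borel_measurable_integrable[OF L2_Qform_integrable[OF G(2)]] borel_measurable_integrable[OF L2_Qform_integrable[OF H(2)]] GH
    by (intro integral_cong_AE) (auto elim: eventually_mono)
  have bound: "\<sigma> * I \<le> C * (s * sqnorm \<Omega> H)" if s: "s > 0" for s
  proof -
    have "\<sigma> * I \<le> C * (s * sqnorm \<Omega> H + (1 / s + 1) * sqnorm \<Omega> (\<lambda>x. grad_mat (\<phi> k) x - H x))" for k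
    proof -
      let ?A = "grad_mat (\<phi> k)"
      have i1: "integrable ?M (\<lambda>x. Qform (H x) (H x))" by (rule L2_Qform_integrable[OF H(2)])
      have i2: "integrable ?M (\<lambda>x. Qform (?A x) (?A x))" by (rule L2_Qform_integrable[OF gL])
      have i3: "integrable ?M (\<lambda>x. (norm (H x))\<^sup>2)" using H(2) by (simp add: L2_def)
      have i4: "integrable ?M (\<lambda>x. (norm (?A x - H x))\<^sup>2)" using L2_diff[OF gL H(2)] by (simp add: L2_def)
      have "\<sigma> * I - \<sigma> * integral\<^sup>L ?M (\<lambda>x. Qform (?A x) (?A x)) = integral\<^sup>L ?M (\<lambda>x. \<sigma> * Qform (H x) (H x) - \<sigma> * Qform (?A x) (?A x))"
        unfolding I_def using i1 i2 by simp
      also have "\<dots> \<le> integral\<^sup>L ?M (\<lambda>x. C * (s * (norm (H x))\<^sup>2 + (1 / s + 1) * (norm (?A x - H x))\<^sup>2))"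
      proof (rule integral_mono)
        fix x
        have "\<sigma> * Qform (H x) (H x) - \<sigma> * Qform (?A x) (?A x) \<le> \<bar>\<sigma> * (Qform (?A x) (?A x) - Qform (H x) (H x))\<bar>"
          by (simp add: right_diff_distrib)
        also have "\<dots> = \<bar>Qform (?A x) (?A x) - Qform (H x) (H x)\<bar>" using \<sigma> by (simp add: abs_mult)
        also have "\<dots> \<le> C * (s * (norm (H x))\<^sup>2 + (1 / s + 1) * (norm (?A x - H x))\<^sup>2)"
          unfolding C_def by (rule Qform_perturb[OF s])
        finally show "\<sigma> * Qform (H x) (H x) - \<sigma> * Qform (?A x) (?A x) \<le>
            C * (s * (norm (H x))\<^sup>2 + (1 / s + 1) * (norm (?A x - H x))\<^sup>2)" .
      qed (use i1 i2 i3 i4 in auto)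
      also have "\<dots> = C * (s * sqnorm \<Omega> H + (1 / s + 1) * sqnorm \<Omega> (\<lambda>x. ?A x - H x))"
        using i3 i4 by (simp add: sqnorm_def)
      finally show ?thesis using neg[of k] by linarith
    qed
    moreover have "(\<lambda>k. C * (s * sqnorm \<Omega> H + (1 / s + 1) * sqnorm \<Omega> (\<lambda>x. grad_mat (\<phi> k) x - H x)))
       \<longlonglongrightarrow> C * (s * sqnorm \<Omega> H + (1 / s + 1) * 0)"
      by (intro tendsto_intros lim)
    ultimately have "\<sigma> * I \<le> C * (s * sqnorm \<Omega> H + (1 / s + 1) * 0)"
      by (intro LIMSEQ_le_const) auto
    then show ?thesis by simp
  qed
  have "\<sigma> * I \<le> 0"
  proof (rule field_le_epsilon)
    fix \<epsilon> :: real assume \<epsilon>: "\<epsilon> > 0"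
    define T where "T = C * sqnorm \<Omega> H"
    have T: "T \<ge> 0" unfolding T_def sqnorm_def using C by (intro mult_nonneg_nonneg integral_nonneg_AE) auto
    have "\<sigma> * I \<le> \<epsilon> / (T + 1) * T" using bound[of "\<epsilon> / (T + 1)"] T \<epsilon> by (simp add: T_def mult_ac)
    also have "\<dots> \<le> \<epsilon>" using T \<epsilon> by (simp add: field_simps)
    finally show "\<sigma> * I \<le> 0 + \<epsilon>" by simp
  qed
  then show ?thesis by (simp add: IG)
qed

subsection \<open>Algebra of the decomposition\<close>

lemma norm_matrix_square: "(norm A)\<^sup>2 = (\<Sum>i\<in>UNIV. \<Sum>j\<in>UNIV. (A $ i $ j)\<^sup>2)" for A :: "real^'n^'n"
  unfolding power2_norm_eq_inner inner_vec_def by (simp add: power2_eq_square)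

lemma norm_symm_square:
  fixes A :: "real^'n^'n"
  shows "2 * (norm (symm A))\<^sup>2 = (norm A)\<^sup>2 + (\<Sum>i\<in>UNIV. \<Sum>j\<in>UNIV. A $ i $ j * A $ j $ i)"
proof -
  have "(norm (symm A))\<^sup>2 = (\<Sum>i\<in>UNIV. \<Sum>j\<in>UNIV. (1/4) * (A $ i $ j)\<^sup>2 + (1/4) * (A $ j $ i)\<^sup>2 + (1/2) * (A $ i $ j * A $ j $ i))"
    unfolding norm_matrix_square by (intro sum.cong refl) (simp add: symm_def transpose_def power2_eq_square field_simps)
  also have "\<dots> = (1/4) * (\<Sum>i\<in>UNIV. \<Sum>j\<in>UNIV. (A $ i $ j)\<^sup>2) + (1/4) * (\<Sum>i\<in>UNIV. \<Sum>j\<in>UNIV. (A $ j $ i)\<^sup>2)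
      + (1/2) * (\<Sum>i\<in>UNIV. \<Sum>j\<in>UNIV. A $ i $ j * A $ j $ i)"
    by (simp only: sum.distrib sum_distrib_left)
  also have "(\<Sum>i\<in>UNIV. \<Sum>j\<in>UNIV. (A $ j $ i)\<^sup>2) = (\<Sum>i\<in>UNIV. \<Sum>j\<in>UNIV. (A $ i $ j)\<^sup>2)" by (rule sum.swap)
  finally show ?thesis by (simp add: norm_matrix_square)
qed

lemma trace_symm: "trace (symm A) = trace A"
  by (simp add: trace_def symm_def transpose_def)

text \<open>Pythagoras: \<open>dev A\<close> is orthogonal to the identity matrix, whose squared
  norm is N.\<close>

lemma norm_dev_square:
  fixes A :: "real^'n^'n"
  shows "(norm (dev A))\<^sup>2 = (norm A)\<^sup>2 - (trace A)\<^sup>2 / real CARD('n)"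
proof -
  let ?c = "trace A / real CARD('n)"
  have "(norm (dev A))\<^sup>2 = (\<Sum>i\<in>UNIV. \<Sum>j\<in>UNIV. (A $ i $ j)\<^sup>2 + (if i = j then ?c\<^sup>2 - 2 * ?c * A $ i $ j else 0))"
    unfolding norm_matrix_square by (intro sum.cong refl) (simp add: dev_def mat_def power2_diff)
  also have "\<dots> = (norm A)\<^sup>2 + (\<Sum>i\<in>UNIV. ?c\<^sup>2 - 2 * ?c * A $ i $ i)"
    by (simp add: sum.distrib norm_matrix_square)
  also have "(\<Sum>i\<in>UNIV. ?c\<^sup>2 - 2 * ?c * A $ i $ i) = real CARD('n) * ?c\<^sup>2 - 2 * ?c * trace A"
    by (simp add: sum_subtractf trace_def sum_distrib_left)
  also have "\<dots> = - (trace A)\<^sup>2 / real CARD('n)" by (simp add: power2_eq_square field_simps)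
  finally show ?thesis by simp
qed

text \<open>The symmetric part satisfies 2 |sym A|^2 = |A|^2 + tr (A A), and \<open>dev\<close>
  removes (tr A)^2 / N from |sym A|^2. The coefficient (2 - N)/N is 2/N - 1, where the -1
  compensates the (tr A)^2 inside \<open>Qform\<close>.\<close>

lemma norm_square_decomposition:
  fixes A :: "real^'n^'n"
  shows "(norm A)\<^sup>2 = 2 * (norm (dev (symm A)))\<^sup>2 + (2 - real CARD('n)) / real CARD('n) * (trace A)\<^sup>2 + Qform A A"
proof -
  have "2 * (norm (dev (symm A)))\<^sup>2 = 2 * (norm (symm A))\<^sup>2 - 2 * ((trace A)\<^sup>2 / real CARD('n))"
    by (simp add: norm_dev_square trace_symm)
  moreover have "(2 - real CARD('n)) / real CARD('n) * (trace A)\<^sup>2 = 2 * ((trace A)\<^sup>2 / real CARD('n)) - (trace A)\<^sup>2"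
    by (simp add: field_simps)
  ultimately show ?thesis using norm_symm_square[of A] by (simp add: Qform_def power2_eq_square)
qed

lemma norm_symm_le: "norm (symm A) \<le> norm A" for A :: "real^'n^'n"
proof -
  have "(norm (transpose A))\<^sup>2 = (\<Sum>i\<in>UNIV. \<Sum>j\<in>UNIV. (A $ j $ i)\<^sup>2)"
    by (simp add: norm_matrix_square transpose_def)
  also have "\<dots> = (norm A)\<^sup>2" unfolding norm_matrix_square by (rule sum.swap)
  finally have "norm (transpose A) = norm A" by simp
  then show ?thesis
    using norm_triangle_ineq[of A "transpose A"] by (simp add: symm_def)
qed

lemma norm_dev_le: "norm (dev A) \<le> norm A" for A :: "real^'n^'n"
  by (rule power2_le_imp_le) (simp_all add: norm_dev_square)

text \<open>The Cauchy-Schwarz inequality against the identity, read off from the nonnegativity of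
  |dev A|^2.\<close>

lemma trace_square_le: "(trace A)\<^sup>2 \<le> real CARD('n) * (norm A)\<^sup>2" for A :: "real^'n^'n"
proof -
  have "0 \<le> (norm A)\<^sup>2 - (trace A)\<^sup>2 / real CARD('n)" using norm_dev_square[of A] by (metis zero_le_power2)
  then show ?thesis by (simp add: field_simps)
qed

lemma L2_continuous_image_integrable:
  fixes q :: "real^'n^'n \<Rightarrow> real"
  assumes "L2 \<Omega> G" "continuous_on UNIV q" "\<And>A. \<bar>q A\<bar> \<le> K * (norm A)\<^sup>2"
  shows "integrable (lebesgue_on \<Omega>) (\<lambda>x. q (G x))"
proof -
  have G: "G \<in> borel_measurable (lebesgue_on \<Omega>)" "integrable (lebesgue_on \<Omega>) (\<lambda>x. (norm (G x))\<^sup>2)"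
    using assms by (auto simp: L2_def)
  show ?thesis
  proof (rule Bochner_Integration.integrable_bound)
    show "integrable (lebesgue_on \<Omega>) (\<lambda>x. K * (norm (G x))\<^sup>2)" using G(2) by simp
    show "(\<lambda>x. q (G x)) \<in> borel_measurable (lebesgue_on \<Omega>)"
      by (rule measurable_compose[OF G(1) borel_measurable_continuous_onI[OF assms(2)]])
    show "AE x in lebesgue_on \<Omega>. norm (q (G x)) \<le> norm (K * (norm (G x))\<^sup>2)"
      by (intro AE_I2) (simp only: real_norm_def order_trans[OF assms(3) abs_ge_self])
  qed
qed

theorem mainTheorem1:
  fixes \<Omega> \<Gamma>1 \<Gamma>t :: "(real^'n) set" and \<nu> v :: "real^'n \<Rightarrow> real^'n"
    and G :: "real^'n \<Rightarrow> real^'n^'n"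
  assumes "CARD('n) \<ge> 2"
    and "pw_C2_concave \<Omega> \<Gamma>1 \<nu>"
    and "openin (top_of_set (frontier \<Omega>)) \<Gamma>t"
    and "v \<in> H1_tn \<Omega> \<Gamma>1 \<nu> \<Gamma>t"
    and "weak_grad \<Omega> v G" and "L2 \<Omega> G"
  shows "sqrt (sqnorm \<Omega> G) \<le> sqrt 2 * sqrt (sqnorm \<Omega> (\<lambda>x. dev (symm (G x))))
       \<and> (polyhedral_domain \<Omega> \<Gamma>1 \<nu> \<longrightarrow>
           sqnorm \<Omega> G = 2 * sqnorm \<Omega> (\<lambda>x. dev (symm (G x)))
              + (2 - real CARD('n)) / real CARD('n) * sqnorm \<Omega> (\<lambda>x. trace (G x))
         \<and> sqnorm \<Omega> G \<le> 2 * sqnorm \<Omega> (\<lambda>x. dev (symm (G x)))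
         \<and> (sqnorm \<Omega> G = 2 * sqnorm \<Omega> (\<lambda>x. dev (symm (G x)))
              \<longleftrightarrow> (sqnorm \<Omega> (\<lambda>x. trace (G x)) = 0 \<or> CARD('n) = 2)))
       \<and> sqrt (sqnorm \<Omega> G) \<le> sqrt 2 * sqrt (sqnorm \<Omega> (\<lambda>x. symm (G x)))"
proof -
  let ?M = "lebesgue_on \<Omega>" and ?N = "real CARD('n)"
  have P: "pw_C2 \<Omega> \<Gamma>1 \<nu>" using assms(2) by (simp add: pw_C2_concave_def)
  define IG where "IG = sqnorm \<Omega> G"
  define ID where "ID = sqnorm \<Omega> (\<lambda>x. dev (symm (G x)))"
  define IS where "IS = sqnorm \<Omega> (\<lambda>x. symm (G x))"
  define IT where "IT = sqnorm \<Omega> (\<lambda>x. trace (G x))"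
  define IQ where "IQ = integral\<^sup>L ?M (\<lambda>x. Qform (G x) (G x))"
  have csymm: "continuous_on UNIV (symm :: real^'n^'n \<Rightarrow> _)"
    unfolding symm_def transpose_def by (intro continuous_intros continuous_on_vec_lambda)
  have ctrace: "continuous_on UNIV (trace :: real^'n^'n \<Rightarrow> real)"
    unfolding trace_def by (intro continuous_intros)
  have cdev: "continuous_on UNIV (\<lambda>A::real^'n^'n. dev (symm A))"
    unfolding dev_def by (intro continuous_intros csymm continuous_on_compose2[OF ctrace csymm]) auto
  have iS: "integrable ?M (\<lambda>x. (norm (symm (G x)))\<^sup>2)"
    by (rule L2_continuous_image_integrable[OF assms(6), where K=1]) (auto intro!: continuous_intros csymm norm_symm_le)
  have iD: "integrable ?M (\<lambda>x. (norm (dev (symm (G x))))\<^sup>2)"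
    by (rule L2_continuous_image_integrable[OF assms(6), where K=1])
      (auto intro!: continuous_intros cdev order_trans[OF norm_dev_le norm_symm_le])
  have iT: "integrable ?M (\<lambda>x. (trace (G x))\<^sup>2)"
    by (rule L2_continuous_image_integrable[OF assms(6), where K="?N"]) (auto intro!: continuous_intros ctrace trace_square_le)
  have iQ: "integrable ?M (\<lambda>x. Qform (G x) (G x))" by (rule L2_Qform_integrable[OF assms(6)])
  have main: "IG = 2 * ID + (2 - ?N) / ?N * IT + IQ"
    unfolding IG_def ID_def IT_def IQ_def sqnorm_def norm_square_decomposition[of "G _"]
    using iD iT iQ by simp
  have IT0: "IT \<ge> 0" unfolding IT_def sqnorm_def by (rule integral_nonneg_AE) auto
  have DS: "ID \<le> IS" unfolding ID_def IS_def sqnorm_def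
    using iD iS by (intro integral_mono power_mono norm_dev_le) auto
  \<comment> \<open>Concavity is exactly the sign condition for \<sigma> = 1.\<close>
  have Q: "IQ \<le> 0"
    using H1_Qform_nonpos[OF P assms(1,3,4,5,6), of 1] assms(2) unfolding IQ_def pw_C2_concave_def by simp
  have neg: "(2 - ?N) / ?N * IT \<le> 0"
    using assms(1) IT0 by (intro mult_nonpos_nonneg divide_nonpos_nonneg) auto
  have GD: "IG \<le> 2 * ID" using main Q neg by linarith
  have 1: "sqrt IG \<le> sqrt 2 * sqrt ID" using GD by (simp add: real_sqrt_mult[symmetric])
  have 3: "sqrt IG \<le> sqrt 2 * sqrt IS" using GD DS by (simp add: real_sqrt_mult[symmetric])
  have 2: "IG = 2 * ID + (2 - ?N) / ?N * IT \<and> IG \<le> 2 * ID \<and> (IG = 2 * ID \<longleftrightarrow> IT = 0 \<or> CARD('n) = 2)"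
    if poly: "polyhedral_domain \<Omega> \<Gamma>1 \<nu>"
  proof -
    \<comment> \<open>The second fundamental form vanishes, so \<sigma> = -1 is admissible too, and
      the two signs together force \<open>IQ = 0\<close>.\<close>
    have "-1 * IQ \<le> 0" unfolding IQ_def
      by (rule H1_Qform_nonpos[OF P assms(1,3,4,5,6)]) (simp_all add: polyhedral_second_form_zero[OF poly])
    then have e: "IG = 2 * ID + (2 - ?N) / ?N * IT" using main Q by simp
    moreover have "(2 - ?N) / ?N * IT = 0 \<longleftrightarrow> IT = 0 \<or> CARD('n) = 2" using assms(1) by auto
    ultimately show ?thesis using GD by auto
  qed
  show ?thesis using 1 2 3 unfolding IG_def ID_def IS_def IT_def by blast
qed

end
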